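(* Let $G$ be a finitely generated group. If $G$ admits a virtual character, then $p_c(G) < 1$ unless $G$ contains a finite index infinite cyclic subgroup.
   Context: A character of a group $G$ is a non-trivial homomorphism from $G$ to $(\mathbb{R},+)$, the additive group of real numbers. A virtual character of $G$ is a character of some finite index subgroup of $G$. For a finitely generated group $G$ with unit element $1$ and a finite symmetric generating set $S$ of $G$, let $\Gamma = \Gamma(G,S)$ be the right Cayley graph: its vertices are the elements of $G$, and $x \sim y$ if $x^{-1}y \in S$. For $p \in [0,1]$, let $\mathbb{P}_p$ be the Bernoulli site percolation measure on $\Gamma$ with parameter $p$: each vertex is independently open with probability $p$ and closed otherwise, and one considers the connected components of the subgraph induced by the open vertices. The event $x \leftrightarrow \infty$ is that $x$ belongs to an infinite component. Define $$p_c(\Gamma) = \inf\{ p \in [0,1] : \mathbb{P}_p[1 \leftrightarrow \infty] > 0 \}.$$ Whether $p_c(\Gamma) < 1$ holds is invariant under quasi-isometries (a known fact), hence does not depend on the choice of the finite symmetric generating set $S$; "$p_c(G) < 1$" means that $p_c(\Gamma(G,S)) < 1$ for some (equivalently every) finite symmetric generating set $S$ of $G$. *)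

theory Defs
  imports "HOL-Algebra.Algebra" "HOL-Probability.Probability"
begin

definition symmetric_generating_set :: "('a, 'b) monoid_scheme \<Rightarrow> 'a set \<Rightarrow> bool" where
  "symmetric_generating_set G S \<longleftrightarrow>
     S \<subseteq> carrier G \<and> (\<forall>s\<in>S. inv\<^bsub>G\<^esub> s \<in> S) \<and> generate G S = carrier G"

definition finitely_generated :: "('a, 'b) monoid_scheme \<Rightarrow> bool" where
  "finitely_generated G \<longleftrightarrow> (\<exists>S. finite S \<and> S \<subseteq> carrier G \<and> generate G S = carrier G)"

definition finite_index_subgroup :: "'a set \<Rightarrow> ('a, 'b) monoid_scheme \<Rightarrow> bool" where
  "finite_index_subgroup H G \<longleftrightarrow> subgroup H G \<and> finite (rcosets\<^bsub>G\<^esub> H)"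

definition real_group :: "real monoid" where
  "real_group = \<lparr>carrier = UNIV, monoid.mult = (+), one = 0\<rparr>"

definition character :: "('a, 'b) monoid_scheme \<Rightarrow> ('a \<Rightarrow> real) \<Rightarrow> bool" where
  "character G f \<longleftrightarrow> f \<in> hom G real_group \<and> (\<exists>x\<in>carrier G. f x \<noteq> 0)"

definition admits_virtual_character :: "('a, 'b) monoid_scheme \<Rightarrow> bool" where
  "admits_virtual_character G \<longleftrightarrow>
     (\<exists>H f. finite_index_subgroup H G \<and> character (G\<lparr>carrier := H\<rparr>) f)"

(* The graph is given by its adjacency relation.  If S contains the unit, every vertex carries a
   loop, which has no influence on connectivity. *)
definition cayley_graph :: "('a, 'b) monoid_scheme \<Rightarrow> 'a set \<Rightarrow> ('a \<times> 'a) set" where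
  "cayley_graph G S =
     {(x, y). x \<in> carrier G \<and> y \<in> carrier G \<and> inv\<^bsub>G\<^esub> x \<otimes>\<^bsub>G\<^esub> y \<in> S}"

(* A configuration assigns True to the open vertices of V and False to the closed ones. *)
definition site_percolation :: "'v set \<Rightarrow> real \<Rightarrow> ('v \<Rightarrow> bool) measure" where
  "site_percolation V p = PiM V (\<lambda>_. measure_pmf (bernoulli_pmf p))"

(* Connected component of x in the subgraph of E induced by the open vertices; empty if x is
   closed. *)
definition open_cluster :: "('v \<times> 'v) set \<Rightarrow> ('v \<Rightarrow> bool) \<Rightarrow> 'v \<Rightarrow> 'v set" where
  "open_cluster E \<omega> x =
     (if \<omega> x then {y. (x, y) \<in> (E \<inter> {(u, v). \<omega> u \<and> \<omega> v})\<^sup>*} else {})"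

definition percolation_prob :: "'v set \<Rightarrow> ('v \<times> 'v) set \<Rightarrow> real \<Rightarrow> 'v \<Rightarrow> real" where
  "percolation_prob V E p x =
     measure (site_percolation V p)
       {\<omega> \<in> space (site_percolation V p). infinite (open_cluster E \<omega> x)}"

(* The infimum is taken in the extended reals, so that it is \<infinity> (and not an unspecified real) when
   no p percolates, i.e. for finite G. *)
definition p_c :: "('a, 'b) monoid_scheme \<Rightarrow> 'a set \<Rightarrow> ereal" where
  "p_c G S =
     Inf (ereal ` {p \<in> {0..1}. percolation_prob (carrier G) (cayley_graph G S) p \<one>\<^bsub>G\<^esub> > 0})"

end

theory Submission
  imports Defs
begin

text \<open>
  A character is used only to find an element \<open>t\<close> of infinite order. If \<open>\<langle>t\<rangle>\<close> has infinite index, the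
  ball of radius \<open>r\<close> meets more than \<open>r\<close> of its cosets and contains a long segment of each of them,
  so the group grows at least quadratically. By the Peierls argument it then suffices to show that
  at most \<open>L ^ n\<close> finite connected sets \<open>A\<close> contain the unit, have a complement without finite
  components, and have a boundary of size \<open>n\<close>.

  Put on the group long-range conductances that average the uniform distributions on balls of radius
  \<open>16 ^ k\<close> with weights \<open>64 ^ (- k)\<close>. They have a finite first moment, so the conductance across the
  boundary of \<open>A\<close> is at most a constant times \<open>n\<close>; and quadratic growth makes them uniformly transient.
  Consider the weighted rooted forests in a large finite set, grounded outside. Every such \<open>A\<close> is,
  with probability at least \<open>exp (- C n)\<close>, the set of descendants of one of its points. Since the sets of
  descendants that contain the unit form a chain, and their size is polynomial in \<open>n\<close> by isoperimetry,
  these events overlap only polynomially often, which bounds the number of sets \<open>A\<close>.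

  The lower bound on the probability compares the forest sum with that of the network in which the
  edges leaving \<open>A\<close> are grounded with strength \<open>s\<close>. Its logarithmic derivative in \<open>s\<close> is a
  weighted sum of Green's functions, which transience bounds by a constant times \<open>1 / sqrt s\<close>.
\<close>

text \<open>If the group is not finitely presented, boundaries of connected sets can fail to be
  coarsely connected, so they cannot be counted like lattice animals; each set is charged to a
  random object instead. Nearest-neighbour conductances would not do: with quadratic growth alone
  they may be recurrent, as on the square lattice. Long jumps buy transience, and the first moment
  keeps the price proportional to \<open>n\<close>. Cutting every edge between \<open>A\<close> and
  its complement would isolate \<open>A\<close>, so one edge, from \<open>a\<close> to
  \<open>b\<close>, is kept as the exit of the tree that fills \<open>A\<close>. With this single
  exit no uniform bound on the Green's function in \<open>A\<close> is available; transience helps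
  only once the whole cut is grounded. The interpolation in \<open>s\<close> joins the two
  situations, and it succeeds because \<open>1 / sqrt s\<close> is integrable at 0, unlike the
  trivial bound \<open>1 / s\<close>. The square root comes from layering: a high potential passes
  through many windows of values, transience forces a fixed amount of the grounding \<kappa> into
  each window, and all of it together absorbs at most the unit current.\<close>

section \<open>Rooted forests\<close>

text \<open>A forest is a partial map sending each vertex to its parent; a vertex \<open>x\<close> of \<open>V\<close> with
  \<open>f x = None\<close> points to the ground. Vertices outside \<open>V\<close> are mapped to \<open>None\<close> as well, but only
  those of \<open>V\<close> enter the weights.\<close>

definition forests :: "'v set \<Rightarrow> ('v \<Rightarrow> 'v option) set" where
  "forests V = {f. dom f \<subseteq> V \<and> ran f \<subseteq> V \<and> acyclic (Map.graph f)}"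

definition arrow_weight :: "('v \<Rightarrow> 'v \<Rightarrow> real) \<Rightarrow> ('v \<Rightarrow> real) \<Rightarrow> 'v \<Rightarrow> 'v option \<Rightarrow> real" where
  "arrow_weight c k x q = (case q of None \<Rightarrow> k x | Some y \<Rightarrow> c x y)"

definition forest_sum :: "'v set \<Rightarrow> ('v \<Rightarrow> 'v \<Rightarrow> real) \<Rightarrow> ('v \<Rightarrow> real) \<Rightarrow> real" where
  "forest_sum V c k = (\<Sum>f\<in>forests V. \<Prod>x\<in>V. arrow_weight c k x (f x))"

definition rooted_weight :: "'v set \<Rightarrow> ('v \<Rightarrow> 'v \<Rightarrow> real) \<Rightarrow> ('v \<Rightarrow> real) \<Rightarrow> 'v \<Rightarrow> ('v \<Rightarrow> 'v option) \<Rightarrow> real" where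
  "rooted_weight V c k x f = (\<Prod>z\<in>V-{x}. arrow_weight c k z (f z))"

text \<open>By the matrix-tree theorem \<open>forest_sum\<close> is the determinant of the Laplacian
  plus the diagonal matrix of \<open>k\<close>, and this is its cofactor belonging to
  \<open>x\<close> and \<open>y\<close>. The factor of \<open>x\<close> is left out of the weight,
  so the ground arrow at \<open>x\<close> costs nothing.\<close>

definition rooted_sum :: "'v set \<Rightarrow> ('v \<Rightarrow> 'v \<Rightarrow> real) \<Rightarrow> ('v \<Rightarrow> real) \<Rightarrow> 'v \<Rightarrow> 'v \<Rightarrow> real" where
  "rooted_sum V c k x y =
     (\<Sum>f | f \<in> forests V \<and> f x = None \<and> (y, x) \<in> (Map.graph f)\<^sup>*. rooted_weight V c k x f)"

lemma arrow_weight_simps [simp]: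
  "arrow_weight c k x None = k x" "arrow_weight c k x (Some y) = c x y"
  by (simp_all add: arrow_weight_def)

lemma finite_forests [simp]: "finite V \<Longrightarrow> finite (forests V)"
proof -
  assume "finite V"
  then have "finite (\<Union>D\<in>Pow V. {f. dom f = D \<and> ran f \<subseteq> V})"
    by (intro finite_UN_I finite_set_of_finite_maps) (auto intro: finite_subset)
  then show ?thesis
    by (rule rev_finite_subset) (auto simp: forests_def)
qed

lemma mem_graph_iff: "(x, y) \<in> Map.graph f \<longleftrightarrow> f x = Some y"
  by (auto simp: Map.graph_def)

lemma single_valued_graph: "single_valued (Map.graph f)"
  by (auto simp: single_valued_def mem_graph_iff)

text \<open>The path is followed up to its first visit to \<open>y\<close>; until then it uses no
  arrow at which the two maps can differ.\<close>

lemma graph_rtrancl_upd: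
  assumes "(a, b) \<in> (Map.graph g)\<^sup>*" "\<And>x. x \<noteq> y \<Longrightarrow> g x = f x"
  shows "(a, b) \<in> (Map.graph f)\<^sup>* \<or> (a, y) \<in> (Map.graph f)\<^sup>*"
  using assms(1)
proof (induction rule: converse_rtrancl_induct)
  case base
  then show ?case by simp
next
  case (step a a')
  show ?case
  proof (cases "a = y")
    case False
    then have "(a, a') \<in> Map.graph f"
      using step.hyps(1) assms(2) by (simp add: mem_graph_iff)
    then show ?thesis using step.IH by (meson converse_rtrancl_into_rtrancl)
  qed simp
qed

lemma graph_rtrancl_root:
  assumes "(x, y) \<in> (Map.graph f)\<^sup>*" "f x = None" shows "y = x"
  using assms by (cases rule: converse_rtranclE) (auto simp: mem_graph_iff)

lemma graph_rtrancl_step: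
  assumes "(y, x) \<in> (Map.graph f)\<^sup>*" "y \<noteq> x"
  shows "\<exists>p. f y = Some p \<and> (p, x) \<in> (Map.graph f)\<^sup>*"
  using assms by (cases rule: converse_rtranclE) (auto simp: mem_graph_iff)

lemma acyclic_no_return:
  assumes "acyclic (Map.graph f)" "f y = Some z"
  shows "(z, y) \<notin> (Map.graph f)\<^sup>*"
  using assms by (meson acyclic_def mem_graph_iff rtrancl_into_trancl2)

lemma forests_upd:
  assumes f: "f \<in> forests V" and y: "y \<in> V"
    and q: "q \<in> insert None (Some ` {z\<in>V. (z, y) \<notin> (Map.graph f)\<^sup>*})"
  shows "f(y := q) \<in> forests V"
proof (cases q)
  case None
  then have "Map.graph (f(y := q)) \<subseteq> Map.graph f"
    by (auto simp: graph_fun_upd_None)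
  then show ?thesis
    using f None by (auto simp: forests_def ran_def split: if_splits intro: acyclic_subset)
next
  case (Some z)
  then have z: "z \<in> V" "(z, y) \<notin> (Map.graph f)\<^sup>*"
    using q by auto
  have sub: "Map.graph (f(y := None)) \<subseteq> Map.graph f"
    by (auto simp: graph_fun_upd_None)
  then have "(z, y) \<notin> (Map.graph (f(y := None)))\<^sup>*"
    using z rtrancl_mono by blast
  moreover have "acyclic (Map.graph (f(y := None)))"
    using f sub by (auto simp: forests_def intro: acyclic_subset)
  ultimately have "acyclic (Map.graph (f(y \<mapsto> z)))"
    by simp
  then show ?thesis
    using f y z Some by (auto simp: forests_def ran_def split: if_splits)
qed

lemma rooted_weight_upd_same [simp]: "rooted_weight V c k x (f(x := q)) = rooted_weight V c k x f"
  unfolding rooted_weight_def by (rule prod.cong) auto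

lemma weight_eq_rooted_weight:
  assumes "finite V" "x \<in> V"
  shows "(\<Prod>z\<in>V. arrow_weight c k z (f z)) = arrow_weight c k x (f x) * rooted_weight V c k x f"
  unfolding rooted_weight_def using assms by (simp add: prod.remove)

lemma sum_insert_None:
  assumes "finite V"
  shows "(\<Sum>q\<in>insert None (Some ` V). h q) = h None + (\<Sum>z\<in>V. h (Some z) :: real)"
  using assms by (subst sum.insert) (auto simp: sum.reindex)

lemma sum_filter_weight:
  assumes "finite Q"
  shows "(\<Sum>q\<in>{q\<in>Q. P q}. a * w q) = a * (\<Sum>q\<in>Q. w q * of_bool (P q) :: real)"
proof -
  have "(\<Sum>q\<in>{q\<in>Q. P q}. a * w q) = (\<Sum>q\<in>Q. if P q then a * w q else 0)"
    using assms by (rule sum.inter_filter)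
  also have "\<dots> = (\<Sum>q\<in>Q. a * (w q * of_bool (P q)))"
    by (rule sum.cong) auto
  finally show ?thesis by (simp add: sum_distrib_left)
qed

lemma rooted_sum_self: 
  "rooted_sum V c k x x = (\<Sum>f | f \<in> forests V \<and> f x = None. rooted_weight V c k x f)"
  by (simp add: rooted_sum_def)

lemma rooted_sum_of_bool:
  assumes "finite V"
  shows "rooted_sum V c k x y = (\<Sum>f | f \<in> forests V \<and> f x = None.
           rooted_weight V c k x f * of_bool ((y, x) \<in> (Map.graph f)\<^sup>*))"
proof -
  have "rooted_sum V c k x y = (\<Sum>f\<in>{f\<in>{f. f \<in> forests V \<and> f x = None}. (y, x) \<in> (Map.graph f)\<^sup>*}.
          rooted_weight V c k x f)"
    by (simp add: rooted_sum_def conj_assoc)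
  also have "\<dots> = (\<Sum>f | f \<in> forests V \<and> f x = None.
           if (y, x) \<in> (Map.graph f)\<^sup>* then rooted_weight V c k x f else 0)"
    using assms by (subst sum.inter_filter) auto
  finally show ?thesis by (simp add: of_bool_def if_distrib cong: if_cong)
qed

text \<open>As a function of \<open>y\<close>, \<open>rooted_sum V c k x y / forest_sum V c k\<close> is the Green's function with pole
  \<open>x\<close>: the two lemmas below state its equation at \<open>x\<close> and elsewhere. The proofs redirect one arrow.\<close>

lemma Kirchhoff_root:
  assumes V: "finite V" and x: "x \<in> V"
  shows "(\<Sum>z\<in>V. c x z * (rooted_sum V c k x x - rooted_sum V c k x z)) + k x * rooted_sum V c k x x
          = forest_sum V c k"
proof -
  let ?T = "{f. f \<in> forests V \<and> f x = None}"
  let ?P = "rooted_weight V c k x"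
  let ?r = "\<lambda>f z. (z, x) \<in> (Map.graph f)\<^sup>*"
  let ?Q = "insert None (Some ` V)"
  let ?ok = "\<lambda>f q. \<forall>z. q = Some z \<longrightarrow> \<not> ?r f z"
  have fin: "finite ?T" using V by simp
  have "(\<Sum>z\<in>V. c x z * (rooted_sum V c k x x - rooted_sum V c k x z)) + k x * rooted_sum V c k x x
      = (\<Sum>z\<in>V. \<Sum>f\<in>?T. ?P f * (c x z * of_bool (\<not> ?r f z))) + (\<Sum>f\<in>?T. ?P f * k x)"
    unfolding rooted_sum_of_bool[OF V]
    by (auto simp: sum_distrib_left sum_subtractf[symmetric] algebra_simps intro!: sum.cong arg_cong2[where f="(+)"])
  also have "\<dots> = (\<Sum>f\<in>?T. ?P f * (k x + (\<Sum>z\<in>V. c x z * of_bool (\<not> ?r f z))))"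
    by (subst sum.swap) (simp add: sum_distrib_left algebra_simps sum.distrib)
  also have "\<dots> = (\<Sum>f\<in>?T. ?P f * (\<Sum>q\<in>?Q. arrow_weight c k x q * of_bool (?ok f q)))"
    using V by (subst sum_insert_None) auto
  also have "\<dots> = (\<Sum>f\<in>?T. \<Sum>q\<in>{q\<in>?Q. ?ok f q}. ?P f * arrow_weight c k x q)"
    using V by (subst sum_filter_weight) simp_all
  also have "\<dots> = (\<Sum>(f, q)\<in>(SIGMA f:?T. {q\<in>?Q. ?ok f q}). ?P f * arrow_weight c k x q)"
    using V by (subst sum.Sigma) auto
  also have "\<dots> = (\<Sum>g\<in>forests V. \<Prod>z\<in>V. arrow_weight c k z (g z))"
  \<comment> \<open>A pair is a forest rooted at \<open>x\<close> together with a new arrow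
    \<open>q\<close> for \<open>x\<close>. The excluded targets, those in the tree of
    \<open>x\<close>, are exactly the ones that would close a cycle, so every forest
    \<open>g\<close> arises once, with \<open>q\<close> its own arrow at \<open>x\<close>.\<close>
  proof (rule sum.reindex_bij_witness[where j = "\<lambda>(f, q). f(x := q)" and i = "\<lambda>g. (g(x := None), g x)"])
    fix g assume g: "g \<in> forests V"
    have "\<not> ?r (g(x := None)) z" if "g x = Some z" for z
    proof
      assume "?r (g(x := None)) z"
      moreover have "Map.graph (g(x := None)) \<subseteq> Map.graph g" by (auto simp: graph_fun_upd_None)
      ultimately have "?r g z" using rtrancl_mono by blast
      then show False using acyclic_no_return[of g x z] that g by (simp add: forests_def)
    qed
    moreover have "g x \<in> ?Q" 
      using g by (cases "g x") (auto simp: forests_def ran_def)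
    moreover have "g(x := None) \<in> forests V"
      using g x by (intro forests_upd) auto
    ultimately show "(g(x := None), g x) \<in> (SIGMA f:?T. {q\<in>?Q. ?ok f q})"
      by auto
  next
    fix a assume "a \<in> (SIGMA f:?T. {q\<in>?Q. ?ok f q})"
    then obtain f q where a: "a = (f, q)" "f \<in> ?T" "q \<in> ?Q" "?ok f q" by auto
    then have "q \<in> insert None (Some ` {z\<in>V. \<not> ?r f z})" by auto
    then show "(case a of (f, q) \<Rightarrow> f(x := q)) \<in> forests V"
      using a x by (auto intro!: forests_upd)
    show "(\<Prod>z\<in>V. arrow_weight c k z ((case a of (f, q) \<Rightarrow> f(x := q)) z)) = (case a of (f, q) \<Rightarrow> ?P f * arrow_weight c k x q)"
      using V x a by (simp add: weight_eq_rooted_weight del: fun_upd_apply) simp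
  qed (auto simp: fun_upd_idem)
  finally show ?thesis by (simp add: forest_sum_def)
qed

lemma Kirchhoff_other:
  assumes V: "finite V" and x: "x \<in> V" and y: "y \<in> V" "y \<noteq> x"
  shows "(\<Sum>z\<in>V. c y z * (rooted_sum V c k x y - rooted_sum V c k x z)) + k y * rooted_sum V c k x y = 0"
proof -
  let ?T = "{f. f \<in> forests V \<and> f x = None}"
  let ?P = "rooted_weight V c k x"
  let ?r = "\<lambda>f z. (z, x) \<in> (Map.graph f)\<^sup>*"
  let ?Q = "insert None (Some ` V)"
  let ?in = "\<lambda>f q. \<exists>z. q = Some z \<and> ?r f z"
  \<comment> \<open>A pair is a forest with a spare arrow at \<open>y\<close>. In \<open>?L\<close>
    the vertex \<open>y\<close> lies in the tree of \<open>x\<close> and the spare arrow does not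
    lead into that tree; in \<open>?R\<close> it is the other way round. \<open>?sw\<close>
    exchanges the arrow at \<open>y\<close> with the spare one, which maps \<open>?L\<close> and
    \<open>?R\<close> onto each other and preserves the weight.\<close>
  let ?L = "SIGMA f:{f\<in>?T. ?r f y}. {q\<in>?Q. \<not> ?in f q}"
  let ?R = "SIGMA f:{f\<in>?T. \<not> ?r f y}. {q\<in>?Q. ?in f q}"
  let ?w = "\<lambda>(f, q). ?P f * arrow_weight c k y q"
  let ?sw = "\<lambda>(f, q). (f(y := q), f y)"
  have fin: "finite ?T" using V by simp
  have sw: "?sw a \<in> ?R" if a: "a \<in> ?L" for a
  proof -
    obtain f q where fq: "a = (f, q)" "f \<in> forests V" "f x = None" "?r f y" "q \<in> ?Q" "\<not> ?in f q"
      using a by auto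
    obtain p where p: "f y = Some p" "?r f p"
      using graph_rtrancl_step[OF fq(4) y(2)] by blast
    have acyc: "acyclic (Map.graph f)" using fq by (simp add: forests_def)
    have nr: "(z, y) \<notin> (Map.graph f)\<^sup>*" if "q = Some z" for z
      
    proof
      assume "(z, y) \<in> (Map.graph f)\<^sup>*"
      then have "?r f z" using fq(4) by (rule rtrancl_trans)
      then show False using fq(6) that by simp
    qed
    then have "q \<in> insert None (Some ` {z\<in>V. (z, y) \<notin> (Map.graph f)\<^sup>*})"
      using fq(5) by blast
    then have g: "f(y := q) \<in> forests V"
      by (rule forests_upd[OF fq(2) y(1)])
    have "?r (f(y := q)) p"
    proof -
      have "?r (f(y := q)) p \<or> (p, y) \<in> (Map.graph (f(y := q)))\<^sup>*"
        using graph_rtrancl_upd[of p x f y "f(y := q)"] p(2) by simp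
      moreover have "(p, y) \<notin> (Map.graph (f(y := q)))\<^sup>*"
        using graph_rtrancl_upd[of p y "f(y := q)" y f] acyclic_no_return[of f y p, OF acyc p(1)] by auto
      ultimately show ?thesis by blast
    qed
    moreover have "\<not> ?r (f(y := q)) y"
    proof
      assume r: "?r (f(y := q)) y"
      then obtain z where z: "q = Some z" "?r (f(y := q)) z"
        using graph_rtrancl_step[OF r y(2)] by auto
      have "?r f z \<or> (z, y) \<in> (Map.graph f)\<^sup>*"
        using graph_rtrancl_upd[of z x "f(y := q)" y f] z by auto
      then have "?r f z" using rtrancl_trans[of z y "Map.graph f" x] fq(4) by argo
      with fq(6) z(1) show False by blast
    qed
    moreover have "p \<in> V" using p fq by (auto simp: forests_def ran_def)
    ultimately show ?thesis using fq g p y by auto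
  qed
  have sw': "?sw a \<in> ?L" if a: "a \<in> ?R" for a
  proof -
    obtain f z where fq: "a = (f, Some z)" "f \<in> forests V" "f x = None" "\<not> ?r f y" "z \<in> V" "?r f z"
      using a by auto
    have zy: "(z, y) \<notin> (Map.graph f)\<^sup>*"
    proof
      assume "(z, y) \<in> (Map.graph f)\<^sup>*"
      then have "(x, y) \<in> (Map.graph f)\<^sup>*"
        using single_valued_confluent[OF single_valued_graph fq(6)] fq(4) by blast
      then show False using graph_rtrancl_root[of x y f] fq(3) y(2) by blast
    qed
    have g: "f(y := Some z) \<in> forests V"
      using fq y zy by (intro forests_upd) auto
    have "?r (f(y := Some z)) z"
    proof -
      have "?r (f(y := Some z)) z \<or> (z, y) \<in> (Map.graph (f(y := Some z)))\<^sup>*"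
        using graph_rtrancl_upd[of z x f y "f(y := Some z)"] fq by auto
      moreover have "(z, y) \<notin> (Map.graph (f(y := Some z)))\<^sup>*"
        using graph_rtrancl_upd[of z y "f(y := Some z)" y f] zy by auto
      ultimately show ?thesis by blast
    qed
    then have "?r (f(y := Some z)) y"
      by (intro converse_rtrancl_into_rtrancl[of y z]) (simp_all add: mem_graph_iff)
    moreover have "\<not> ?r (f(y := Some z)) p" if "f y = Some p" for p
    proof
      assume "?r (f(y := Some z)) p"
      then have "?r f p \<or> (p, y) \<in> (Map.graph f)\<^sup>*"
        using graph_rtrancl_upd[of p x "f(y := Some z)" y f] by auto
      moreover have "(p, y) \<notin> (Map.graph f)\<^sup>*"
        using acyclic_no_return[of f y p] that fq by (simp add: forests_def)
      ultimately have "?r f p" by blast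
      then have "?r f y"
        using that by (intro converse_rtrancl_into_rtrancl[of y p]) (simp_all add: mem_graph_iff)
      then show False using fq(4) by blast
    qed
    moreover have "f y \<in> ?Q" using fq by (cases "f y") (auto simp: forests_def ran_def)
    ultimately show ?thesis using fq g y by auto
  qed
  have w: "?w (?sw a) = ?w a" for a
  proof (cases a)
    case (Pair f q)
    have "rooted_weight V c k x g = arrow_weight c k y (g y) * (\<Prod>z\<in>V-{x}-{y}. arrow_weight c k z (g z))" for g
      unfolding rooted_weight_def using V y by (intro prod.remove) auto
    moreover have "(\<Prod>z\<in>V-{x}-{y}. arrow_weight c k z ((f(y := q)) z)) = (\<Prod>z\<in>V-{x}-{y}. arrow_weight c k z (f z))"
      by (rule prod.cong) auto
    ultimately show ?thesis using Pair by simp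
  qed
  have LR: "sum ?w ?L = sum ?w ?R"
  proof (rule sum.reindex_bij_witness[where i = ?sw and j = ?sw])
    fix a assume "a \<in> ?L" then show "?sw a \<in> ?R" by (rule sw)
  next
    fix a assume "a \<in> ?R" then show "?sw a \<in> ?L" by (rule sw')
  next
    fix a show "?w (?sw a) = ?w a" by (rule w)
  qed (simp_all add: case_prod_unfold)
  have sumL: "sum ?w ?L = (\<Sum>f\<in>?T. ?P f * of_bool (?r f y) * (k y + (\<Sum>z\<in>V. c y z * of_bool (\<not> ?r f z))))"
  proof -
    have "sum ?w ?L = (\<Sum>f\<in>{f\<in>?T. ?r f y}. \<Sum>q\<in>{q\<in>?Q. \<not> ?in f q}. ?P f * arrow_weight c k y q)"
      using V fin by (subst sum.Sigma) auto
    also have "\<dots> = (\<Sum>f\<in>{f\<in>?T. ?r f y}. ?P f * (\<Sum>q\<in>?Q. arrow_weight c k y q * of_bool (\<not> ?in f q)))"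
      using V by (subst sum_filter_weight) simp_all
    also have "\<dots> = (\<Sum>f\<in>{f\<in>?T. ?r f y}. ?P f * (k y + (\<Sum>z\<in>V. c y z * of_bool (\<not> ?r f z))))"
      using V by (subst sum_insert_None) auto
    also have "\<dots> = (\<Sum>f\<in>?T. if ?r f y then ?P f * (k y + (\<Sum>z\<in>V. c y z * of_bool (\<not> ?r f z))) else 0)"
      using fin by (rule sum.inter_filter)
    also have "\<dots> = (\<Sum>f\<in>?T. ?P f * of_bool (?r f y) * (k y + (\<Sum>z\<in>V. c y z * of_bool (\<not> ?r f z))))"
      by (rule sum.cong) auto
    finally show ?thesis .
  qed
  have sumR: "sum ?w ?R = (\<Sum>f\<in>?T. ?P f * of_bool (\<not> ?r f y) * (\<Sum>z\<in>V. c y z * of_bool (?r f z)))"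
  proof -
    have "sum ?w ?R = (\<Sum>f\<in>{f\<in>?T. \<not> ?r f y}. \<Sum>q\<in>{q\<in>?Q. ?in f q}. ?P f * arrow_weight c k y q)"
      using V fin by (subst sum.Sigma) auto
    also have "\<dots> = (\<Sum>f\<in>{f\<in>?T. \<not> ?r f y}. ?P f * (\<Sum>q\<in>?Q. arrow_weight c k y q * of_bool (?in f q)))"
      using V by (subst sum_filter_weight) simp_all
    also have "\<dots> = (\<Sum>f\<in>{f\<in>?T. \<not> ?r f y}. ?P f * (\<Sum>z\<in>V. c y z * of_bool (?r f z)))"
      using V by (subst sum_insert_None) auto
    also have "\<dots> = (\<Sum>f\<in>?T. if \<not> ?r f y then ?P f * (\<Sum>z\<in>V. c y z * of_bool (?r f z)) else 0)"
      using fin by (rule sum.inter_filter)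
    also have "\<dots> = (\<Sum>f\<in>?T. ?P f * of_bool (\<not> ?r f y) * (\<Sum>z\<in>V. c y z * of_bool (?r f z)))"
      by (rule sum.cong) auto
    finally show ?thesis .
  qed
  let ?ob = "\<lambda>f z. of_bool (?r f z) :: real"
  have d: "c y z * (rooted_sum V c k x y - rooted_sum V c k x z)
      = (\<Sum>f\<in>?T. ?P f * (c y z * (?ob f y - ?ob f z)))" for z
    unfolding rooted_sum_of_bool[OF V] sum_subtractf[symmetric] sum_distrib_left
    by (rule sum.cong) (simp_all add: right_diff_distrib mult.left_commute)
  have e: "k y * rooted_sum V c k x y = (\<Sum>f\<in>?T. ?P f * (k y * ?ob f y))"
    unfolding rooted_sum_of_bool[OF V] sum_distrib_left
    by (rule sum.cong) (simp_all add: mult.left_commute)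
  have "(\<Sum>z\<in>V. c y z * (rooted_sum V c k x y - rooted_sum V c k x z)) + k y * rooted_sum V c k x y
      = (\<Sum>f\<in>?T. \<Sum>z\<in>V. ?P f * (c y z * (?ob f y - ?ob f z))) + (\<Sum>f\<in>?T. ?P f * (k y * ?ob f y))"
    unfolding d e by (subst sum.swap) (rule refl)
  also have "\<dots> = (\<Sum>f\<in>?T. ?P f * (k y * ?ob f y + (\<Sum>z\<in>V. c y z * (?ob f y - ?ob f z))))"
    unfolding sum.distrib[symmetric]
    by (rule sum.cong) (simp_all add: sum_distrib_left[symmetric] distrib_left)
  also have "\<dots> = (\<Sum>f\<in>?T. ?P f * of_bool (?r f y) * (k y + (\<Sum>z\<in>V. c y z * of_bool (\<not> ?r f z)))
        - ?P f * of_bool (\<not> ?r f y) * (\<Sum>z\<in>V. c y z * of_bool (?r f z)))"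
  proof (rule sum.cong[OF refl])
    fix f
    show "?P f * (k y * ?ob f y + (\<Sum>z\<in>V. c y z * (?ob f y - ?ob f z))) =
      ?P f * of_bool (?r f y) * (k y + (\<Sum>z\<in>V. c y z * of_bool (\<not> ?r f z)))
        - ?P f * of_bool (\<not> ?r f y) * (\<Sum>z\<in>V. c y z * of_bool (?r f z))"
    proof (cases "?r f y")
      case True
      have "(\<Sum>z\<in>V. c y z * (?ob f y - ?ob f z)) = (\<Sum>z\<in>V. c y z * of_bool (\<not> ?r f z))"
        using True by (intro sum.cong) (auto simp: of_bool_def)
      then show ?thesis using True by simp
    next
      case False
      have "(\<Sum>z\<in>V. c y z * (?ob f y - ?ob f z)) = - (\<Sum>z\<in>V. c y z * ?ob f z)"
        unfolding sum_negf[symmetric] using False by (intro sum.cong) (auto simp: of_bool_def)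
      then show ?thesis using False by simp
    qed
  qed
  also have "\<dots> = sum ?w ?L - sum ?w ?R"
    unfolding sumL sumR by (simp add: sum_subtractf)
  finally show ?thesis unfolding LR by simp
qed

section \<open>Green's functions and the forest sum of a network\<close>

text \<open>A forest of positive weight is grown one vertex at a time: \<open>grounded\<close>,
  applied to the vertices not yet used, yields one that can point to the ground or to a used vertex.
  No old arrow ends in the new vertex, so no cycle arises.\<close>

lemma forest_sum_pos:
  assumes V: "finite V" and c: "\<And>x y. x \<in> V \<Longrightarrow> y \<in> V \<Longrightarrow> 0 \<le> c x y"
    and k: "\<And>x. x \<in> V \<Longrightarrow> 0 \<le> k x"
    and grounded: "\<And>Y. Y \<subseteq> V \<Longrightarrow> Y \<noteq> {} \<Longrightarrow> \<exists>y\<in>Y. 0 < k y \<or> (\<exists>z\<in>V-Y. 0 < c y z)"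
  shows "0 < forest_sum V c k"
proof -
  have "\<exists>U f. U \<subseteq> V \<and> card U = n \<and> f \<in> forests U \<and> (\<forall>x\<in>U. 0 < arrow_weight c k x (f x))"
    if "n \<le> card V" for n
    using that
  proof (induction n)
    case 0
    have "Map.empty \<in> forests {}" by (auto simp: forests_def Map.graph_def acyclic_def)
    then show ?case by (intro exI[of _ "{}"] exI[of _ "Map.empty"]) auto
  next
    case (Suc n)
    then obtain U f where U: "U \<subseteq> V" "card U = n" "f \<in> forests U" "\<forall>x\<in>U. 0 < arrow_weight c k x (f x)"
      by auto
    have "V - U \<noteq> {}" using Suc.prems U by auto
    with grounded[of "V - U"] U(1) obtain y where y: "y \<in> V" "y \<notin> U"
        "0 < k y \<or> (\<exists>z\<in>U. 0 < c y z)" by auto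
    have fy: "f y = None" "f \<in> forests (insert y U)"
      using U(3) y(2) by (auto simp: forests_def)
    have "finite U" using U(1) V by (rule finite_subset)
    then have card: "card (insert y U) = Suc n" using U y by simp
    show ?case
    proof (cases "0 < k y")
      case True
      then show ?thesis
        using U fy y card by (intro exI[of _ "insert y U"] exI[of _ f]) auto
    next
      case False
      then obtain z where z: "z \<in> U" "0 < c y z" using y by auto
      have "(z, y) \<notin> (Map.graph f)\<^sup>*"
      proof
        assume "(z, y) \<in> (Map.graph f)\<^sup>*"
        then obtain p where "f p = Some y"
          using z y(2) by (cases rule: rtranclE) (auto simp: mem_graph_iff)
        then show False using U(3) y(2) by (auto simp: forests_def ran_def)
      qed
      then have "f(y := Some z) \<in> forests (insert y U)"
        using fy(2) z by (intro forests_upd) auto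
      moreover have "\<forall>x\<in>insert y U. 0 < arrow_weight c k x ((f(y := Some z)) x)"
        using U(4) z(2) y(2) by auto
      ultimately show ?thesis
        using U(1) y(1) card by blast
    qed
  qed
  from this[of "card V"] obtain U f where U: "U \<subseteq> V" "card U = card V" "f \<in> forests U"
    "\<forall>x\<in>U. 0 < arrow_weight c k x (f x)" by auto
  then have "U = V" using V by (simp add: card_subset_eq)
  then have f: "f \<in> forests V" "0 < (\<Prod>x\<in>V. arrow_weight c k x (f x))"
    using U by (auto intro: prod_pos)
  have "0 \<le> (\<Prod>x\<in>V. arrow_weight c k x (g x))" if "g \<in> forests V" for g
    using that c k by (intro prod_nonneg) (auto simp: arrow_weight_def forests_def ran_def split: option.split)
  then show ?thesis
    unfolding forest_sum_def using f V by (intro sum_pos2[of _ f]) auto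
qed

text \<open>Jacobi's formula for the derivative of a determinant. A weight depends on
  \<open>s\<close> only through its ground arrows, and removing the factor of a ground arrow at
  \<open>x\<close> leaves the weight rooted at \<open>x\<close>.\<close>

lemma forest_sum_derivative:
  assumes V: "finite V"
  shows "((\<lambda>s. forest_sum V c (\<lambda>x. k0 x + s * \<kappa> x)) has_real_derivative
           (\<Sum>x\<in>V. \<kappa> x * rooted_sum V c (\<lambda>x. k0 x + s * \<kappa> x) x x)) (at s)"
proof -
  let ?k = "\<lambda>s x. k0 x + s * \<kappa> x"
  have aw: "((\<lambda>s. arrow_weight c (?k s) x q) has_real_derivative (\<kappa> x * of_bool (q = None))) (at s)" for x q
    by (cases q) (auto intro!: derivative_eq_intros)
  have "((\<lambda>s. \<Prod>x\<in>V. arrow_weight c (?k s) x (f x)) has_real_derivative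
      (\<Sum>x\<in>V. \<kappa> x * of_bool (f x = None) * rooted_weight V c (?k s) x f)) (at s)" for f
    unfolding rooted_weight_def by (rule has_field_derivative_prod) (rule aw)
  then have "((\<lambda>s. forest_sum V c (?k s)) has_real_derivative
      (\<Sum>f\<in>forests V. \<Sum>x\<in>V. \<kappa> x * of_bool (f x = None) * rooted_weight V c (?k s) x f)) (at s)"
    unfolding forest_sum_def by (intro DERIV_sum)
  also have "(\<Sum>f\<in>forests V. \<Sum>x\<in>V. \<kappa> x * of_bool (f x = None) * rooted_weight V c (?k s) x f)
      = (\<Sum>x\<in>V. \<kappa> x * (\<Sum>f\<in>forests V. rooted_weight V c (?k s) x f * of_bool (f x = None)))"
    by (subst sum.swap) (simp add: sum_distrib_left mult_ac)
  also have "\<dots> = (\<Sum>x\<in>V. \<kappa> x * rooted_sum V c (?k s) x x)"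
  proof (rule sum.cong[OF refl])
    fix x
    have "(\<Sum>f\<in>forests V. rooted_weight V c (?k s) x f * of_bool (f x = None)) = rooted_sum V c (?k s) x x"
      using sum_filter_weight[OF finite_forests[OF V], where P = "\<lambda>f. f x = None" and a = 1 and w = "rooted_weight V c (?k s) x"]
      by (simp add: rooted_sum_self)
    then show "\<kappa> x * (\<Sum>f\<in>forests V. rooted_weight V c (?k s) x f * of_bool (f x = None))
       = \<kappa> x * rooted_sum V c (?k s) x x" by simp
  qed
  finally show ?thesis .
qed

lemma Green_identity:
  fixes c :: "'v \<Rightarrow> 'v \<Rightarrow> real"
  assumes "\<And>x y. x \<in> V \<Longrightarrow> y \<in> V \<Longrightarrow> c x y = c y x"
  shows "(\<Sum>y\<in>V. g y * (\<Sum>z\<in>V. c y z * (h y - h z)))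
       = (\<Sum>y\<in>V. \<Sum>z\<in>V. c y z * (g y - g z) * (h y - h z)) / 2"
proof -
  have 1: "(\<Sum>y\<in>V. g y * (\<Sum>z\<in>V. c y z * (h y - h z))) = (\<Sum>y\<in>V. \<Sum>z\<in>V. c y z * g y * (h y - h z))"
    by (simp add: sum_distrib_left mult_ac)
  have 2: "(\<Sum>y\<in>V. \<Sum>z\<in>V. c y z * g y * (h y - h z)) = (\<Sum>y\<in>V. \<Sum>z\<in>V. c y z * g z * (h z - h y))"
    by (subst sum.swap) (intro sum.cong refl, simp add: assms)
  have "(\<Sum>y\<in>V. \<Sum>z\<in>V. c y z * (g y - g z) * (h y - h z))
      = (\<Sum>y\<in>V. \<Sum>z\<in>V. c y z * g y * (h y - h z)) + (\<Sum>y\<in>V. \<Sum>z\<in>V. c y z * g z * (h z - h y))"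
    unfolding sum.distrib[symmetric] by (intro sum.cong refl) (simp add: algebra_simps)
  then show ?thesis using 1 2 by simp
qed

text \<open>\<open>k0\<close> is permanent grounding, and \<kappa> is switched on by a factor
  \<open>s\<close> between 0 and 1. \<open>transient\<close> bounds the Green's functions at
  \<open>s = 1\<close> only, while \<open>grounded\<close> refers to \<open>k0\<close> alone and so
  serves every \<open>s\<close>, including 0.\<close>

locale network =
  fixes V :: "'v set" and c :: "'v \<Rightarrow> 'v \<Rightarrow> real" and k0 \<kappa> :: "'v \<Rightarrow> real" and C c0 :: real
  assumes finite_V: "finite V"
    and c_sym: "\<And>x y. x \<in> V \<Longrightarrow> y \<in> V \<Longrightarrow> c x y = c y x"
    and c_nonneg: "\<And>x y. x \<in> V \<Longrightarrow> y \<in> V \<Longrightarrow> 0 \<le> c x y"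
    and k0_nonneg: "\<And>x. x \<in> V \<Longrightarrow> 0 \<le> k0 x"
    and \<kappa>_nonneg: "\<And>x. x \<in> V \<Longrightarrow> 0 \<le> \<kappa> x"
    and C_pos: "0 < C" and c0_pos: "0 < c0"
    and transient: "\<And>v z. z \<in> V \<Longrightarrow> (v z)\<^sup>2 \<le>
          C * ((\<Sum>y\<in>V. \<Sum>z\<in>V. c y z * (v y - v z)\<^sup>2) / 2 + (\<Sum>y\<in>V. (k0 y + \<kappa> y) * (v y)\<^sup>2))"
    and grounded: "\<And>Y. Y \<subseteq> V \<Longrightarrow> Y \<noteq> {} \<Longrightarrow> \<exists>y\<in>Y. c0 \<le> k0 y \<or> (\<exists>z\<in>V-Y. c0 \<le> c y z)"
begin

text \<open>The height of one window of potential values. \<open>32 * C\<close> lets the energy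
  apart from \<kappa> use up at most half of the transience inequality in
  \<open>window_mass\<close>; \<open>4 / c0\<close> makes a drop of half a window along an edge of
  conductance \<open>c0\<close> carry a current of at least 2, more than the unit injected.\<close>

definition width :: real where "width = max (32 * C) (4 / c0)"

lemma width: "width > 0" "32 * C \<le> width" "4 \<le> c0 * width"
proof -
  show "width > 0" "32 * C \<le> width" using C_pos by (auto simp: width_def less_max_iff_disj)
  have "4 / c0 \<le> width" by (simp add: width_def)
  then show "4 \<le> c0 * width" using c0_pos by (simp add: field_simps)
qed

section \<open>The Green's function with pole \<open>x\<close> under grounding of strength
  \<open>s\<close>\<close>

context
  fixes s :: real and u :: "'v \<Rightarrow> real" and x :: 'v
  assumes s: "0 < s" "s \<le> 1" and x: "x \<in> V" and u: "\<And>y. y \<in> V \<Longrightarrow> 0 \<le> u y"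
    and eq: "\<And>y. y \<in> V \<Longrightarrow> (\<Sum>z\<in>V. c y z * (u y - u z)) + (k0 y + s * \<kappa> y) * u y = of_bool (y = x)"
begin

lemma test_function:
  "(\<Sum>y\<in>V. \<Sum>z\<in>V. c y z * (g y - g z) * (u y - u z)) / 2 + (\<Sum>y\<in>V. (k0 y + s * \<kappa> y) * u y * g y) = g x"
proof -
  have "g x = (\<Sum>y\<in>V. g y * of_bool (y = x))"
    using x finite_V by (simp add: of_bool_def if_distrib cong: if_cong)
  also have "\<dots> = (\<Sum>y\<in>V. g y * ((\<Sum>z\<in>V. c y z * (u y - u z)) + (k0 y + s * \<kappa> y) * u y))"
    by (intro sum.cong refl) (simp only: eq)
  also have "\<dots> = (\<Sum>y\<in>V. g y * (\<Sum>z\<in>V. c y z * (u y - u z))) + (\<Sum>y\<in>V. (k0 y + s * \<kappa> y) * u y * g y)"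
    by (simp add: distrib_left sum.distrib mult_ac)
  finally show ?thesis using Green_identity[of V c g u] c_sym by simp
qed

lemma absorbed_mass: "s * (\<Sum>y\<in>V. \<kappa> y * u y) \<le> 1"
proof -
  have "(\<Sum>y\<in>V. (k0 y + s * \<kappa> y) * u y) = 1"
    using test_function[of "\<lambda>_. 1"] by simp
  moreover have "s * (\<Sum>y\<in>V. \<kappa> y * u y) \<le> (\<Sum>y\<in>V. (k0 y + s * \<kappa> y) * u y)"
    unfolding sum_distrib_left using u k0_nonneg by (intro sum_mono) (simp add: algebra_simps)
  ultimately show ?thesis by simp
qed

text \<open>The current through a level set of the potential is at most 1, so along edges of conductance
  at least \<open>c0\<close> the potential cannot jump over half a window.\<close>

lemma intermediate_value:
  assumes a: "0 \<le> a" "a + width \<le> u x"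
  shows "\<exists>z\<in>V. a + width / 4 \<le> u z \<and> u z \<le> a + 3 * width / 4"
proof (rule ccontr)
  assume no: "\<not> ?thesis"
  define Y where "Y = {y\<in>V. a + width / 4 \<le> u y}"
  \<comment> \<open>Tested with the indicator of \<open>Y\<close>, the equation says that the
    current leaving \<open>Y\<close> plus the absorption in \<open>Y\<close> equals 1. All terms are
    nonnegative, since \<open>u\<close> is larger on \<open>Y\<close> than off it, so one large term
    is a contradiction.\<close>
  define g where "g y = (of_bool (y \<in> Y) :: real)" for y
  have big: "u y > a + 3 * width / 4" if "y \<in> Y" for y
    using no that by (force simp: Y_def)
  have small: "u y < a + width / 4" if "y \<in> V" "y \<notin> Y" for y
    using that by (force simp: Y_def)
  have xY: "x \<in> Y" using a x width by (auto simp: Y_def)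
  have nn: "0 \<le> c y z * (g y - g z) * (u y - u z)" if "y \<in> V" "z \<in> V" for y z
    using that big[of y] big[of z] small[of y] small[of z] width(1) c_nonneg[of y z]
    by (cases "y \<in> Y"; cases "z \<in> Y") (auto simp: g_def mult_nonneg_nonpos)
  have kn: "0 \<le> (k0 y + s * \<kappa> y) * u y * g y" if "y \<in> V" for y
    using that u k0_nonneg \<kappa>_nonneg s by (auto simp: g_def)
  have one: "(\<Sum>y\<in>V. \<Sum>z\<in>V. c y z * (g y - g z) * (u y - u z)) / 2 + (\<Sum>y\<in>V. (k0 y + s * \<kappa> y) * u y * g y) = 1"
    using test_function[of g] xY by (simp add: g_def)
  obtain y where y: "y \<in> Y" "c0 \<le> k0 y \<or> (\<exists>z\<in>V-Y. c0 \<le> c y z)"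
    using grounded[of Y] xY by (auto simp: Y_def)
  have yV: "y \<in> V" using y by (simp add: Y_def)
  from y(2) show False
  proof
    assume k: "c0 \<le> k0 y"
    have "c0 * (3 * width / 4) \<le> k0 y * u y"
      using k c0_pos width a big[OF y(1)] by (intro mult_mono) auto
    also have "\<dots> \<le> (k0 y + s * \<kappa> y) * u y * g y"
      using y yV u \<kappa>_nonneg s by (simp add: g_def distrib_right)
    also have "\<dots> \<le> (\<Sum>y\<in>V. (k0 y + s * \<kappa> y) * u y * g y)"
      using kn finite_V yV by (intro member_le_sum) auto
    also have "\<dots> \<le> 1"
      using one nn by (smt (verit, best) divide_nonneg_nonneg sum_nonneg)
    finally show False using width(3) by simp
  next
    assume "\<exists>z\<in>V-Y. c0 \<le> c y z"
    then obtain z where z: "z \<in> V" "z \<notin> Y" "c0 \<le> c y z" by auto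
    let ?t = "\<lambda>(y, z). c y z * (g y - g z) * (u y - u z)"
    have yz: "(y, z) \<noteq> (z, y)" using y z by auto
    have "c0 * (width / 2) \<le> c y z * (u y - u z)"
      using z(3) c0_pos width(1) big[OF y(1)] small[OF z(1,2)] by (intro mult_mono) auto
    also have "\<dots> = (sum ?t {(y, z), (z, y)}) / 2"
      using yz y z yV c_sym[of y z] by (simp add: g_def algebra_simps)
    also have "\<dots> \<le> sum ?t (V \<times> V) / 2"
      using nn finite_V yV z by (intro divide_right_mono sum_mono2) auto
    also have "\<dots> \<le> 1"
      using one kn sum_nonneg[of V "\<lambda>y. (k0 y + s * \<kappa> y) * u y * g y"]
      by (simp add: sum.cartesian_product[symmetric])
    finally show False using width(3) by simp
  qed
qed

text \<open>The tent function \<open>v\<close> of \<open>u\<close> lives on the window and reaches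
  \<open>width / 4\<close> somewhere by \<open>intermediate_value\<close>. Its energy apart from
  \<kappa> is at most \<open>width\<close>, by the equation tested with the truncation
  \<open>\<psi>\<close> of \<open>u\<close>. Transience at full grounding can then hold only if the
  window contains a fixed amount of \<kappa>.\<close>

lemma window_mass:
  assumes a: "0 \<le> a" "a + width \<le> u x"
  shows "1 / (8 * C) \<le> (\<Sum>z | z \<in> V \<and> a < u z \<and> u z < a + width. \<kappa> z)"
proof -
  define \<psi> where "\<psi> p = min width (max 0 (p - a))" for p
  define v where "v y = min (\<psi> (u y)) (width - \<psi> (u y))" for y
  let ?W = "{z \<in> V. a < u z \<and> u z < a + width}"
  have \<psi>: "0 \<le> \<psi> p" "\<psi> p \<le> width" for p using width(1) by (auto simp: \<psi>_def)
  have v0: "0 \<le> v y" "v y \<le> width / 2" for y unfolding v_def using \<psi>[of "u y"] by linarith+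
  obtain z where z: "z \<in> V" "a + width / 4 \<le> u z" "u z \<le> a + 3 * width / 4"
    using intermediate_value[OF a] by auto
  have "width / 4 \<le> v z" using z width(1) by (auto simp: v_def \<psi>_def)
  then have vz: "(width / 4)\<^sup>2 \<le> (v z)\<^sup>2" using width(1) by (intro power_mono) auto
  have "(v y - v y')\<^sup>2 \<le> (\<psi> (u y) - \<psi> (u y')) * (u y - u y')" for y y'
  proof -
    have "\<bar>v y - v y'\<bar> \<le> \<bar>\<psi> (u y) - \<psi> (u y')\<bar>" unfolding v_def by linarith
    moreover have "\<bar>\<psi> (u y) - \<psi> (u y')\<bar> \<le> \<bar>u y - u y'\<bar>" unfolding \<psi>_def by linarith
    ultimately have "\<bar>v y - v y'\<bar> * \<bar>v y - v y'\<bar> \<le> \<bar>\<psi> (u y) - \<psi> (u y')\<bar> * \<bar>u y - u y'\<bar>"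
      by (intro mult_mono) auto
    moreover have "\<bar>\<psi> (u y) - \<psi> (u y')\<bar> * \<bar>u y - u y'\<bar> = (\<psi> (u y) - \<psi> (u y')) * (u y - u y')"
    proof (cases "u y \<le> u y'")
      case True
      then have "\<psi> (u y) \<le> \<psi> (u y')" unfolding \<psi>_def by linarith
      then show ?thesis using True by (simp add: algebra_simps)
    next
      case False
      then have "\<psi> (u y') \<le> \<psi> (u y)" unfolding \<psi>_def by linarith
      then show ?thesis using False by (simp add: abs_mult[symmetric])
    qed
    ultimately show ?thesis by (simp add: power2_eq_square abs_mult_self_eq)
  qed
  then have E: "(\<Sum>y\<in>V. \<Sum>z\<in>V. c y z * (v y - v z)\<^sup>2)
      \<le> (\<Sum>y\<in>V. \<Sum>z\<in>V. c y z * (\<psi> (u y) - \<psi> (u z)) * (u y - u z))"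
    using c_nonneg by (intro sum_mono) (simp add: mult_left_mono mult.assoc)
  have K: "(\<Sum>y\<in>V. k0 y * (v y)\<^sup>2) \<le> (\<Sum>y\<in>V. (k0 y + s * \<kappa> y) * u y * \<psi> (u y))"
  proof (rule sum_mono)
    fix y assume y: "y \<in> V"
    have "v y \<le> \<psi> (u y)" "\<psi> (u y) \<le> u y"
      using u[OF y] a(1) width(1) by (auto simp: v_def \<psi>_def)
    then have "(v y)\<^sup>2 \<le> u y * \<psi> (u y)"
      unfolding power2_eq_square using v0[of y] by (intro mult_mono) auto
    then have "k0 y * (v y)\<^sup>2 \<le> k0 y * (u y * \<psi> (u y))" using k0_nonneg[OF y] by (rule mult_left_mono)
    also have "\<dots> \<le> (k0 y + s * \<kappa> y) * (u y * \<psi> (u y))"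
      using s \<kappa>_nonneg[OF y] u[OF y] \<psi> by (intro mult_right_mono) auto
    finally show "k0 y * (v y)\<^sup>2 \<le> (k0 y + s * \<kappa> y) * u y * \<psi> (u y)" by (simp add: mult.assoc)
  qed
  have EK: "(\<Sum>y\<in>V. \<Sum>z\<in>V. c y z * (v y - v z)\<^sup>2) / 2 + (\<Sum>y\<in>V. k0 y * (v y)\<^sup>2) \<le> width"
    using E K test_function[of "\<lambda>y. \<psi> (u y)"] \<psi>(2)[of "u x"] by linarith
  have "(\<Sum>y\<in>V. \<kappa> y * (v y)\<^sup>2) \<le> (\<Sum>y\<in>V. if y \<in> ?W then \<kappa> y * (width\<^sup>2 / 4) else 0)"
  proof (rule sum_mono)
    fix y assume y: "y \<in> V"
    have "v y = 0" if "y \<notin> ?W"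
      using that y width(1) by (auto simp: v_def \<psi>_def)
    moreover have "(v y)\<^sup>2 \<le> width\<^sup>2 / 4"
      using power_mono[OF v0(2) v0(1), of y 2] by (simp add: power_divide)
    ultimately show "\<kappa> y * (v y)\<^sup>2 \<le> (if y \<in> ?W then \<kappa> y * (width\<^sup>2 / 4) else 0)"
      using mult_left_mono[OF _ \<kappa>_nonneg[OF y]] by (cases "y \<in> ?W") (simp_all only: if_True if_False, simp)
  qed
  also have "\<dots> = (\<Sum>y\<in>?W. \<kappa> y * (width\<^sup>2 / 4))"
    using finite_V by (subst sum.inter_filter[symmetric]) (auto intro!: sum.cong)
  also have "\<dots> = (\<Sum>y\<in>?W. \<kappa> y) * (width\<^sup>2 / 4)" by (simp add: sum_distrib_right)
  finally have \<kappa>v: "(\<Sum>y\<in>V. \<kappa> y * (v y)\<^sup>2) \<le> (\<Sum>y\<in>?W. \<kappa> y) * (width\<^sup>2 / 4)" .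
  have "(width / 4)\<^sup>2 \<le> C * ((\<Sum>y\<in>V. \<Sum>z\<in>V. c y z * (v y - v z)\<^sup>2) / 2 + (\<Sum>y\<in>V. (k0 y + \<kappa> y) * (v y)\<^sup>2))"
    using transient[OF z(1), of v] vz by linarith
  also have "\<dots> \<le> C * (width + (\<Sum>y\<in>?W. \<kappa> y) * (width\<^sup>2 / 4))"
    using EK \<kappa>v C_pos by (intro mult_left_mono) (auto simp: distrib_right sum.distrib)
  finally have main: "width * width \<le> 16 * C * width + 4 * C * (\<Sum>y\<in>?W. \<kappa> y) * (width * width)"
    by (simp add: power2_eq_square algebra_simps)
  have "32 * C * width \<le> width * width" using width by (intro mult_right_mono) auto
  then have "width * width * 1 \<le> width * width * (8 * C * (\<Sum>y\<in>?W. \<kappa> y))"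
    using main by (simp add: algebra_simps)
  then have "1 \<le> 8 * C * (\<Sum>y\<in>?W. \<kappa> y)"
    using width(1) by (subst (asm) mult_le_cancel_left_pos) auto
  then show ?thesis using C_pos by (simp add: field_simps)
qed

text \<open>About \<open>u x / width\<close> disjoint windows are stacked below \<open>u x\<close>.
  Window \<open>j\<close> holds \<kappa>-mass at least \<open>1 / (8 * C)\<close> at potential above
  \<open>j * width\<close>, so the sum of \<kappa> times \<open>u\<close> grows like the square of
  the number of windows, whereas \<open>absorbed_mass\<close> limits it to
  \<open>1 / s\<close>.\<close>

lemma potential_bound: "u x \<le> 3 * width / sqrt s"
proof -
  define J where "J = nat \<lfloor>u x / width\<rfloor>"
  have J: "real J * width \<le> u x" "u x \<le> (real J + 1) * width"
  proof -
    have "0 \<le> u x / width" using u[OF x] width(1) by simp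
    then have "real J \<le> u x / width" "u x / width \<le> real J + 1"
      unfolding J_def by linarith+
    then show "real J * width \<le> u x" "u x \<le> (real J + 1) * width"
      using width(1) by (simp_all add: field_simps)
  qed
  let ?in = "\<lambda>z j. real j * width < u z \<and> u z < real j * width + width"
  have one: "(\<Sum>j<J. if ?in z j then real j * width else 0) \<le> u z" if z: "z \<in> V" for z
  proof (cases "\<exists>j. ?in z j")
    case True
    then obtain j where j: "?in z j" by auto
    have uniq: "i = j" if "?in z i" for i
    proof -
      have "real i * width < (real j + 1) * width" "real j * width < (real i + 1) * width"
        using j that by (auto simp: algebra_simps)
      then show ?thesis using width(1) by (simp add: mult_less_cancel_right)
    qed
    have "(\<Sum>j<J. if ?in z j then real j * width else 0) \<le> (\<Sum>i<J. if i = j then real j * width else 0)"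
    proof (rule sum_mono)
      fix i
      have "0 \<le> real j * width" using width(1) by simp
      then show "(if ?in z i then real i * width else 0) \<le> (if i = j then real j * width else 0)"
      proof (cases "?in z i")
        case True
        then show ?thesis using uniq[OF True] by simp
      next
        case False
        then show ?thesis using \<open>0 \<le> real j * width\<close> by (subst if_not_P[OF False]) auto
      qed
    qed
    also have "\<dots> \<le> u z" using j u[OF z] by (simp add: less_imp_le)
    finally show ?thesis .
  next
    case False
    then have "(\<Sum>j<J. if ?in z j then real j * width else 0) = (\<Sum>j<J. 0)"
      by (intro sum.cong refl if_not_P) blast
    then show ?thesis using u[OF z] by simp
  qed
  have "(\<Sum>j<J. 4 * real j) \<le> (\<Sum>j<J. (\<Sum>z | z \<in> V \<and> ?in z j. \<kappa> z) * (real j * width))"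
  proof (rule sum_mono)
    fix j assume "j \<in> {..<J}"
    then have "real j + 1 \<le> real J" by auto
    then have "(real j + 1) * width \<le> u x" using J(1) width(1)
      by (meson less_imp_le mult_right_mono order_trans)
    then have m: "1 / (8 * C) \<le> (\<Sum>z | z \<in> V \<and> ?in z j. \<kappa> z)"
      using window_mass[of "real j * width"] width(1) by (simp add: distrib_right)
    have "4 * real j = 1 / (8 * C) * (real j * (32 * C))" using C_pos by simp
    also have "\<dots> \<le> 1 / (8 * C) * (real j * width)"
      using width C_pos by (intro mult_left_mono) auto
    also have "\<dots> \<le> (\<Sum>z | z \<in> V \<and> ?in z j. \<kappa> z) * (real j * width)"
      using m width by (intro mult_right_mono) auto
    finally show "4 * real j \<le> (\<Sum>z | z \<in> V \<and> ?in z j. \<kappa> z) * (real j * width)" .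
  qed
  also have "\<dots> = (\<Sum>j<J. \<Sum>z\<in>V. \<kappa> z * (if ?in z j then real j * width else 0))"
  proof (rule sum.cong[OF refl])
    fix j
    have "(\<Sum>z | z \<in> V \<and> ?in z j. \<kappa> z) * (real j * width) = (\<Sum>z\<in>{z\<in>V. ?in z j}. (real j * width) * \<kappa> z)"
      by (simp only: sum_distrib_left[symmetric] mult.commute[of _ "real j * width"])
    also have "\<dots> = (\<Sum>z\<in>V. if ?in z j then (real j * width) * \<kappa> z else 0)"
      using finite_V by (rule sum.inter_filter)
    also have "\<dots> = (\<Sum>z\<in>V. \<kappa> z * (if ?in z j then real j * width else 0))"
      by (rule sum.cong) auto
    finally show "(\<Sum>z | z \<in> V \<and> ?in z j. \<kappa> z) * (real j * width)
        = (\<Sum>z\<in>V. \<kappa> z * (if ?in z j then real j * width else 0))" .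
  qed
  also have "\<dots> = (\<Sum>z\<in>V. \<kappa> z * (\<Sum>j<J. if ?in z j then real j * width else 0))"
    by (subst sum.swap) (simp add: sum_distrib_left)
  also have "\<dots> \<le> (\<Sum>z\<in>V. \<kappa> z * u z)"
    using one \<kappa>_nonneg by (intro sum_mono mult_left_mono)
  finally have le: "(\<Sum>j<J. 4 * real j) \<le> (\<Sum>z\<in>V. \<kappa> z * u z)" .
  have "(\<Sum>j<n. 4 * real j) = 2 * real n * (real n - 1)" for n
    by (induction n) (simp_all add: algebra_simps)
  then have "s * (2 * real J * (real J - 1)) \<le> 1"
    using absorbed_mass mult_left_mono[OF le less_imp_le[OF s(1)]] by (simp only:)
  moreover have "(real J - 1)\<^sup>2 \<le> 2 * real J * (real J - 1)" if "J \<noteq> 0"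
  proof -
    have "(real J - 1) * (real J - 1) \<le> (2 * real J) * (real J - 1)"
      using that by (intro mult_right_mono) auto
    then show ?thesis by (simp add: power2_eq_square)
  qed
  ultimately have "s * (real J - 1)\<^sup>2 \<le> 1" if "J \<noteq> 0"
    using s that by (smt (verit, best) mult_left_mono)
  then have "(real J - 1)\<^sup>2 \<le> (1 / sqrt s)\<^sup>2" if "J \<noteq> 0"
    using s that by (simp add: field_simps power_divide)
  then have "real J - 1 \<le> 1 / sqrt s"
    using s by (cases "J = 0") (auto intro: power2_le_imp_le)
  moreover have "1 \<le> 1 / sqrt s" using s by simp
  ultimately have "real J + 1 \<le> 3 / sqrt s" by simp
  then have "(real J + 1) * width \<le> 3 / sqrt s * width" using width(1) by (intro mult_right_mono) auto
  then show ?thesis using J(2) by simp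
qed

end

lemma positive: 
  assumes "0 \<le> s" shows "0 < forest_sum V c (\<lambda>x. k0 x + s * \<kappa> x)"
proof (rule forest_sum_pos[OF finite_V c_nonneg])
  show "0 \<le> k0 x + s * \<kappa> x" if "x \<in> V" for x using that assms k0_nonneg \<kappa>_nonneg by simp
  fix Y assume Y: "Y \<subseteq> V" "Y \<noteq> {}"
  then obtain y where y: "y \<in> Y" "c0 \<le> k0 y \<or> (\<exists>z\<in>V-Y. c0 \<le> c y z)" using grounded by blast
  have "0 \<le> s * \<kappa> y" using y Y assms \<kappa>_nonneg by auto
  then show "\<exists>y\<in>Y. 0 < k0 y + s * \<kappa> y \<or> (\<exists>z\<in>V-Y. 0 < c y z)"
    using y c0_pos by (intro bexI[of _ y]) force+
qed

lemma rooted_sum_le: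
  assumes s: "0 < s" "s \<le> 1" and x: "x \<in> V"
  shows "rooted_sum V c (\<lambda>x. k0 x + s * \<kappa> x) x x \<le> 3 * width / sqrt s * forest_sum V c (\<lambda>x. k0 x + s * \<kappa> x)"
proof -
  let ?k = "\<lambda>x. k0 x + s * \<kappa> x"
  let ?Z = "forest_sum V c ?k"
  let ?u = "\<lambda>y. rooted_sum V c ?k x y / ?Z"
  have Z: "0 < ?Z" using positive s by simp
  have "0 \<le> rooted_weight V c ?k x f" if "f \<in> forests V" for f
    using that c_nonneg k0_nonneg \<kappa>_nonneg s unfolding rooted_weight_def
    by (intro prod_nonneg) (auto simp: arrow_weight_def forests_def ran_def split: option.split)
  then have "0 \<le> rooted_sum V c ?k x y" for y
    unfolding rooted_sum_def by (intro sum_nonneg) auto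
  then have u: "0 \<le> ?u y" for y using Z by simp
  have "(\<Sum>z\<in>V. c y z * (?u y - ?u z)) + ?k y * ?u y
      = ((\<Sum>z\<in>V. c y z * (rooted_sum V c ?k x y - rooted_sum V c ?k x z)) + ?k y * rooted_sum V c ?k x y) / ?Z" for y
    by (simp add: diff_divide_distrib[symmetric] sum_divide_distrib add_divide_distrib)
  then have eq: "(\<Sum>z\<in>V. c y z * (?u y - ?u z)) + ?k y * ?u y = of_bool (y = x)" if "y \<in> V" for y
    using Kirchhoff_root[OF finite_V x, of c ?k] Kirchhoff_other[OF finite_V x, of y c ?k] Z that
    by (cases "y = x") auto
  have "?u x \<le> 3 * width / sqrt s"
    by (rule potential_bound[OF s x u eq])
  then show ?thesis using Z by (simp add: field_simps)
qed

text \<open>The logarithmic derivative is integrated from 0 to 1: the bound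
  \<open>3 * width / sqrt s\<close> has the primitive \<open>6 * width * sqrt s\<close>. As the
  bound blows up at 0, monotonicity of \<open>?h\<close> is drawn from the open interval and
  continuity.\<close>

theorem forest_sum_le:
  "forest_sum V c (\<lambda>x. k0 x + \<kappa> x) \<le> exp (6 * width * (\<Sum>x\<in>V. \<kappa> x)) * forest_sum V c k0"
proof -
  define D where "D s = forest_sum V c (\<lambda>x. k0 x + s * \<kappa> x)" for s
  define K where "K = (\<Sum>x\<in>V. \<kappa> x)"
  define D' where "D' s = (\<Sum>x\<in>V. \<kappa> x * rooted_sum V c (\<lambda>x. k0 x + s * \<kappa> x) x x)" for s
  let ?h = "\<lambda>s. ln (D s) - 6 * width * K * sqrt s"
  have pos: "0 < D s" if "0 \<le> s" for s using positive that by (simp add: D_def)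
  have D: "(D has_real_derivative D' s) (at s)" for s
    unfolding D_def D'_def using forest_sum_derivative[OF finite_V] .
  have D'le: "D' s \<le> K * (3 * width / sqrt s) * D s" if "0 < s" "s < 1" for s
  proof -
    have "D' s \<le> (\<Sum>x\<in>V. \<kappa> x * (3 * width / sqrt s * D s))"
      unfolding D'_def D_def
      using rooted_sum_le[of s] that \<kappa>_nonneg by (intro sum_mono mult_left_mono) auto
    also have "\<dots> = K * (3 * width / sqrt s) * D s"
      unfolding K_def by (simp only: sum_distrib_right mult.assoc)
    finally show ?thesis .
  qed
  have "?h 1 \<le> ?h 0"
  proof (rule DERIV_nonpos_imp_decreasing_open[where f = ?h and a = 0 and b = 1])
    show "(0::real) \<le> 1" by simp
  next
    fix s :: real assume s: "0 < s" "s < 1"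
    have "(?h has_real_derivative (D' s / D s - 6 * width * K * (inverse (sqrt s) / 2))) (at s)"
    proof -
      have "((\<lambda>s. ln (D s)) has_real_derivative (1 / D s * D' s)) (at s)"
        using s pos[of s] by (intro DERIV_chain2[OF DERIV_ln_divide D]) auto
      from DERIV_diff[OF this DERIV_cmult[OF DERIV_real_sqrt[OF s(1)], of "6 * width * K"]]
      show ?thesis by simp
    qed
    moreover have "D' s / D s \<le> 6 * width * K * (inverse (sqrt s) / 2)"
    proof -
      have "D' s / D s \<le> K * (3 * width / sqrt s)"
        using D'le[OF s] pos_divide_le_eq[OF pos[of s]] s(1) by auto
      moreover have "K * (3 * width / sqrt s) = 6 * width * K * (inverse (sqrt s) / 2)"
        unfolding divide_inverse[of _ "sqrt s"] by simp
      ultimately show ?thesis by argo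
    qed
    ultimately show "\<exists>y. (?h has_real_derivative y) (at s) \<and> y \<le> 0"
      by (intro exI[of _ "D' s / D s - 6 * width * K * (inverse (sqrt s) / 2)"]) simp
  next
    have "continuous_on {0..1} D"
      by (rule DERIV_continuous_on[OF has_field_derivative_at_within[OF D]])
    then show "continuous_on {0..1} ?h"
      using pos by (intro continuous_on_diff continuous_on_ln continuous_on_mult continuous_on_real_sqrt
          continuous_on_const continuous_on_id) (auto simp: less_le)
  qed
  then have "ln (D 1) \<le> 6 * width * K + ln (D 0)" by simp
  then have "D 1 \<le> exp (6 * width * K + ln (D 0))"
    using pos[of 1] by (metis exp_le_cancel_iff exp_ln zero_le_one)
  then have "D 1 \<le> exp (6 * width * K) * D 0" using pos[of 0] by (simp add: exp_add)
  then show ?thesis by (simp add: D_def K_def)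
qed

end

section \<open>Transience from smoothing kernels\<close>

lemma nonneg_quadratic_discriminant:
  fixes a b c :: real
  assumes nn: "\<And>t. 0 \<le> a + 2 * b * t + c * t\<^sup>2"
  shows "b\<^sup>2 \<le> a * c"
proof (cases "c = 0")
  case True
  have "b = 0"
  proof (rule ccontr)
    assume "b \<noteq> 0"
    then have "2 * b * (- (a + 1) / (2 * b)) = - (a + 1)" by simp
    then show False using nn[of "- (a + 1) / (2 * b)"] True by simp
  qed
  then show ?thesis using True by simp
next
  case False
  have c: "0 < c"
  proof (rule ccontr)
    assume "\<not> 0 < c"
    then have c: "c < 0" using False by simp
    define t where "t = (\<bar>a\<bar> + 2 * \<bar>b\<bar> + 1) / (- c) + 1"
    have "0 \<le> (\<bar>a\<bar> + 2 * \<bar>b\<bar> + 1) / (- c)" using c by (intro divide_nonneg_pos) auto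
    then have t1: "1 \<le> t" by (simp add: t_def)
    have ct: "- c * t = \<bar>a\<bar> + 2 * \<bar>b\<bar> + 1 - c" using c by (simp add: t_def field_simps)
    have "a \<le> \<bar>a\<bar> * t" using t1 mult_left_mono[OF t1, of "\<bar>a\<bar>"] by linarith
    moreover have "2 * b * t \<le> 2 * \<bar>b\<bar> * t" using t1 by (intro mult_right_mono) auto
    moreover have "c * t\<^sup>2 = - ((\<bar>a\<bar> + 2 * \<bar>b\<bar> + 1 - c) * t)"
      unfolding ct[symmetric] by (simp add: power2_eq_square)
    moreover have "0 < (1 - c) * t" using c t1 by (intro mult_pos_pos) auto
    ultimately show False using nn[of t] by (simp add: algebra_simps)
  qed
  have "0 \<le> a + 2 * b * (- b / c) + c * (- b / c)\<^sup>2" by (rule nn)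
  also have "\<dots> = a - b\<^sup>2 / c" using c by (simp add: power2_eq_square field_simps)
  finally show ?thesis using c by (simp add: field_simps)
qed

locale substochastic =
  fixes V :: "'v set" and b :: "'v \<Rightarrow> 'v \<Rightarrow> real"
  assumes finite_V: "finite V"
    and b_sym: "\<And>x y. x \<in> V \<Longrightarrow> y \<in> V \<Longrightarrow> b x y = b y x"
    and b_nonneg: "\<And>x y. x \<in> V \<Longrightarrow> y \<in> V \<Longrightarrow> 0 \<le> b x y"
    and row_sum: "\<And>x. x \<in> V \<Longrightarrow> (\<Sum>y\<in>V. b x y) \<le> 1"
begin

text \<open>The Dirichlet form of the identity minus \<open>b\<close>: the energy of the network
  with conductances \<open>b\<close> in which the mass missing from each row goes to the
  ground.\<close>

definition form :: "('v \<Rightarrow> real) \<Rightarrow> ('v \<Rightarrow> real) \<Rightarrow> real" where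
  "form v p = (\<Sum>x\<in>V. v x * p x) - (\<Sum>x\<in>V. \<Sum>y\<in>V. b x y * v x * p y)"

lemma form_nonneg: "0 \<le> form v v"
proof -
  have "(\<Sum>x\<in>V. \<Sum>y\<in>V. b x y * v x * v y) \<le> (\<Sum>x\<in>V. \<Sum>y\<in>V. b x y * ((v x)\<^sup>2 / 2) + b x y * ((v y)\<^sup>2 / 2))"
  proof (intro sum_mono)
    fix x y assume xy: "x \<in> V" "y \<in> V"
    have "v x * v y \<le> (v x)\<^sup>2 / 2 + (v y)\<^sup>2 / 2"
      using sum_squares_bound[of "v x" "v y"] by simp
    from mult_left_mono[OF this b_nonneg[OF xy]]
    show "b x y * v x * v y \<le> b x y * ((v x)\<^sup>2 / 2) + b x y * ((v y)\<^sup>2 / 2)"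
      by (simp add: algebra_simps)
  qed
  also have "\<dots> = (\<Sum>x\<in>V. \<Sum>y\<in>V. b x y * ((v x)\<^sup>2 / 2)) + (\<Sum>x\<in>V. \<Sum>y\<in>V. b x y * ((v y)\<^sup>2 / 2))"
    by (simp only: sum.distrib)
  also have "(\<Sum>x\<in>V. \<Sum>y\<in>V. b x y * ((v y)\<^sup>2 / 2)) = (\<Sum>x\<in>V. \<Sum>y\<in>V. b x y * ((v x)\<^sup>2 / 2))"
    by (subst sum.swap) (intro sum.cong refl, simp add: b_sym)
  also have "(\<Sum>x\<in>V. \<Sum>y\<in>V. b x y * ((v x)\<^sup>2 / 2)) + \<dots> = (\<Sum>x\<in>V. (\<Sum>y\<in>V. b x y) * (v x)\<^sup>2)"
    unfolding sum.distrib[symmetric] by (simp add: sum_distrib_right)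
  also have "\<dots> \<le> (\<Sum>x\<in>V. 1 * (v x)\<^sup>2)"
    using row_sum by (intro sum_mono mult_right_mono) auto
  finally show ?thesis by (simp add: form_def power2_eq_square)
qed

lemma form_Cauchy_Schwarz: "\<bar>form v p\<bar> \<le> sqrt (form v v) * sqrt (form p p)"
proof -
  have sym: "form p v = form v p"
  proof -
    have "(\<Sum>x\<in>V. \<Sum>y\<in>V. b x y * p x * v y) = (\<Sum>x\<in>V. \<Sum>y\<in>V. b x y * v x * p y)"
      by (subst sum.swap) (intro sum.cong refl, simp add: b_sym)
    then show ?thesis by (simp add: form_def mult.commute)
  qed
  have "form (\<lambda>x. v x + t * p x) (\<lambda>x. v x + t * p x) = form v v + t * form v p + t * form p v + t\<^sup>2 * form p p" for t
    unfolding form_def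
    by (simp add: algebra_simps sum.distrib sum_distrib_left power2_eq_square)
  then have "0 \<le> form v v + 2 * form v p * t + form p p * t\<^sup>2" for t
    using form_nonneg[of "\<lambda>x. v x + t * p x"] sym by (simp add: algebra_simps)
  then have "(form v p)\<^sup>2 \<le> form v v * form p p" by (rule nonneg_quadratic_discriminant)
  then have "sqrt ((form v p)\<^sup>2) \<le> sqrt (form v v * form p p)" by (rule real_sqrt_le_mono)
  then show ?thesis by (simp add: real_sqrt_mult)
qed

end

text \<open>The point mass at \<open>z\<close> is smoothed successively by \<open>b 0, b 1, \<dots>\<close>; the telescoping sum of
  \<open>v\<close> tested against these masses is controlled term by term by the forms of the \<open>b k\<close>.\<close>

lemma sup_bound_of_forms:
  fixes b :: "nat \<Rightarrow> 'v \<Rightarrow> 'v \<Rightarrow> real" and w \<beta> :: "nat \<Rightarrow> real"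
  assumes b: "\<And>k. k \<le> K \<Longrightarrow> substochastic V (b k)"
    and \<beta>: "\<And>k x y. k \<le> K \<Longrightarrow> x \<in> V \<Longrightarrow> y \<in> V \<Longrightarrow> b k x y \<le> \<beta> k"
    and w: "\<And>k. k \<le> K \<Longrightarrow> 0 < w k"
    and K: "card V * \<beta> K \<le> 1 / 2" and z: "z \<in> V"
  shows "\<bar>v z\<bar> \<le> 2 * (1 / sqrt (w 0) + (\<Sum>k<K. sqrt (\<beta> k / w (Suc k))))
      * sqrt (\<Sum>k\<le>K. w k * substochastic.form V (b k) v v)"
proof -
  define F where "F = (\<Sum>k\<le>K. w k * substochastic.form V (b k) v v)"
  have V: "finite V" using b[of 0] by (simp add: substochastic_def)
  have ne: "(\<lambda>y. \<bar>v y\<bar>) ` V \<noteq> {}" and fin: "finite ((\<lambda>y. \<bar>v y\<bar>) ` V)" using z V by auto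
  \<comment> \<open>Smoothing starts at a maximum of the absolute value instead of at
    \<open>z\<close>, so that what is left after the last smoothing is at most half of the value at
    \<open>m\<close> and can be moved to the other side.\<close>
  obtain m where m: "m \<in> V" "\<bar>v m\<bar> = Max ((\<lambda>y. \<bar>v y\<bar>) ` V)"
    using Max_in[OF fin ne] by auto
  have m_max: "\<bar>v y\<bar> \<le> \<bar>v m\<bar>" if "y \<in> V" for y
    using that fin m(2) by simp
  define p where "p = rec_nat (\<lambda>x. of_bool (x = m) :: real) (\<lambda>k q x. \<Sum>y\<in>V. b k x y * q y)"
  have p0: "p 0 x = of_bool (x = m)" and pS: "p (Suc k) x = (\<Sum>y\<in>V. b k x y * p k y)" for k x
    by (simp_all add: p_def)
  have p_nn: "0 \<le> p k x" if "k \<le> Suc K" "x \<in> V" for k x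
    using that
  proof (induction k arbitrary: x)
    case (Suc k)
    then interpret substochastic V "b k" using b by simp
    show ?case using Suc b_nonneg by (auto simp: pS intro!: sum_nonneg)
  qed (simp add: p0)
  have p_sum: "(\<Sum>x\<in>V. p k x) \<le> 1" if "k \<le> Suc K" for k
    using that
  proof (induction k)
    case 0
    then show ?case using V m(1) by (simp add: p0)
  next
    case (Suc k)
    then interpret substochastic V "b k" using b by simp
    have "(\<Sum>x\<in>V. p (Suc k) x) = (\<Sum>y\<in>V. (\<Sum>x\<in>V. b k y x) * p k y)"
      unfolding pS sum_distrib_right by (subst sum.swap) (intro sum.cong refl, simp add: b_sym)
    also have "\<dots> \<le> (\<Sum>y\<in>V. 1 * p k y)"
      using row_sum p_nn Suc by (intro sum_mono mult_right_mono) auto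
    finally show ?case using Suc by simp
  qed
  have p_max: "p (Suc k) x \<le> \<beta> k" if "k \<le> K" "x \<in> V" for k x
  proof -
    interpret substochastic V "b k" using b that by simp
    have \<beta>0: "0 \<le> \<beta> k" using \<beta>[OF that(1) that(2) that(2)] b_nonneg[OF that(2) that(2)] by linarith
    have "p (Suc k) x \<le> (\<Sum>y\<in>V. \<beta> k * p k y)"
      unfolding pS using \<beta> p_nn that by (intro sum_mono mult_right_mono) auto
    also have "\<dots> \<le> \<beta> k * 1"
      unfolding sum_distrib_left[symmetric] using p_sum[of k] that \<beta>0 by (intro mult_left_mono) auto
    finally show ?thesis by simp
  qed
  \<comment> \<open>The form of a mass distribution is at most its maximum times its total mass. The
    initial point mass has maximum 1, and smoothing by \<open>b j\<close> brings the maximum down to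
    \<open>\<beta> j\<close>.\<close>
  have form_p: "substochastic.form V (b k) (p k) (p k) \<le> (case k of 0 \<Rightarrow> 1 | Suc j \<Rightarrow> \<beta> j)" if k: "k \<le> K" for k
  proof -
    interpret substochastic V "b k" using b k by simp
    define B where "B = (case k of 0 \<Rightarrow> 1 | Suc j \<Rightarrow> \<beta> j)"
    have pB: "p k x \<le> B" if "x \<in> V" for x
      using p_max[of "k - 1" x] that k by (cases k) (auto simp: p0 B_def)
    have "0 \<le> B" using pB[OF m(1)] p_nn[OF _ m(1), of k] k by simp
    have "form (p k) (p k) \<le> (\<Sum>x\<in>V. p k x * p k x)"
      unfolding form_def using b_nonneg p_nn k by (auto intro!: sum_nonneg)
    also have "\<dots> \<le> (\<Sum>x\<in>V. B * p k x)"
      using pB p_nn k by (intro sum_mono mult_right_mono) auto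
    also have "\<dots> \<le> B * 1"
      unfolding sum_distrib_left[symmetric] using p_sum[of k] k \<open>0 \<le> B\<close> by (intro mult_left_mono) auto
    finally show ?thesis by (simp add: B_def)
  qed
  have step: "\<bar>(\<Sum>x\<in>V. v x * p k x) - (\<Sum>x\<in>V. v x * p (Suc k) x)\<bar>
      \<le> sqrt F * sqrt ((case k of 0 \<Rightarrow> 1 | Suc j \<Rightarrow> \<beta> j) / w k)" if k: "k \<le> K" for k
  proof -
    interpret substochastic V "b k" using b k by simp
    have "(\<Sum>x\<in>V. v x * p k x) - (\<Sum>x\<in>V. v x * p (Suc k) x) = form v (p k)"
      by (simp add: form_def pS sum_distrib_left mult_ac)
    moreover have "\<bar>form v (p k)\<bar> \<le> sqrt (form v v) * sqrt (form (p k) (p k))"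
      by (rule form_Cauchy_Schwarz)
    moreover have "sqrt (form v v) * sqrt (form (p k) (p k))
        \<le> sqrt (F / w k) * sqrt (case k of 0 \<Rightarrow> 1 | Suc j \<Rightarrow> \<beta> j)"
    proof (intro mult_mono real_sqrt_le_mono form_p k)
      have "w k * form v v \<le> F"
        unfolding F_def using k w substochastic.form_nonneg[OF b]
        by (intro member_le_sum) (auto simp: less_imp_le)
      then show "form v v \<le> F / w k" using w[OF k] by (simp add: field_simps)
      then show "0 \<le> sqrt (F / w k)" using form_nonneg[of v] by auto
    qed (auto simp: form_nonneg)
    ultimately show ?thesis by (simp add: real_sqrt_divide)
  qed
  have "v m = (\<Sum>x\<in>V. v x * p 0 x)"
    using V m(1) by (simp add: p0 of_bool_def if_distrib cong: if_cong)
  moreover have "(\<Sum>k\<le>K. (\<Sum>x\<in>V. v x * p k x) - (\<Sum>x\<in>V. v x * p (Suc k) x))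
      = (\<Sum>x\<in>V. v x * p 0 x) - (\<Sum>x\<in>V. v x * p (Suc K) x)"
    by (rule sum_telescope)
  ultimately have "\<bar>v m\<bar> \<le> \<bar>\<Sum>k\<le>K. (\<Sum>x\<in>V. v x * p k x) - (\<Sum>x\<in>V. v x * p (Suc k) x)\<bar>
      + \<bar>\<Sum>x\<in>V. v x * p (Suc K) x\<bar>" by linarith
  also have "\<dots> \<le> (\<Sum>k\<le>K. sqrt F * sqrt ((case k of 0 \<Rightarrow> 1 | Suc j \<Rightarrow> \<beta> j) / w k))
      + (\<Sum>x\<in>V. \<bar>v m\<bar> * \<beta> K)"
  proof (rule add_mono)
    show "\<bar>\<Sum>k\<le>K. (\<Sum>x\<in>V. v x * p k x) - (\<Sum>x\<in>V. v x * p (Suc k) x)\<bar>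
       \<le> (\<Sum>k\<le>K. sqrt F * sqrt ((case k of 0 \<Rightarrow> 1 | Suc j \<Rightarrow> \<beta> j) / w k))"
      using step by (intro order_trans[OF sum_abs] sum_mono) simp
    show "\<bar>\<Sum>x\<in>V. v x * p (Suc K) x\<bar> \<le> (\<Sum>x\<in>V. \<bar>v m\<bar> * \<beta> K)"
      using m_max p_max[of K] p_nn[of "Suc K"]
      by (intro order_trans[OF sum_abs] sum_mono) (auto simp: abs_mult intro!: mult_mono)
  qed
  also have "(\<Sum>k\<le>K. sqrt F * sqrt ((case k of 0 \<Rightarrow> 1 | Suc j \<Rightarrow> \<beta> j) / w k))
      = sqrt F * (1 / sqrt (w 0) + (\<Sum>k<K. sqrt (\<beta> k / w (Suc k))))"
    unfolding sum_distrib_left[symmetric] lessThan_Suc_atMost[symmetric] sum.lessThan_Suc_shift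
    by (simp add: real_sqrt_divide)
  also have "(\<Sum>x\<in>V. \<bar>v m\<bar> * \<beta> K) \<le> \<bar>v m\<bar> * (1 / 2)"
    using mult_left_mono[OF K, of "\<bar>v m\<bar>"] by (simp add: mult_ac)
  finally have "\<bar>v m\<bar> \<le> sqrt F * (1 / sqrt (w 0) + (\<Sum>k<K. sqrt (\<beta> k / w (Suc k)))) + \<bar>v m\<bar> * (1 / 2)"
    by simp
  then have "\<bar>v m\<bar> \<le> 2 * (sqrt F * (1 / sqrt (w 0) + (\<Sum>k<K. sqrt (\<beta> k / w (Suc k)))))"
    by linarith
  also have "\<dots> = 2 * (1 / sqrt (w 0) + (\<Sum>k<K. sqrt (\<beta> k / w (Suc k)))) * sqrt F"
    by (simp only: mult_ac)
  finally show ?thesis using m_max[OF z] unfolding F_def by linarith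
qed

section \<open>Sets of descendants\<close>

lemma forests_SomeD: "f \<in> forests V \<Longrightarrow> f x = Some y \<Longrightarrow> x \<in> V \<and> y \<in> V"
  by (auto simp: forests_def intro: ranI)

lemma forests_outside: "f \<in> forests V \<Longrightarrow> x \<notin> V \<Longrightarrow> f x = None"
  by (auto simp: forests_def)

lemma arrow_weight_nonneg:
  assumes "f \<in> forests V" "x \<in> V" "\<And>y. y \<in> V \<Longrightarrow> 0 \<le> c x y" "0 \<le> k x"
  shows "0 \<le> arrow_weight c k x (f x)"
  using assms by (auto simp: arrow_weight_def forests_def ran_def split: option.split)

text \<open>Arrows violating \<open>P\<close> are sent to the ground. The forests that become the
  same \<open>g\<close> differ by choices at the ground arrows of \<open>g\<close>; dropping the
  requirement that these choices create no cycle only increases the sum, which then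
  factorizes.\<close>

lemma forest_sum_le_absorbed:
  assumes V: "finite V" and c: "\<And>x y. x \<in> V \<Longrightarrow> y \<in> V \<Longrightarrow> 0 \<le> c x y"
    and k: "\<And>x. x \<in> V \<Longrightarrow> 0 \<le> k x"
  shows "forest_sum V c k \<le> forest_sum V (\<lambda>x y. c x y * of_bool (P x y))
           (\<lambda>x. k x + (\<Sum>y\<in>V. c x y * of_bool (\<not> P x y)))"
proof -
  define red where "red x q = (case q of None \<Rightarrow> None | Some y \<Rightarrow> if P x y then Some y else None)" for x q
  define r where "r f = (\<lambda>x. red x (f x))" for f
  let ?c = "\<lambda>x y. c x y * of_bool (P x y)"
  let ?k = "\<lambda>x. k x + (\<Sum>y\<in>V. c x y * of_bool (\<not> P x y))"
  let ?W = "\<lambda>f. \<Prod>x\<in>V. arrow_weight c k x (f x)"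
  let ?opt = "insert None (Some ` V)"
  have red_None: "red x q = None \<longleftrightarrow> (\<forall>y. q = Some y \<longrightarrow> \<not> P x y)" for x q
    by (cases q) (auto simp: red_def)
  have red_Some: "red x q = Some y \<longleftrightarrow> q = Some y \<and> P x y" for x q y
    by (cases q) (auto simp: red_def)
  have r: "r f \<in> forests V" if f: "f \<in> forests V" for f
  proof -
    have "Map.graph (r f) \<subseteq> Map.graph f"
      by (auto simp: Map.graph_def r_def red_Some)
    moreover have "dom (r f) \<subseteq> dom f" "ran (r f) \<subseteq> ran f"
      by (auto simp: r_def red_Some ran_def dom_def)
    ultimately show ?thesis
      using f acyclic_subset[of "Map.graph f" "Map.graph (r f)"] unfolding forests_def by blast
  qed
  have fiber: "(\<Sum>f | f \<in> forests V \<and> r f = g. ?W f) \<le> (\<Prod>x\<in>V. arrow_weight ?c ?k x (g x))"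
    if g: "g \<in> forests V" for g
  proof -
    let ?Q = "\<lambda>x. {q \<in> ?opt. red x q = g x}"
    have inj: "inj_on (\<lambda>f. restrict f V) {f. f \<in> forests V \<and> r f = g}"
    proof (rule inj_onI)
      fix f f' assume f: "f \<in> {f. f \<in> forests V \<and> r f = g}" "f' \<in> {f. f \<in> forests V \<and> r f = g}"
        and eq: "restrict f V = restrict f' V"
      show "f = f'"
      proof
        fix x show "f x = f' x"
          using f forests_outside[of f V x] forests_outside[of f' V x] fun_cong[OF eq, of x]
          by (cases "x \<in> V") auto
      qed
    qed
    have "(\<Sum>f | f \<in> forests V \<and> r f = g. ?W f)
        = (\<Sum>\<phi>\<in>(\<lambda>f. restrict f V) ` {f. f \<in> forests V \<and> r f = g}. \<Prod>x\<in>V. arrow_weight c k x (\<phi> x))"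
      by (subst sum.reindex[OF inj]) (auto intro!: sum.cong prod.cong)
    also have "\<dots> \<le> (\<Sum>\<phi>\<in>PiE V ?Q. \<Prod>x\<in>V. arrow_weight c k x (\<phi> x))"
    proof (rule sum_mono2)
      show "finite (PiE V ?Q)" using V by (intro finite_PiE) auto
      show "(\<lambda>f. restrict f V) ` {f. f \<in> forests V \<and> r f = g} \<subseteq> PiE V ?Q"
      proof (rule image_subsetI)
        fix f assume "f \<in> {f. f \<in> forests V \<and> r f = g}"
        then have f: "f \<in> forests V" "g x = red x (f x)" for x by (auto simp: r_def)
        have "f x \<in> ?opt" for x using f by (cases "f x") (auto simp: forests_def ran_def)
        then show "restrict f V \<in> PiE V ?Q"
          using f(2) by auto
      qed
      show "0 \<le> (\<Prod>x\<in>V. arrow_weight c k x (\<phi> x))" if "\<phi> \<in> PiE V ?Q - (\<lambda>f. restrict f V) ` {f. f \<in> forests V \<and> r f = g}" for \<phi>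
      proof (rule prod_nonneg)
        fix x assume x: "x \<in> V"
        then have "\<phi> x \<in> ?opt" using that by auto
        then show "0 \<le> arrow_weight c k x (\<phi> x)" using c k x by auto
      qed
    qed
    also have "\<dots> = (\<Prod>x\<in>V. \<Sum>q\<in>?Q x. arrow_weight c k x q)"
      using V by (intro prod_sum_PiE[symmetric]) auto
    also have "\<dots> = (\<Prod>x\<in>V. arrow_weight ?c ?k x (g x))"
    proof (rule prod.cong[OF refl])
      fix x assume x: "x \<in> V"
      show "(\<Sum>q\<in>?Q x. arrow_weight c k x q) = arrow_weight ?c ?k x (g x)"
      proof (cases "g x")
        case None
        have "?Q x = insert None (Some ` {y\<in>V. \<not> P x y})"
          using None by (auto simp: red_None)
        then have "(\<Sum>q\<in>?Q x. arrow_weight c k x q) = k x + (\<Sum>y\<in>{y\<in>V. \<not> P x y}. c x y)"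
          using sum_insert_None[of "{y\<in>V. \<not> P x y}" "arrow_weight c k x"] V by simp
        also have "(\<Sum>y\<in>{y\<in>V. \<not> P x y}. c x y) = (\<Sum>y\<in>V. c x y * of_bool (\<not> P x y))"
          using sum_filter_weight[OF V, where P = "\<lambda>y. \<not> P x y" and a = 1 and w = "c x"] by simp
        finally show ?thesis using None by simp
      next
        case (Some y)
        then have "y \<in> V" using g by (auto simp: forests_def ran_def)
        then have "?Q x = (if P x y then {Some y} else {})"
          using Some by (auto simp: red_Some)
        then show ?thesis using Some by simp
      qed
    qed
    finally show ?thesis .
  qed
  have "forest_sum V c k = (\<Sum>g\<in>forests V. \<Sum>f | f \<in> forests V \<and> r f = g. ?W f)"
    unfolding forest_sum_def using V r by (intro sum.group[symmetric]) auto
  also have "\<dots> \<le> forest_sum V ?c ?k"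
    unfolding forest_sum_def by (rule sum_mono) (rule fiber)
  finally show ?thesis .
qed

lemma forest_root:
  assumes V: "finite V" and f: "f \<in> forests V" and x: "x \<in> V"
  shows "\<exists>r\<in>V. (x, r) \<in> (Map.graph f)\<^sup>* \<and> f r = None"
proof -
  have "Map.graph f \<subseteq> V \<times> V" using forests_SomeD[OF f] by (auto simp: mem_graph_iff)
  then have "finite (Map.graph f)" using V by (meson finite_SigmaI finite_subset)
  then have "wf ((Map.graph f)\<inverse>)"
    using f by (intro finite_acyclic_wf_converse) (auto simp: forests_def)
  then show ?thesis using x
  proof (induction x rule: wf_induct_rule)
    case (less x)
    show ?case
    proof (cases "f x")
      case None
      then show ?thesis using less.prems by blast
    next
      case (Some y)
      then have "y \<in> V" "(x, y) \<in> Map.graph f" using f by (auto simp: forests_def mem_graph_iff ran_def)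
      then show ?thesis using less.IH[of y] by (meson converseI converse_rtrancl_into_rtrancl)
    qed
  qed
qed

text \<open>In the network on the left no arrow of nonzero weight crosses between \<open>A\<close>
  and its complement, and \<open>a\<close> is the only exit of \<open>A\<close>. So in a forest of
  nonzero weight all of \<open>A\<close> drains into \<open>a\<close>, and turning the ground arrow
  of \<open>a\<close> towards \<open>b\<close> makes \<open>A\<close> the set of descendants of
  \<open>a\<close>. The ground rate at \<open>a\<close> is \<open>c a b\<close>, hence the weight is
  preserved.\<close>

lemma forest_sum_le_past:
  assumes V: "finite V" and c: "\<And>x y. x \<in> V \<Longrightarrow> y \<in> V \<Longrightarrow> 0 \<le> c x y"
    and k: "\<And>x. x \<in> V \<Longrightarrow> 0 \<le> k x" and A: "A \<subseteq> V" "a \<in> A" and b: "b \<in> V" "b \<notin> A"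
  shows "forest_sum V (\<lambda>x y. c x y * of_bool (x \<in> A \<longleftrightarrow> y \<in> A))
             (\<lambda>x. if x \<in> A then (if x = a then c a b else 0) else k x)
       \<le> (\<Sum>g | g \<in> forests V \<and> {x. (x, a) \<in> (Map.graph g)\<^sup>*} = A. \<Prod>x\<in>V. arrow_weight c k x (g x))"
proof -
  let ?c = "\<lambda>x y. c x y * of_bool (x \<in> A \<longleftrightarrow> y \<in> A)"
  let ?k = "\<lambda>x. if x \<in> A then (if x = a then c a b else 0) else k x"
  let ?W = "\<lambda>f. \<Prod>x\<in>V. arrow_weight ?c ?k x (f x)"
  let ?W' = "\<lambda>f. \<Prod>x\<in>V. arrow_weight c k x (f x)"
  let ?F = "{f \<in> forests V. ?W f \<noteq> 0}"
  let ?G = "{g. g \<in> forests V \<and> {x. (x, a) \<in> (Map.graph g)\<^sup>*} = A}"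
  have "a \<in> V" using A by auto
  have same: "y \<in> A \<longleftrightarrow> x \<in> A" if "f \<in> ?F" "f x = Some y" for f x y
  proof -
    have "x \<in> V" using that by (auto simp: forests_def)
    then have "arrow_weight ?c ?k x (f x) \<noteq> 0" using that V by auto
    then show ?thesis using that by (auto split: if_splits)
  qed
  have rootA: "x \<notin> A" if "f \<in> ?F" "f x = None" "x \<noteq> a" for f x
  proof
    assume x: "x \<in> A"
    have "?W f \<noteq> 0" using that(1) by blast
    then have "arrow_weight ?c ?k x (f x) \<noteq> 0"
      using prod_zero_iff[OF V, of "\<lambda>x. arrow_weight ?c ?k x (f x)"] x A(1) by blast
    then show False using that(2,3) x by (simp only: arrow_weight_simps if_True if_False)
  qed
  have stay: "y \<in> A \<longleftrightarrow> x \<in> A" if "f \<in> ?F" "(x, y) \<in> (Map.graph f)\<^sup>*" for f x y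
    using that(2) by (induction rule: rtrancl_induct) (use same[OF that(1)] in \<open>auto simp: mem_graph_iff\<close>)
  have to_a: "(x, a) \<in> (Map.graph f)\<^sup>*" "f a = None" if f: "f \<in> ?F" and x: "x \<in> A" for f x
  proof -
    from forest_root[OF V _ subsetD[OF A(1) x], of f] f
    obtain z where z: "(x, z) \<in> (Map.graph f)\<^sup>*" "f z = None" by auto
    then have "z = a" using stay[OF f z(1)] rootA[OF f z(2)] x by blast
    then show "(x, a) \<in> (Map.graph f)\<^sup>*" "f a = None" using z by auto
  qed
  have upd: "f(a := Some b) \<in> ?G \<and> ?W' (f(a := Some b)) = ?W f" if f: "f \<in> ?F" for f
  proof -
    have fa: "f a = None" using to_a[OF f A(2)] by simp
    have notin: "(x, a) \<notin> (Map.graph f)\<^sup>*" if "x \<notin> A" for x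
      using stay[OF f] that A(2) by blast
    have "f(a := Some b) \<in> forests V"
      using f \<open>a \<in> V\<close> b notin[OF b(2)] by (intro forests_upd) auto
    moreover have "(x, a) \<in> (Map.graph (f(a := Some b)))\<^sup>* \<longleftrightarrow> (x, a) \<in> (Map.graph f)\<^sup>*" for x
      using graph_rtrancl_upd[of x a f a "f(a := Some b)"] graph_rtrancl_upd[of x a "f(a := Some b)" a f]
      by auto
    moreover have "(x, a) \<in> (Map.graph f)\<^sup>* \<longleftrightarrow> x \<in> A" for x
      using to_a(1)[OF f] notin by blast
    moreover have "?W' (f(a := Some b)) = ?W f"
    proof (rule prod.cong[OF refl])
      fix x assume x: "x \<in> V"
      show "arrow_weight c k x ((f(a := Some b)) x) = arrow_weight ?c ?k x (f x)"
      proof (cases "x = a")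
        case True
        then show ?thesis using fa A by simp
      next
        case False
        then show ?thesis using same[OF f, of x] rootA[OF f, of x] by (cases "f x") auto
      qed
    qed
    ultimately show ?thesis by simp
  qed
  have inj: "inj_on (\<lambda>f. f(a := Some b)) ?F"
  proof (rule inj_onI)
    fix f f' assume f: "f \<in> ?F" "f' \<in> ?F" and eq: "f(a := Some b) = f'(a := Some b)"
    have "f a = f' a" using to_a(2)[OF f(1) A(2)] to_a(2)[OF f(2) A(2)] by (simp only:)
    then show "f = f'" using eq by (metis fun_upd_triv fun_upd_upd)
  qed
  have "forest_sum V ?c ?k = (\<Sum>f\<in>?F. ?W f)"
    unfolding forest_sum_def using V by (intro sum.mono_neutral_right) auto
  also have "\<dots> = (\<Sum>f\<in>?F. ?W' (f(a := Some b)))"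
    by (rule sum.cong[OF refl]) (rule conjunct2[OF upd, symmetric])
  also have "\<dots> = (\<Sum>g\<in>(\<lambda>f. f(a := Some b)) ` ?F. ?W' g)"
    by (subst sum.reindex[OF inj]) simp
  also have "\<dots> \<le> (\<Sum>g\<in>?G. ?W' g)"
  proof (rule sum_mono2)
    show "finite ?G" using V by simp
    show "(\<lambda>f. f(a := Some b)) ` ?F \<subseteq> ?G"
      by (rule image_subsetI) (rule conjunct1[OF upd])
    show "0 \<le> ?W' g" if "g \<in> ?G - (\<lambda>f. f(a := Some b)) ` ?F" for g
      using that c k by (intro prod_nonneg ballI arrow_weight_nonneg[of g V]) auto
  qed
  finally show ?thesis .
qed

text \<open>The points \<open>\<rho> A\<close> all lie on the one path that starts at
  \<open>z\<close>, hence the sets are nested, and nested finite sets are told apart by their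
  size.\<close>

lemma card_pasts_le:
  fixes \<rho> :: "'v set \<Rightarrow> 'v"
  assumes past: "\<And>A. A \<in> \<A> \<Longrightarrow> z \<in> A \<and> A = {x. (x, \<rho> A) \<in> (Map.graph g)\<^sup>*}"
    and m: "\<And>A. A \<in> \<A> \<Longrightarrow> finite A \<and> card A \<le> m"
  shows "card \<A> \<le> m"
proof -
  have "A \<subseteq> A' \<or> A' \<subseteq> A" if A: "A \<in> \<A>" "A' \<in> \<A>" for A A'
  proof -
    have "(z, \<rho> A) \<in> (Map.graph g)\<^sup>*" "(z, \<rho> A') \<in> (Map.graph g)\<^sup>*"
      using past[OF A(1)] past[OF A(2)] by blast+
    from single_valued_confluent[OF single_valued_graph this]
    show ?thesis
    proof
      assume "(\<rho> A, \<rho> A') \<in> (Map.graph g)\<^sup>*"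
      then have "{x. (x, \<rho> A) \<in> (Map.graph g)\<^sup>*} \<subseteq> {x. (x, \<rho> A') \<in> (Map.graph g)\<^sup>*}"
        by (auto intro: rtrancl_trans)
      then show ?thesis using past[OF A(1)] past[OF A(2)] by simp
    next
      assume "(\<rho> A', \<rho> A) \<in> (Map.graph g)\<^sup>*"
      then have "{x. (x, \<rho> A') \<in> (Map.graph g)\<^sup>*} \<subseteq> {x. (x, \<rho> A) \<in> (Map.graph g)\<^sup>*}"
        by (auto intro: rtrancl_trans)
      then show ?thesis using past[OF A(1)] past[OF A(2)] by simp
    qed
  qed
  then have "inj_on card \<A>"
    using m by (intro inj_onI) (metis card_subset_eq)
  moreover have "card ` \<A> \<subseteq> {1..m}"
  proof
    fix n assume "n \<in> card ` \<A>"
    then obtain A where A: "A \<in> \<A>" "n = card A" by auto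
    then have "z \<in> A" "finite A" "card A \<le> m" using past[of A] m[of A] by auto
    then have "0 < card A" by (auto simp: card_gt_0_iff)
    then show "n \<in> {1..m}" using A \<open>card A \<le> m\<close> by simp
  qed
  ultimately show ?thesis using card_inj_on_le[of card \<A> "{1..m}"] by simp
qed

section \<open>Word metric, boundaries and the long-range kernel\<close>

locale cayley = group G for G :: "('a, 'b) monoid_scheme" (structure) +
  fixes S :: "'a set"
  assumes finite_S: "finite S" and S_sub: "S \<subseteq> carrier G"
    and S_inv: "\<And>s. s \<in> S \<Longrightarrow> inv s \<in> S" and gen: "generate G S = carrier G"
begin

primrec word_ball :: "nat \<Rightarrow> 'a set" where
  "word_ball 0 = {\<one>}"
| "word_ball (Suc n) = (\<lambda>(x, s). x \<otimes> s) ` (word_ball n \<times> insert \<one> S)"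

lemma word_ball_carrier: "word_ball n \<subseteq> carrier G"
  using S_sub by (induction n) auto

lemma word_ball_closed: "x \<in> word_ball n \<Longrightarrow> x \<in> carrier G"
  using word_ball_carrier by blast

lemma inv_mult_cancel [simp]:
  assumes "x \<in> carrier G" "y \<in> carrier G"
  shows "inv x \<otimes> (x \<otimes> y) = y" "x \<otimes> (inv x \<otimes> y) = y"
  using assms by (simp_all add: m_assoc[symmetric])

lemma finite_word_ball: "finite (word_ball n)"
  using finite_S by (induction n) auto

lemma word_ball_mult: "x \<in> word_ball m \<Longrightarrow> y \<in> word_ball n \<Longrightarrow> x \<otimes> y \<in> word_ball (m + n)"
proof (induction n arbitrary: y)
  case 0
  then show ?case using word_ball_closed[of x m] by simp
next
  case (Suc n)
  then obtain z s where z: "y = z \<otimes> s" "z \<in> word_ball n" "s \<in> insert \<one> S" by auto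
  then have "x \<otimes> z \<in> word_ball (m + n)" using Suc by simp
  moreover have "x \<otimes> y = (x \<otimes> z) \<otimes> s"
    using z Suc.prems(1) word_ball_carrier S_sub by (subst z(1), subst m_assoc) auto
  ultimately show ?case using z(3) by auto
qed

lemma one_in_word_ball: "\<one> \<in> word_ball n"
  by (induction n) force+

lemma word_ball_mono: "m \<le> n \<Longrightarrow> word_ball m \<subseteq> word_ball n"
  using word_ball_mult[OF _ one_in_word_ball[of "n - m"], of _ m] word_ball_closed[of _ m] by fastforce

lemma S_sub_word_ball: "S \<subseteq> word_ball (Suc 0)"
  using S_sub by force

lemma word_ball_inv: "x \<in> word_ball n \<Longrightarrow> inv x \<in> word_ball n"
proof (induction n arbitrary: x)
  case (Suc n)
  then obtain z s where z: "x = z \<otimes> s" "z \<in> word_ball n" "s \<in> insert \<one> S" by auto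
  have "inv s \<in> word_ball 1" using z(3) S_inv S_sub_word_ball one_in_word_ball by auto
  then have "inv s \<otimes> inv z \<in> word_ball (1 + n)"
    using Suc z by (intro word_ball_mult) auto
  moreover have "inv x = inv s \<otimes> inv z"
    using z word_ball_closed[of z n] S_sub by (auto simp: inv_mult_group subset_iff)
  ultimately show ?case by (simp del: word_ball.simps)
qed simp

lemma word_ball_exhausts:
  assumes "x \<in> carrier G" shows "\<exists>n. x \<in> word_ball n"
proof -
  have "x \<in> generate G S" using assms gen by simp
  then show ?thesis
  proof (induction rule: generate.induct)
    case one
    then show ?case using one_in_word_ball by blast
  next
    case (incl h)
    then show ?case using S_sub_word_ball by blast
  next
    case (inv h)
    then show ?case using S_sub_word_ball S_inv by blast
  next
    case (eng h1 h2)
    then show ?case using word_ball_mult by blast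
  qed
qed

lemma word_ball_le: "x \<in> word_ball m \<Longrightarrow> m \<le> n \<Longrightarrow> x \<in> word_ball n"
  using word_ball_mono by blast

definition vboundary :: "'a set \<Rightarrow> 'a set" where
  "vboundary A = {y \<in> carrier G - A. \<exists>x\<in>A. inv x \<otimes> y \<in> S}"

lemma vboundaryI:
  assumes "A \<subseteq> carrier G" "x \<in> A" "s \<in> S" "x \<otimes> s \<notin> A"
  shows "x \<otimes> s \<in> vboundary A"
proof -
  have "x \<in> carrier G" "s \<in> carrier G" using assms S_sub by auto
  then show ?thesis using assms by (auto simp: vboundary_def intro!: bexI[of _ x])
qed

lemma finite_vboundary:
  assumes "finite A" "A \<subseteq> carrier G" shows "finite (vboundary A)"
proof -
  have "vboundary A \<subseteq> (\<lambda>(x, s). x \<otimes> s) ` (A \<times> S)"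
  proof
    fix y assume "y \<in> vboundary A"
    then obtain x where x: "x \<in> A" "inv x \<otimes> y \<in> S" "y \<in> carrier G" by (auto simp: vboundary_def)
    then have "y = x \<otimes> (inv x \<otimes> y)" using assms by auto
    then show "y \<in> (\<lambda>(x, s). x \<otimes> s) ` (A \<times> S)" using x by force
  qed
  then show ?thesis using assms finite_S by (meson finite_SigmaI finite_imageI finite_subset)
qed

text \<open>The way from \<open>x\<close> to \<open>x \<otimes> g\<close> is taken one generator at
  a time. The step that leaves \<open>A\<close> lands in the boundary, and right translation is
  injective, so each of the \<open>n\<close> steps accounts for at most
  \<open>card (vboundary A)\<close> points.\<close>

lemma card_exits_le:
  assumes A: "finite A" "A \<subseteq> carrier G" and g: "g \<in> word_ball n"
  shows "card {x\<in>A. x \<otimes> g \<notin> A} \<le> n * card (vboundary A)"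
  using g
proof (induction n arbitrary: g)
  case 0
  then have "{x\<in>A. x \<otimes> g \<notin> A} = {}" using A by auto
  then show ?case by (simp only: card.empty)
next
  case (Suc n)
  then obtain h s where h: "g = h \<otimes> s" "h \<in> word_ball n" "s \<in> insert \<one> S" by auto
  have c: "h \<in> carrier G" "s \<in> carrier G" using h word_ball_carrier S_sub by auto
  let ?E = "{x\<in>A. x \<otimes> h \<in> A \<and> x \<otimes> h \<otimes> s \<notin> A}"
  have g: "x \<otimes> g = x \<otimes> h \<otimes> s" if "x \<in> A" for x
    using that A c h by (auto simp: m_assoc)
  have "card ?E \<le> card (vboundary A)"
  proof (rule card_inj_on_le[where f = "\<lambda>x. x \<otimes> h \<otimes> s"])
    show "inj_on (\<lambda>x. x \<otimes> h \<otimes> s) ?E"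
    proof (rule inj_onI)
      fix x y assume xy: "x \<in> ?E" "y \<in> ?E" "x \<otimes> h \<otimes> s = y \<otimes> h \<otimes> s"
      then have "x \<in> carrier G" "y \<in> carrier G" using A by auto
      then show "x = y" using xy(3) c by simp
    qed
    show "(\<lambda>x. x \<otimes> h \<otimes> s) ` ?E \<subseteq> vboundary A"
    proof (rule image_subsetI)
      fix x assume x: "x \<in> ?E"
      then have "s \<noteq> \<one>" using A c by auto
      then show "x \<otimes> h \<otimes> s \<in> vboundary A" using x h A by (intro vboundaryI) auto
    qed
  qed (use A finite_vboundary in auto)
  moreover have "{x\<in>A. x \<otimes> g \<notin> A} \<subseteq> {x\<in>A. x \<otimes> h \<notin> A} \<union> ?E" using g by auto
  then have "card {x\<in>A. x \<otimes> g \<notin> A} \<le> card ({x\<in>A. x \<otimes> h \<notin> A} \<union> ?E)"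
    using A by (intro card_mono) auto
  then have "card {x\<in>A. x \<otimes> g \<notin> A} \<le> card {x\<in>A. x \<otimes> h \<notin> A} + card ?E"
    using card_Un_le le_trans by blast
  ultimately show ?case using Suc.IH[OF h(2)] by simp
qed

text \<open>Connectedness of a set containing the unit, expressed by cuts instead of paths; this is
  the form in which it serves to verify \<open>grounded\<close>.\<close>

definition linked :: "'a set \<Rightarrow> bool" where
  "linked A \<longleftrightarrow> A \<subseteq> carrier G \<and> \<one> \<in> A \<and>
     (\<forall>Y\<subseteq>A. Y \<noteq> {} \<and> Y \<noteq> A \<longrightarrow> vboundary Y \<inter> A \<noteq> {})"

lemma linkedD: "linked A \<Longrightarrow> Y \<subseteq> A \<Longrightarrow> Y \<noteq> {} \<Longrightarrow> Y \<noteq> A \<Longrightarrow> vboundary Y \<inter> A \<noteq> {}"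
  by (simp add: linked_def)

section \<open>The long-range kernel and its first moment\<close>

definition step_prob :: "nat \<Rightarrow> 'a \<Rightarrow> 'a \<Rightarrow> real" where
  "step_prob k x y = of_bool (inv x \<otimes> y \<in> word_ball (16 ^ k)) / card (word_ball (16 ^ k))"

text \<open>The scale of radius \<open>16 ^ k\<close> gets as weight the power
  \<open>- 3 / 2\<close> of its radius. The exponent 3/2 lies between 1 and 2: above 1 the first
  moment is finite, as \<open>16 / 64 < 1\<close>; below 2 smoothing profits from quadratic growth,
  as \<open>64 / 256 < 1\<close>. For a finite set the scales up to a suitable \<open>K\<close> are
  enough.\<close>

definition kernel :: "nat \<Rightarrow> 'a \<Rightarrow> 'a \<Rightarrow> real" where
  "kernel K x y = (\<Sum>k\<le>K. (1 / 64 ^ k) * step_prob k x y)"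

definition total_rate :: "nat \<Rightarrow> real" where
  "total_rate K = (\<Sum>k\<le>K. 1 / 64 ^ k)"

lemma card_word_ball_pos: "0 < card (word_ball n)"
  using one_in_word_ball finite_word_ball by (auto simp: card_gt_0_iff)

lemma step_prob_nonneg: "0 \<le> step_prob k x y"
  by (simp add: step_prob_def)

lemma kernel_nonneg: "0 \<le> kernel K x y"
  by (simp add: kernel_def sum_nonneg step_prob_nonneg)

lemma step_prob_sym: "x \<in> carrier G \<Longrightarrow> y \<in> carrier G \<Longrightarrow> step_prob k x y = step_prob k y x"
proof -
  have *: "inv y \<otimes> x \<in> word_ball n" if "x \<in> carrier G" "y \<in> carrier G" "inv x \<otimes> y \<in> word_ball n" for x y n
    using word_ball_inv[OF that(3)] that by (simp add: inv_mult_group)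
  assume "x \<in> carrier G" "y \<in> carrier G"
  then have "inv x \<otimes> y \<in> word_ball n \<longleftrightarrow> inv y \<otimes> x \<in> word_ball n" for n
    using * by blast
  then show ?thesis by (simp add: step_prob_def)
qed

lemma kernel_sym: "x \<in> carrier G \<Longrightarrow> y \<in> carrier G \<Longrightarrow> kernel K x y = kernel K y x"
  using step_prob_sym by (simp add: kernel_def)

lemma step_prob_sum:
  assumes V: "finite V" "V \<subseteq> carrier G" and x: "x \<in> carrier G"
  shows "1 - (\<Sum>y\<in>V. step_prob k x y)
       = card {g \<in> word_ball (16 ^ k). x \<otimes> g \<notin> V} / card (word_ball (16 ^ k))"
proof -
  let ?B = "word_ball (16 ^ k)"
  have bij: "bij_betw (\<lambda>g. x \<otimes> g) {g \<in> ?B. x \<otimes> g \<in> V} {y\<in>V. inv x \<otimes> y \<in> ?B}"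
  proof (rule bij_betw_byWitness[where f' = "\<lambda>y. inv x \<otimes> y"])
    show "\<forall>g\<in>{g \<in> ?B. x \<otimes> g \<in> V}. inv x \<otimes> (x \<otimes> g) = g"
      using x word_ball_closed by auto
    show "\<forall>y\<in>{y\<in>V. inv x \<otimes> y \<in> ?B}. x \<otimes> (inv x \<otimes> y) = y"
      using x V by auto
    show "(\<lambda>g. x \<otimes> g) ` {g \<in> ?B. x \<otimes> g \<in> V} \<subseteq> {y\<in>V. inv x \<otimes> y \<in> ?B}"
    proof (rule image_subsetI)
      fix g assume g: "g \<in> {g \<in> ?B. x \<otimes> g \<in> V}"
      then have "inv x \<otimes> (x \<otimes> g) = g" using x word_ball_closed by auto
      then show "x \<otimes> g \<in> {y\<in>V. inv x \<otimes> y \<in> ?B}" using g by auto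
    qed
    show "(\<lambda>y. inv x \<otimes> y) ` {y\<in>V. inv x \<otimes> y \<in> ?B} \<subseteq> {g \<in> ?B. x \<otimes> g \<in> V}"
    proof (rule image_subsetI)
      fix y assume y: "y \<in> {y\<in>V. inv x \<otimes> y \<in> ?B}"
      then have "x \<otimes> (inv x \<otimes> y) = y" using x V by auto
      then show "inv x \<otimes> y \<in> {g \<in> ?B. x \<otimes> g \<in> V}" using y by auto
    qed
  qed
  have "(\<Sum>y\<in>V. step_prob k x y) = (\<Sum>y\<in>{y\<in>V. inv x \<otimes> y \<in> ?B}. 1 / card ?B)"
    using sum_filter_weight[OF V(1), where P = "\<lambda>y. inv x \<otimes> y \<in> ?B" and a = "1 / card ?B" and w = "\<lambda>_. 1"]
    by (simp add: step_prob_def sum_divide_distrib)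
  also have "\<dots> = card {g \<in> ?B. x \<otimes> g \<in> V} / card ?B"
    using bij_betw_same_card[OF bij] by simp
  finally have 1: "(\<Sum>y\<in>V. step_prob k x y) = card {g \<in> ?B. x \<otimes> g \<in> V} / card ?B" .
  have "card ?B = card ({g \<in> ?B. x \<otimes> g \<in> V} \<union> {g \<in> ?B. x \<otimes> g \<notin> V})"
    by (rule arg_cong[where f = card]) auto
  also have "\<dots> = card {g \<in> ?B. x \<otimes> g \<in> V} + card {g \<in> ?B. x \<otimes> g \<notin> V}"
    using finite_word_ball by (intro card_Un_disjoint) auto
  finally have N: "real (card ?B) - card {g \<in> ?B. x \<otimes> g \<in> V} = card {g \<in> ?B. x \<otimes> g \<notin> V}"
    by linarith
  have "1 - card {g \<in> ?B. x \<otimes> g \<in> V} / card ?B = (real (card ?B) - card {g \<in> ?B. x \<otimes> g \<in> V}) / card ?B"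
    using card_word_ball_pos[of "16 ^ k"] by (simp only: diff_divide_distrib) simp
  then show ?thesis unfolding 1 N .
qed

lemma substochastic_step_prob:
  assumes "finite V" "V \<subseteq> carrier G"
  shows "substochastic V (step_prob k)"
proof
  show "(\<Sum>y\<in>V. step_prob k x y) \<le> 1" if "x \<in> V" for x
    using step_prob_sum[OF assms, of x k] that assms
    by (smt (verit, best) divide_nonneg_nonneg of_nat_0_le_iff subset_iff)
  show "step_prob k x y = step_prob k y x" if "x \<in> V" "y \<in> V" for x y
    using that assms by (intro step_prob_sym) auto
qed (use assms step_prob_nonneg in auto)

lemma kernel_sum_le:
  assumes "finite V" "V \<subseteq> carrier G" "x \<in> carrier G"
  shows "(\<Sum>y\<in>V. kernel K x y) \<le> total_rate K"
proof -
  have "(\<Sum>y\<in>V. step_prob k x y) \<le> 1" for k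
    using step_prob_sum[OF assms, of k] by (smt (verit, best) divide_nonneg_nonneg of_nat_0_le_iff)
  then have "(1 / 64 ^ k) * (\<Sum>y\<in>V. step_prob k x y) \<le> (1 / 64 ^ k) * 1" for k
    by (intro mult_left_mono) auto
  then have "(\<Sum>k\<le>K. (1 / 64 ^ k) * (\<Sum>y\<in>V. step_prob k x y)) \<le> (\<Sum>k\<le>K. (1 / 64 ^ k) * 1)"
    by (intro sum_mono)
  moreover have "(\<Sum>y\<in>V. kernel K x y) = (\<Sum>k\<le>K. (1 / 64 ^ k) * (\<Sum>y\<in>V. step_prob k x y))"
    unfolding kernel_def by (subst sum.swap) (simp only: sum_distrib_left)
  ultimately show ?thesis by (simp add: total_rate_def)
qed

text \<open>Only the scale \<open>k = 0\<close> is used, where the radius is 1. The bound does not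
  depend on \<open>K\<close> and becomes the constant \<open>c0\<close> of the network.\<close>

lemma kernel_step:
  assumes "inv x \<otimes> y \<in> S"
  shows "1 / card (word_ball 1) \<le> kernel K x y"
proof -
  have "1 / card (word_ball 1) = (1 / 64 ^ 0) * step_prob 0 x y"
    using assms S_sub_word_ball by (auto simp: step_prob_def)
  also have "\<dots> \<le> kernel K x y"
    unfolding kernel_def by (rule member_le_sum) (auto simp: step_prob_nonneg)
  finally show ?thesis .
qed

text \<open>Exits from \<open>A\<close> are counted jump by jump instead of point by point. Then
  \<open>card_exits_le\<close> gives the factor \<open>16 ^ k\<close> on scale \<open>k\<close>, and
  with the weights a geometric series of ratio 1/4 and sum at most 4/3 remains.\<close>

lemma sum_kernel_exit_le:
  assumes A: "finite A" "A \<subseteq> carrier G"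
  shows "(\<Sum>x\<in>A. total_rate K - (\<Sum>y\<in>A. kernel K x y)) \<le> 4 / 3 * card (vboundary A)"
proof -
  let ?n = "real (card (vboundary A))"
  have one: "(\<Sum>x\<in>A. 1 - (\<Sum>y\<in>A. step_prob k x y)) \<le> 16 ^ k * ?n" for k
  proof -
    let ?B = "word_ball (16 ^ k)"
    have "(\<Sum>x\<in>A. 1 - (\<Sum>y\<in>A. step_prob k x y)) = (\<Sum>x\<in>A. card {g \<in> ?B. x \<otimes> g \<notin> A}) / card ?B"
      using step_prob_sum[OF A] A by (simp add: sum_divide_distrib subset_iff)
    also have "(\<Sum>x\<in>A. card {g \<in> ?B. x \<otimes> g \<notin> A}) = (\<Sum>g\<in>?B. card {x \<in> A. x \<otimes> g \<notin> A})"
      by (rule sum_multicount_gen) (use A finite_word_ball in auto)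
    also have "real \<dots> \<le> (\<Sum>g\<in>?B. 16 ^ k * ?n)"
      unfolding of_nat_sum
    proof (rule sum_mono)
      fix g assume "g \<in> ?B"
      then have "card {x \<in> A. x \<otimes> g \<notin> A} \<le> 16 ^ k * card (vboundary A)"
        by (rule card_exits_le[OF A])
      then have "real (card {x \<in> A. x \<otimes> g \<notin> A}) \<le> real (16 ^ k * card (vboundary A))"
        by (rule of_nat_mono)
      then show "real (card {x \<in> A. x \<otimes> g \<notin> A}) \<le> 16 ^ k * ?n" by simp
    qed
    finally show ?thesis using card_word_ball_pos[of "16 ^ k"] by (simp add: field_simps)
  qed
  have "(\<Sum>x\<in>A. total_rate K - (\<Sum>y\<in>A. kernel K x y))
      = (\<Sum>x\<in>A. \<Sum>k\<le>K. (1 / 64 ^ k) * (1 - (\<Sum>y\<in>A. step_prob k x y)))"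
  proof (rule sum.cong[OF refl])
    fix x
    have "(\<Sum>y\<in>A. kernel K x y) = (\<Sum>k\<le>K. (1 / 64 ^ k) * (\<Sum>y\<in>A. step_prob k x y))"
      unfolding kernel_def by (subst sum.swap) (simp only: sum_distrib_left)
    then show "total_rate K - (\<Sum>y\<in>A. kernel K x y)
       = (\<Sum>k\<le>K. (1 / 64 ^ k) * (1 - (\<Sum>y\<in>A. step_prob k x y)))"
      by (simp add: total_rate_def right_diff_distrib sum_subtractf)
  qed
  also have "\<dots> = (\<Sum>k\<le>K. (1 / 64 ^ k) * (\<Sum>x\<in>A. 1 - (\<Sum>y\<in>A. step_prob k x y)))"
    by (subst sum.swap) (simp only: sum_distrib_left)
  also have "\<dots> \<le> (\<Sum>k\<le>K. (1 / 64 ^ k) * (16 ^ k * ?n))"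
    using one by (intro sum_mono mult_left_mono) auto
  also have "\<dots> = (\<Sum>k\<le>K. (1 / 4) ^ k) * ?n"
  proof -
    have "(1 / 64 ^ k) * (16 ^ k * ?n) = (1 / 4) ^ k * ?n" for k
    proof -
      have "(64::real) ^ k = 16 ^ k * 4 ^ k" by (simp flip: power_mult_distrib)
      then show ?thesis by (simp add: power_one_over)
    qed
    then show ?thesis by (simp only: sum_distrib_right)
  qed
  also have "\<dots> \<le> 4 / 3 * ?n"
  proof (rule mult_right_mono)
    have "(\<Sum>k\<le>K. (1 / 4 :: real) ^ k) = (1 - (1 / 4) ^ Suc K) / (1 - 1 / 4)"
      by (subst sum_gp0) auto
    then show "(\<Sum>k\<le>K. (1 / 4 :: real) ^ k) \<le> 4 / 3" by simp
  qed simp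
  finally show ?thesis .
qed

end

locale quadratic_growth = cayley +
  fixes \<tau> :: nat
  assumes \<tau>: "1 \<le> \<tau>" and growth: "\<And>r. r\<^sup>2 \<le> \<tau>\<^sup>2 * card (word_ball r)"
begin

section \<open>Isoperimetry from volume growth\<close>

lemma infinite_carrier: "infinite (carrier G)"
proof
  assume fin: "finite (carrier G)"
  define r where "r = \<tau>\<^sup>2 * card (carrier G) + 1"
  have "card (word_ball r) \<le> card (carrier G)"
    using fin word_ball_carrier by (intro card_mono) auto
  then have "r * r \<le> \<tau>\<^sup>2 * card (carrier G)"
    using growth[of r] by (metis le_trans mult_le_mono2 power2_eq_square)
  then have "r * r < r" by (simp add: r_def)
  then show False by (simp add: r_def)
qed

text \<open>A finite set without boundary would contain, with one point \<open>y\<close>, all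
  translates \<open>y \<otimes> g\<close>, hence a copy of the infinite group.\<close>

lemma edge_out:
  assumes Y: "finite Y" "Y \<subseteq> carrier G" "Y \<noteq> {}"
  shows "vboundary Y \<noteq> {}"
proof
  assume no: "vboundary Y = {}"
  obtain y where y: "y \<in> Y" using Y by auto
  have "y \<otimes> g \<in> Y" if "g \<in> word_ball n" for g n
    using that
  proof (induction n arbitrary: g)
    case 0
    then show ?case using y Y by auto
  next
    case (Suc n)
    then obtain h s where h: "g = h \<otimes> s" "h \<in> word_ball n" "s \<in> insert \<one> S" by auto
    have c: "h \<in> carrier G" "s \<in> carrier G" "y \<in> carrier G" using h word_ball_carrier S_sub y Y by auto
    have "y \<otimes> h \<otimes> s \<in> Y"
    proof (cases "s = \<one>")
      case True
      then show ?thesis using Suc.IH[OF h(2)] c by simp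
    next
      case False
      then show ?thesis using vboundaryI[OF Y(2) Suc.IH[OF h(2)], of s] h(3) no by blast
    qed
    then show ?case using h c by (simp add: m_assoc)
  qed
  then have "carrier G \<subseteq> (\<lambda>z. inv y \<otimes> z) ` Y"
  proof (intro subsetI)
    fix g assume g: "g \<in> carrier G" and *: "\<And>g n. g \<in> word_ball n \<Longrightarrow> y \<otimes> g \<in> Y"
    obtain n where "g \<in> word_ball n" using word_ball_exhausts[OF g] by auto
    then have "y \<otimes> g \<in> Y" by (rule *)
    moreover have "g = inv y \<otimes> (y \<otimes> g)" using g y Y by auto
    ultimately show "g \<in> (\<lambda>z. inv y \<otimes> z) ` Y" by blast
  qed
  then show False using infinite_carrier Y(1) finite_subset by blast
qed

text \<open>The argument of Coulhon and Saloff-Coste. If the ball of radius \<open>r\<close> has at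
  least \<open>2 * card A\<close> elements, at least half of them move any given point of
  \<open>A\<close> out of \<open>A\<close>; comparison with \<open>card_exits_le\<close> gives
  \<open>card A \<le> 2 * r * n\<close>. For the least such \<open>r\<close> the preceding ball has
  fewer than \<open>2 * card A\<close> elements, and quadratic growth turns this into a bound on
  \<open>r\<close> that is linear in \<open>n\<close>.\<close>

lemma isoperimetry:
  assumes A: "finite A" "A \<subseteq> carrier G"
  shows "card A \<le> 32 * \<tau>\<^sup>2 * (card (vboundary A))\<^sup>2"
proof (cases "A = {}")
  case False
  define n where "n = card (vboundary A)"
  have n: "1 \<le> n" unfolding n_def
    using edge_out[OF A False] finite_vboundary[OF A] by (simp add: Suc_le_eq card_gt_0_iff)
  have cA: "1 \<le> card A" using A False by (simp add: Suc_le_eq card_gt_0_iff)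
  define big where "big r = (2 * card A \<le> card (word_ball r))" for r
  have half: "card A \<le> 2 * r * n" if "big r" for r
  proof -
    let ?B = "word_ball r"
    have "card A * (card ?B - card A) = (\<Sum>x\<in>A. card ?B - card A)" by simp
    also have "\<dots> \<le> (\<Sum>x\<in>A. card {g\<in>?B. x \<otimes> g \<notin> A})"
    proof (rule sum_mono)
      fix x assume x: "x \<in> A"
      have "card {g\<in>?B. x \<otimes> g \<in> A} \<le> card A"
      proof (rule card_inj_on_le[where f = "\<lambda>g. x \<otimes> g"])
        show "inj_on (\<lambda>g. x \<otimes> g) {g\<in>?B. x \<otimes> g \<in> A}"
          using x A word_ball_carrier[of r] by (intro inj_onI) (auto simp: subset_iff)
      qed (use A in auto)
      moreover have "card ?B = card ({g\<in>?B. x \<otimes> g \<in> A} \<union> {g\<in>?B. x \<otimes> g \<notin> A})"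
        by (rule arg_cong[where f = card]) auto
      then have "card ?B \<le> card {g\<in>?B. x \<otimes> g \<in> A} + card {g\<in>?B. x \<otimes> g \<notin> A}"
        by (rule ord_eq_le_trans[OF _ card_Un_le])
      ultimately show "card ?B - card A \<le> card {g\<in>?B. x \<otimes> g \<notin> A}" by simp
    qed
    also have "\<dots> = (\<Sum>g\<in>?B. card {x\<in>A. x \<otimes> g \<notin> A})"
      by (rule sum_multicount_gen) (use A finite_word_ball in auto)
    also have "\<dots> \<le> (\<Sum>g\<in>?B. r * n)"
      unfolding n_def using card_exits_le[OF A] by (intro sum_mono) auto
    finally have "card A * (card ?B - card A) \<le> card ?B * (r * n)" by simp
    moreover have "card ?B \<le> 2 * (card ?B - card A)" using that by (simp add: big_def)
    then have "card A * card ?B \<le> 2 * (card A * (card ?B - card A))"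
      by (metis mult.left_commute mult_le_mono2)
    ultimately have "card A * card ?B \<le> 2 * (card ?B * (r * n))"
      by linarith
    then have "card A * card ?B \<le> (2 * r * n) * card ?B" by (simp only: mult_ac)
    then show ?thesis using card_word_ball_pos[of r] by simp
  qed
  have ex: "\<exists>r. big r"
  proof (rule exI)
    define r where "r = 2 * \<tau>\<^sup>2 * card A"
    have "\<tau>\<^sup>2 * (2 * card A) \<le> r * r"
      using cA \<tau> by (simp add: r_def)
    also have "\<dots> \<le> \<tau>\<^sup>2 * card (word_ball r)" using growth[of r] by (simp add: power2_eq_square)
    finally show "big r" using \<tau> by (simp add: big_def)
  qed
  define r where "r = (LEAST r. big r)"
  have r: "big r" unfolding r_def using ex by (rule LeastI_ex)
  have "r \<noteq> 0"
  proof
    assume "r = 0"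
    then have "2 * card A \<le> 1" using r by (simp add: big_def)
    then show False using cA by simp
  qed
  then obtain q where q: "r = Suc q" by (cases r) auto
  have "\<not> big q" using not_less_Least[of q big] q by (simp add: r_def)
  then have "card (word_ball q) \<le> 2 * card A" by (simp add: big_def)
  then have "card (word_ball q) \<le> 4 * r * n" using half[OF r] by simp
  then have "q\<^sup>2 \<le> \<tau>\<^sup>2 * (4 * r * n)"
    using growth[of q] by (meson le_trans mult_le_mono2)
  have rle: "r \<le> 16 * \<tau>\<^sup>2 * n"
  proof (cases "q = 0")
    case True
    then show ?thesis using q n \<tau> by (simp add: Suc_le_eq)
  next
    case False
    then have "r \<le> 2 * q" using q by simp
    then have "r * r \<le> 4 * q\<^sup>2" using mult_mono[of r "2 * q" r "2 * q"] by (simp add: power2_eq_square)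
    also have "\<dots> \<le> 16 * \<tau>\<^sup>2 * n * r" using \<open>q\<^sup>2 \<le> \<tau>\<^sup>2 * (4 * r * n)\<close> by (simp add: mult_ac)
    finally have "r * r \<le> 16 * \<tau>\<^sup>2 * n * r" .
    moreover have "0 < r" using q by simp
    ultimately show ?thesis by (metis mult_le_cancel2)
  qed
  have "card A \<le> 2 * r * n" using half[OF r] .
  also have "\<dots> \<le> 2 * (16 * \<tau>\<^sup>2 * n) * n" using rle by (intro mult_le_mono) auto
  finally show ?thesis by (simp add: n_def power2_eq_square)
qed simp

end

section \<open>Counting connected sets by their boundary\<close>

context quadratic_growth
begin

text \<open>The square of the factor \<open>2 * (1 + 16 * \<tau>)\<close> from
  \<open>sup_bound_of_forms\<close>, where 1 belongs to the first scale and
  \<open>16 * \<tau>\<close> to \<open>smoothing_sum_le\<close>.\<close>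

definition energy_const :: real where
  "energy_const = 4 * (1 + 16 * real \<tau>)\<^sup>2"

text \<open>Growth at radius \<open>16 ^ k\<close> gives balls of at least
  \<open>256 ^ k / \<tau>\<^sup>2\<close> elements, so the terms are at most
  \<open>8 * \<tau> / 2 ^ k\<close>.\<close>

lemma smoothing_sum_le:
  "(\<Sum>k<K. sqrt (1 / card (word_ball (16 ^ k)) / (1 / 64 ^ Suc k))) \<le> 16 * real \<tau>"
proof -
  have "sqrt (1 / card (word_ball (16 ^ k)) / (1 / 64 ^ Suc k)) \<le> 8 * \<tau> * (1 / 2) ^ k" for k
  proof (rule real_le_lsqrt)
    let ?N = "real (card (word_ball (16 ^ k)))"
    have N: "0 < ?N" using card_word_ball_pos by simp
    have "real ((16 ^ k)\<^sup>2) \<le> real (\<tau>\<^sup>2 * card (word_ball (16 ^ k)))"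
      using growth[of "16 ^ k"] by (rule of_nat_mono)
    then have g: "(256::real) ^ k \<le> real \<tau> ^ 2 * ?N"
      by (simp add: power_mult[symmetric] power2_eq_square mult.commute power_mult_distrib[symmetric])
    have p: "(256::real) ^ k = 64 ^ k * 4 ^ k" by (simp flip: power_mult_distrib)
    have "64 ^ Suc k / ?N = 64 * 64 ^ k / ?N" by simp
    also have "\<dots> \<le> 64 * (real \<tau> ^ 2 / 4 ^ k)"
      using g N unfolding p by (simp add: field_simps)
    also have "\<dots> = (8 * \<tau> * (1 / 2) ^ k)\<^sup>2"
    proof -
      have "((1 / 2 :: real) ^ k)\<^sup>2 = 1 / 4 ^ k"
        by (simp add: power2_eq_square power_mult_distrib[symmetric] power_one_over)
      then show ?thesis by (simp add: power_mult_distrib)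
    qed
    finally show "1 / ?N / (1 / 64 ^ Suc k) \<le> (8 * \<tau> * (1 / 2) ^ k)\<^sup>2" by simp
  qed simp_all
  then have "(\<Sum>k<K. sqrt (1 / card (word_ball (16 ^ k)) / (1 / 64 ^ Suc k))) \<le> (\<Sum>k<K. 8 * \<tau> * (1 / 2) ^ k)"
    by (intro sum_mono)
  also have "\<dots> = 8 * \<tau> * (\<Sum>k<K. (1 / 2) ^ k)" by (simp only: sum_distrib_left)
  also have "\<dots> \<le> 8 * real \<tau> * 2"
  proof -
    have "(\<Sum>k<K. (1 / 2 :: real) ^ k) \<le> 2" by (simp add: sum_gp_strict)
    from mult_left_mono[OF this, of "8 * real \<tau>"] show ?thesis by simp
  qed
  finally show ?thesis by simp
qed

text \<open>The bracket is the energy of the kernel on \<open>V\<close> with everything that leaves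
  \<open>V\<close> grounded. The constant is independent of \<open>V\<close>; \<open>K\<close> only
  has to reach a scale at which at most half of the smoothed mass can remain in
  \<open>V\<close>.\<close>

lemma transience:
  assumes V: "finite V" "V \<subseteq> carrier G" and z: "z \<in> V"
    and K: "2 * card V \<le> card (word_ball (16 ^ K))"
  shows "(v z)\<^sup>2 \<le> energy_const *
     (total_rate K * (\<Sum>x\<in>V. (v x)\<^sup>2) - (\<Sum>x\<in>V. \<Sum>y\<in>V. kernel K x y * v x * v y))"
proof -
  let ?w = "\<lambda>k. 1 / 64 ^ k :: real"
  let ?\<beta> = "\<lambda>k. 1 / real (card (word_ball (16 ^ k)))"
  let ?F = "total_rate K * (\<Sum>x\<in>V. (v x)\<^sup>2) - (\<Sum>x\<in>V. \<Sum>y\<in>V. kernel K x y * v x * v y)"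
  note sub = substochastic_step_prob[OF V]
  have F: "(\<Sum>k\<le>K. ?w k * substochastic.form V (step_prob k) v v) = ?F"
  proof -
    have 1: "(\<Sum>k\<le>K. ?w k * (\<Sum>x\<in>V. \<Sum>y\<in>V. step_prob k x y * v x * v y))
        = (\<Sum>x\<in>V. \<Sum>y\<in>V. kernel K x y * v x * v y)"
      unfolding kernel_def sum_distrib_left sum_distrib_right
      by (subst sum.swap, intro sum.cong refl, subst sum.swap) (simp add: mult.assoc)
    show ?thesis
      unfolding substochastic.form_def[OF sub] right_diff_distrib sum_subtractf 1
      by (simp add: total_rate_def sum_distrib_right power2_eq_square)
  qed
  have F0: "0 \<le> ?F"
    unfolding F[symmetric] using substochastic.form_nonneg[OF sub] by (intro sum_nonneg mult_nonneg_nonneg) auto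
  have "\<bar>v z\<bar> \<le> 2 * (1 / sqrt (?w 0) + (\<Sum>k<K. sqrt (?\<beta> k / ?w (Suc k)))) * sqrt ?F"
    unfolding F[symmetric]
  proof (rule sup_bound_of_forms[OF sub _ _ _ z])
    show "step_prob k x y \<le> ?\<beta> k" for k x y by (simp add: step_prob_def)
    show "real (card V) * ?\<beta> K \<le> 1 / 2"
    proof -
      have "real (2 * card V) \<le> real (card (word_ball (16 ^ K)))" using K by (rule of_nat_mono)
      then show ?thesis using card_word_ball_pos[of "16 ^ K"] by (simp add: field_simps)
    qed
  qed simp
  also have "\<dots> \<le> 2 * (1 + 16 * real \<tau>) * sqrt ?F"
    using smoothing_sum_le[of K] F0 by (intro mult_right_mono) auto
  finally have "\<bar>v z\<bar>\<^sup>2 \<le> (2 * (1 + 16 * real \<tau>) * sqrt ?F)\<^sup>2"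
    by (intro power_mono) auto
  also have "(2 * (1 + 16 * real \<tau>) * sqrt ?F)\<^sup>2 = energy_const * ?F"
    unfolding power_mult_distrib[of _ "sqrt ?F"] real_sqrt_pow2[OF F0] energy_const_def
    by (simp only: power_mult_distrib) simp
  finally show ?thesis by simp
qed

text \<open>The last clause forbids finite holes: a subset of the complement with its boundary in
  \<open>A\<close> is a union of components of the complement. It is also what grounds the subsets
  of the complement in the separated network.\<close>

definition admissible :: "'a set \<Rightarrow> bool" where
  "admissible A \<longleftrightarrow> finite A \<and> linked A \<and>
     (\<forall>Y\<subseteq>carrier G - A. finite Y \<and> Y \<noteq> {} \<longrightarrow> \<not> vboundary Y \<subseteq> A)"

lemma admissibleD:
  assumes "admissible A"
  shows "finite A" "A \<subseteq> carrier G" "\<one> \<in> A" "linked A"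
  using assms by (auto simp: admissible_def linked_def)

lemma admissible_coinfinite:
  "admissible A \<Longrightarrow> Y \<subseteq> carrier G - A \<Longrightarrow> finite Y \<Longrightarrow> Y \<noteq> {} \<Longrightarrow> \<not> vboundary Y \<subseteq> A"
  by (simp add: admissible_def)

lemma vboundaryE:
  assumes "z \<in> vboundary Y"
  obtains y where "y \<in> Y" "z \<in> carrier G" "z \<notin> Y" "inv y \<otimes> z \<in> S"
  using assms by (auto simp: vboundary_def)

text \<open>18 is the 6 of \<open>forest_sum_le\<close> times 3, where \<open>3 * n\<close> bounds
  the total grounding \<kappa>; the maximum is \<open>width\<close> for
  \<open>C = energy_const\<close> and the \<open>c0\<close> of \<open>kernel_step\<close>.\<close>

definition cut_rate :: real where
  "cut_rate = 18 * max (32 * energy_const) (4 / (1 / card (word_ball 1)))"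

definition killing :: "'a set \<Rightarrow> nat \<Rightarrow> 'a \<Rightarrow> real" where
  "killing \<Lambda> K x = total_rate K - (\<Sum>y\<in>\<Lambda>. kernel K x y)"

lemma killing_nonneg: "finite \<Lambda> \<Longrightarrow> \<Lambda> \<subseteq> carrier G \<Longrightarrow> x \<in> carrier G \<Longrightarrow> 0 \<le> killing \<Lambda> K x"
  using kernel_sum_le[of \<Lambda> x K] by (simp add: killing_def)

lemma killing_step:
  assumes \<Lambda>: "finite \<Lambda>" "\<Lambda> \<subseteq> carrier G" and x: "x \<in> carrier G"
    and z: "z \<in> carrier G - \<Lambda>" "inv x \<otimes> z \<in> S"
  shows "1 / card (word_ball 1) \<le> killing \<Lambda> K x"
proof -
  have "(\<Sum>y\<in>insert z \<Lambda>. kernel K x y) \<le> total_rate K"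
    using assms by (intro kernel_sum_le) auto
  then have "kernel K x z + (\<Sum>y\<in>\<Lambda>. kernel K x y) \<le> total_rate K"
    using \<Lambda>(1) z by simp
  then show ?thesis using kernel_step[OF z(2), of K] by (simp add: killing_def)
qed

text \<open>The separated network: the edges between \<open>A\<close> and its complement are redirected to the ground,
  where only the edge from \<open>a\<close> to \<open>b\<close> counts as permanent; the other ones form \<open>\<kappa>\<close>.\<close>

lemma forest_sum_le_separated:
  assumes A: "admissible A" and \<Lambda>: "finite \<Lambda>" "\<Lambda> \<subseteq> carrier G" "A \<union> vboundary A \<subseteq> \<Lambda>"
    and K: "2 * card \<Lambda> \<le> card (word_ball (16 ^ K))"
    and ab: "a \<in> A" "b \<in> vboundary A" "inv a \<otimes> b \<in> S"
  shows "forest_sum \<Lambda> (kernel K) (killing \<Lambda> K) \<le> exp (cut_rate * card (vboundary A)) *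
     (\<Sum>g | g \<in> forests \<Lambda> \<and> {x. (x, a) \<in> (Map.graph g)\<^sup>*} = A.
        \<Prod>x\<in>\<Lambda>. arrow_weight (kernel K) (killing \<Lambda> K) x (g x))"
proof -
  let ?k = "killing \<Lambda> K" and ?q = "kernel K" and ?Q = "total_rate K"
  define same where "same x y \<longleftrightarrow> (x \<in> A \<longleftrightarrow> y \<in> A)" for x y
  define c where "c x y = ?q x y * of_bool (same x y)" for x y
  define k0 where "k0 x = (if x \<in> A then (if x = a then ?q a b else 0) else ?k x)" for x
  define \<kappa> where "\<kappa> x = ?Q - (\<Sum>y\<in>\<Lambda>. c x y) - k0 x" for x
  let ?c0 = "1 / real (card (word_ball 1))"
  have A': "finite A" "A \<subseteq> carrier G" "A \<subseteq> \<Lambda>" using admissibleD[OF A] \<Lambda> by auto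
  have b: "b \<in> \<Lambda>" "b \<notin> A" "b \<in> carrier G" using ab \<Lambda> by (auto simp: vboundary_def)
  have split: "(\<Sum>y\<in>\<Lambda>. c x y) = (if x \<in> A then \<Sum>y\<in>A. ?q x y else \<Sum>y\<in>\<Lambda>-A. ?q x y)" for x
  proof -
    have "(\<Sum>y\<in>\<Lambda>. c x y) = (\<Sum>y\<in>\<Lambda>-A. c x y) + (\<Sum>y\<in>A. c x y)"
      using \<Lambda> A' by (intro sum.subset_diff) auto
    then show ?thesis by (auto simp: c_def same_def)
  qed
  have split_q: "(\<Sum>y\<in>\<Lambda>. ?q x y) = (\<Sum>y\<in>\<Lambda>-A. ?q x y) + (\<Sum>y\<in>A. ?q x y)" for x
    using \<Lambda> A' by (intro sum.subset_diff) auto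
  have total: "k0 x + \<kappa> x = ?Q - (\<Sum>y\<in>\<Lambda>. c x y)" for x by (simp add: \<kappa>_def)
  have k0_nn: "0 \<le> k0 x" if "x \<in> \<Lambda>" for x
    using that \<Lambda> killing_nonneg[OF \<Lambda>(1,2)] by (auto simp: k0_def kernel_nonneg)
  have \<kappa>_out: "\<kappa> x = (\<Sum>y\<in>A. ?q x y)" if "x \<in> \<Lambda> - A" for x
    using that split[of x] split_q[of x] by (simp add: \<kappa>_def k0_def killing_def)
  have \<kappa>_in: "\<kappa> x = ?Q - (\<Sum>y\<in>A. ?q x y) - k0 x" if "x \<in> A" for x
    using that split[of x] by (simp add: \<kappa>_def)
  \<comment> \<open>At \<open>a\<close> the rate to \<open>b\<close> has been moved to
    \<open>k0\<close>. It is part of the rate leaving \<open>A\<close>, since \<open>b\<close> lies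
    outside, so what remains is still nonnegative.\<close>
  have \<kappa>_nn: "0 \<le> \<kappa> x" if x: "x \<in> \<Lambda>" for x
  proof (cases "x \<in> A")
    case True
    have "(\<Sum>y\<in>insert b A. ?q x y) \<le> ?Q"
      using A' b x \<Lambda> by (intro kernel_sum_le) auto
    then have "?q x b + (\<Sum>y\<in>A. ?q x y) \<le> ?Q" using A' b by simp
    moreover have "k0 x \<le> ?q x b"
      using True kernel_nonneg[of K x b] by (auto simp: k0_def)
    ultimately show ?thesis unfolding \<kappa>_in[OF True] by linarith
  next
    case False
    then show ?thesis using x by (simp add: \<kappa>_out sum_nonneg kernel_nonneg)
  qed
  have c_sym: "c x y = c y x" if "x \<in> \<Lambda>" "y \<in> \<Lambda>" for x y
    using that \<Lambda> kernel_sym[of x y K] by (auto simp: c_def same_def)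
  have net: "network \<Lambda> c k0 \<kappa> energy_const ?c0"
  proof
    show "0 < energy_const" unfolding energy_const_def by (simp add: add_pos_nonneg)
    show "0 < ?c0" using card_word_ball_pos[of 1] by (simp del: word_ball.simps One_nat_def)
    show "0 \<le> c x y" for x y by (simp add: c_def kernel_nonneg)
    show "c x y = c y x" if "x \<in> \<Lambda>" "y \<in> \<Lambda>" for x y using that by (rule c_sym)
  next
    fix v :: "'a \<Rightarrow> real" and z assume z: "z \<in> \<Lambda>"
    \<comment> \<open>With the whole cut grounded the two sides do not interact: the energy of
      \<open>v\<close> is that of its restriction to \<open>A\<close> plus that of its restriction
      to the complement, each extended by zero. So transience survives with the same
      constant.\<close>
    define v1 where "v1 x = v x * of_bool (x \<in> A)" for x
    define v2 where "v2 x = v x * of_bool (x \<notin> A)" for x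
    let ?E = "\<lambda>v. ?Q * (\<Sum>x\<in>\<Lambda>. (v x)\<^sup>2) - (\<Sum>x\<in>\<Lambda>. \<Sum>y\<in>\<Lambda>. ?q x y * v x * v y)"
    have "(\<Sum>y\<in>\<Lambda>. \<Sum>z\<in>\<Lambda>. c y z * (v y - v z)\<^sup>2) / 2 + (\<Sum>y\<in>\<Lambda>. (k0 y + \<kappa> y) * (v y)\<^sup>2)
       = ?Q * (\<Sum>x\<in>\<Lambda>. (v x)\<^sup>2) - (\<Sum>x\<in>\<Lambda>. \<Sum>y\<in>\<Lambda>. c x y * v x * v y)"
    proof -
      have g: "(\<Sum>y\<in>\<Lambda>. \<Sum>z\<in>\<Lambda>. c y z * (v y - v z)\<^sup>2) / 2 = (\<Sum>y\<in>\<Lambda>. v y * (\<Sum>z\<in>\<Lambda>. c y z * (v y - v z)))"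
        using Green_identity[of \<Lambda> c v v] c_sym by (simp add: power2_eq_square mult.assoc)
      show ?thesis
        unfolding g total sum_distrib_left sum.distrib[symmetric] sum_subtractf[symmetric]
      proof (rule sum.cong[OF refl])
        fix y
        have "(\<Sum>n\<in>\<Lambda>. v y * (c y n * (v y - v n))) = (\<Sum>n\<in>\<Lambda>. c y n) * (v y)\<^sup>2 - (\<Sum>n\<in>\<Lambda>. c y n * v y * v n)"
          unfolding sum_distrib_right sum_subtractf[symmetric]
          by (intro sum.cong refl) (simp add: algebra_simps power2_eq_square)
        then show "(\<Sum>n\<in>\<Lambda>. v y * (c y n * (v y - v n))) + (?Q - (\<Sum>y'\<in>\<Lambda>. c y y')) * (v y)\<^sup>2
           = ?Q * (v y)\<^sup>2 - (\<Sum>y'\<in>\<Lambda>. c y y' * v y * v y')"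
          by (simp add: left_diff_distrib)
      qed
    qed
    also have "\<dots> = ?E v1 + ?E v2"
    proof -
      have "(v x)\<^sup>2 = (v1 x)\<^sup>2 + (v2 x)\<^sup>2" for x by (simp add: v1_def v2_def)
      moreover have "c x y * v x * v y = ?q x y * v1 x * v1 y + ?q x y * v2 x * v2 y" for x y
        by (simp add: c_def same_def v1_def v2_def)
      ultimately show ?thesis by (simp add: sum.distrib distrib_left)
    qed
    finally have eq: "(\<Sum>y\<in>\<Lambda>. \<Sum>z\<in>\<Lambda>. c y z * (v y - v z)\<^sup>2) / 2 + (\<Sum>y\<in>\<Lambda>. (k0 y + \<kappa> y) * (v y)\<^sup>2)
       = ?E v1 + ?E v2" .
    have C0: "0 < energy_const" unfolding energy_const_def by (simp add: add_pos_nonneg)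
    have tr: "(u z)\<^sup>2 \<le> energy_const * ?E u" for u
      by (rule transience[OF \<Lambda>(1,2) z K])
    have nn: "0 \<le> energy_const * ?E u" for u
      using tr[of u] zero_le_power2[of "u z"] by linarith
    have "(v z)\<^sup>2 \<le> energy_const * ?E v1 + energy_const * ?E v2"
    proof (cases "z \<in> A")
      case True
      then have "v z = v1 z" by (simp add: v1_def)
      then show ?thesis using tr[of v1] nn[of v2] by simp
    next
      case False
      then have "v z = v2 z" by (simp add: v2_def)
      then show ?thesis using tr[of v2] nn[of v1] by simp
    qed
    then show "(v z)\<^sup>2 \<le> energy_const * ((\<Sum>y\<in>\<Lambda>. \<Sum>z\<in>\<Lambda>. c y z * (v y - v z)\<^sup>2) / 2
        + (\<Sum>y\<in>\<Lambda>. (k0 y + \<kappa> y) * (v y)\<^sup>2))"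
      unfolding eq by (simp only: distrib_left)
  next
    fix Y assume Y: "Y \<subseteq> \<Lambda>" "Y \<noteq> {}"
    show "\<exists>y\<in>Y. ?c0 \<le> k0 y \<or> (\<exists>z\<in>\<Lambda> - Y. ?c0 \<le> c y z)"
    \<comment> \<open>A set containing \<open>A\<close> is grounded through \<open>a\<close> by the
      kept edge; one that splits \<open>A\<close> has an edge inside \<open>A\<close>, because
      \<open>A\<close> is linked; one disjoint from \<open>A\<close> has an edge to a point outside
      \<open>A\<close>, in \<Lambda> or beyond, because there are no finite holes.\<close>
    proof (cases "Y \<inter> A = {}")
      case False
      show ?thesis
      proof (cases "A \<subseteq> Y")
        case True
        have "k0 a = ?q a b" using ab by (simp add: k0_def)
        then have "?c0 \<le> k0 a" using kernel_step[OF ab(3), of K] by (simp only:)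
        then show ?thesis using True ab(1) by blast
      next
        case F: False
        then have "vboundary (Y \<inter> A) \<inter> A \<noteq> {}"
          using False F by (intro linkedD[OF admissibleD(4)[OF A]]) auto
        then obtain z where zA: "z \<in> A" "z \<in> vboundary (Y \<inter> A)" by blast
        from zA(2) obtain y where "y \<in> Y \<inter> A" "z \<notin> Y \<inter> A" "inv y \<otimes> z \<in> S"
          by (rule vboundaryE)
        with zA(1) have z: "z \<in> A" "z \<notin> Y" "y \<in> Y" "y \<in> A" "inv y \<otimes> z \<in> S" by auto
        have "c y z = ?q y z" using z by (simp add: c_def same_def)
        then have "?c0 \<le> c y z" using kernel_step[OF z(5), of K] by (simp only:)
        then show ?thesis using z A' by blast
      qed
    next
      case True
      have fY: "finite Y" using Y \<Lambda> finite_subset by blast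
      have "\<not> vboundary Y \<subseteq> A"
        using True Y \<Lambda>(2) fY by (intro admissible_coinfinite[OF A]) auto
      then obtain z where zA: "z \<notin> A" "z \<in> vboundary Y" by blast
      from zA(2) obtain y where "y \<in> Y" "z \<in> carrier G" "z \<notin> Y" "inv y \<otimes> z \<in> S"
        by (rule vboundaryE)
      with zA(1) have z: "z \<in> carrier G" "z \<notin> A" "z \<notin> Y" "y \<in> Y" "inv y \<otimes> z \<in> S"
        by auto
      have y: "y \<in> \<Lambda>" "y \<notin> A" "y \<in> carrier G" using z Y True \<Lambda> by auto
      show ?thesis
      proof (cases "z \<in> \<Lambda>")
        case True
        have "c y z = ?q y z" using y z by (simp add: c_def same_def)
        then have "?c0 \<le> c y z" using kernel_step[OF z(5), of K] by (simp only:)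
        then show ?thesis using z True by blast
      next
        case False
        then have "?c0 \<le> k0 y" using killing_step[OF \<Lambda>(1,2) y(3) DiffI[OF z(1) False] z(5), of K] y(2) by (simp only: k0_def if_False)
        then show ?thesis using z(4) by blast
      qed
    qed
  qed (use \<Lambda> k0_nn \<kappa>_nn in auto)
  \<comment> \<open>Cut edges are grounded at both ends, so the exit rate of \<open>A\<close> enters
    at most twice, and \<open>2 * 4 / 3 \<le> 3\<close>.\<close>
  have \<kappa>_sum: "(\<Sum>x\<in>\<Lambda>. \<kappa> x) \<le> 3 * card (vboundary A)"
  proof -
    let ?X = "\<Sum>x\<in>A. ?Q - (\<Sum>y\<in>A. ?q x y)"
    have "(\<Sum>x\<in>\<Lambda>. \<kappa> x) = (\<Sum>x\<in>\<Lambda>-A. \<kappa> x) + (\<Sum>x\<in>A. \<kappa> x)"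
      using \<Lambda> A' by (intro sum.subset_diff) auto
    also have "(\<Sum>x\<in>A. \<kappa> x) \<le> ?X"
      using k0_nn A' by (intro sum_mono) (auto simp: \<kappa>_in)
    also have "(\<Sum>x\<in>\<Lambda>-A. \<kappa> x) = (\<Sum>x\<in>A. \<Sum>y\<in>\<Lambda>-A. ?q x y)"
    proof -
      have "(\<Sum>x\<in>\<Lambda>-A. \<kappa> x) = (\<Sum>x\<in>\<Lambda>-A. \<Sum>y\<in>A. ?q y x)"
      proof (rule sum.cong[OF refl])
        fix x assume x: "x \<in> \<Lambda> - A"
        then have "?q x y = ?q y x" if "y \<in> A" for y
          using that A'(2) \<Lambda>(2) by (intro kernel_sym) auto
        then show "\<kappa> x = (\<Sum>y\<in>A. ?q y x)" by (simp add: \<kappa>_out[OF x])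
      qed
      then show ?thesis by (subst sum.swap)
    qed
    also have "\<dots> \<le> ?X"
    proof (rule sum_mono)
      fix x assume "x \<in> A"
      then have "(\<Sum>y\<in>\<Lambda>. ?q x y) \<le> ?Q" using A' \<Lambda> by (intro kernel_sum_le) auto
      then show "(\<Sum>y\<in>\<Lambda>-A. ?q x y) \<le> ?Q - (\<Sum>y\<in>A. ?q x y)" using split_q[of x] by simp
    qed
    also have "?X + ?X \<le> 3 * card (vboundary A)"
      using sum_kernel_exit_le[OF A'(1,2), of K] by simp
    finally show ?thesis by simp
  qed
  have "forest_sum \<Lambda> ?q ?k \<le> forest_sum \<Lambda> (\<lambda>x y. ?q x y * of_bool (same x y))
           (\<lambda>x. ?k x + (\<Sum>y\<in>\<Lambda>. ?q x y * of_bool (\<not> same x y)))"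
    using \<Lambda> killing_nonneg[OF \<Lambda>(1,2)] by (intro forest_sum_le_absorbed) (auto simp: kernel_nonneg)
  also have "(\<lambda>x. ?k x + (\<Sum>y\<in>\<Lambda>. ?q x y * of_bool (\<not> same x y))) = (\<lambda>x. k0 x + \<kappa> x)"
  proof
    fix x
    have "(\<Sum>y\<in>\<Lambda>. ?q x y) = (\<Sum>y\<in>\<Lambda>. ?q x y * of_bool (\<not> same x y)) + (\<Sum>y\<in>\<Lambda>. c x y)"
      unfolding c_def sum.distrib[symmetric] by (intro sum.cong refl) auto
    then show "?k x + (\<Sum>y\<in>\<Lambda>. ?q x y * of_bool (\<not> same x y)) = k0 x + \<kappa> x"
      unfolding total killing_def by simp
  qed
  also have "forest_sum \<Lambda> (\<lambda>x y. ?q x y * of_bool (same x y)) (\<lambda>x. k0 x + \<kappa> x) = forest_sum \<Lambda> c (\<lambda>x. k0 x + \<kappa> x)"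
    by (simp add: c_def[abs_def])
  also have "\<dots> \<le> exp (6 * network.width energy_const ?c0 * (\<Sum>x\<in>\<Lambda>. \<kappa> x)) * forest_sum \<Lambda> c k0"
    by (rule network.forest_sum_le[OF net])
  also have "\<dots> \<le> exp (cut_rate * card (vboundary A)) *
     (\<Sum>g | g \<in> forests \<Lambda> \<and> {x. (x, a) \<in> (Map.graph g)\<^sup>*} = A. \<Prod>x\<in>\<Lambda>. arrow_weight ?q ?k x (g x))"
  proof (rule mult_mono)
    let ?w = "network.width energy_const ?c0"
    have w: "0 < ?w" by (rule network.width(1)[OF net])
    have "6 * ?w * (\<Sum>x\<in>\<Lambda>. \<kappa> x) \<le> 6 * ?w * (3 * card (vboundary A))"
      using \<kappa>_sum w by (intro mult_left_mono) auto
    also have "\<dots> = cut_rate * card (vboundary A)"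
      unfolding cut_rate_def network.width_def[OF net] by (simp only: mult_ac) (simp del: word_ball.simps One_nat_def)
    finally show "exp (6 * ?w * (\<Sum>x\<in>\<Lambda>. \<kappa> x)) \<le> exp (cut_rate * card (vboundary A))" by simp
    have "c = (\<lambda>x y. ?q x y * of_bool (x \<in> A \<longleftrightarrow> y \<in> A))"
      "k0 = (\<lambda>x. if x \<in> A then (if x = a then ?q a b else 0) else ?k x)"
      by (auto simp: c_def same_def k0_def fun_eq_iff)
    then show "forest_sum \<Lambda> c k0 \<le> (\<Sum>g | g \<in> forests \<Lambda> \<and> {x. (x, a) \<in> (Map.graph g)\<^sup>*} = A.
        \<Prod>x\<in>\<Lambda>. arrow_weight ?q ?k x (g x))"
      using \<Lambda> A' ab b killing_nonneg[OF \<Lambda>(1,2)]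
      by (simp only:, intro forest_sum_le_past) (auto simp: kernel_nonneg)
    show "0 \<le> forest_sum \<Lambda> c k0"
      using network.positive[OF net, of 0] by simp
  qed simp
  finally show ?thesis .
qed

lemma card_admissible_le:
  assumes fam: "finite \<A>" "\<And>A. A \<in> \<A> \<Longrightarrow> admissible A \<and> card (vboundary A) = n"
  shows "card \<A> \<le> 32 * \<tau>\<^sup>2 * n\<^sup>2 * exp (cut_rate * n)"
proof -
  \<comment> \<open>The region has to contain every set of the family with its boundary, hence a
    finite family; the unit keeps it nonempty when the family is empty.\<close>
  define \<Lambda> where "\<Lambda> = (\<Union>A\<in>\<A>. A \<union> vboundary A) \<union> {\<one>}"
  define m where "m = 32 * \<tau>\<^sup>2 * n\<^sup>2"
  have adm: "finite A" "A \<subseteq> carrier G" "\<one> \<in> A" if "A \<in> \<A>" for A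
    using admissibleD[of A] fam(2)[OF that] by auto
  have vb: "vboundary A \<subseteq> carrier G" for A by (auto simp: vboundary_def)
  have \<Lambda>: "finite \<Lambda>" "\<Lambda> \<subseteq> carrier G"
  proof -
    show "finite \<Lambda>" unfolding \<Lambda>_def using fam(1) adm finite_vboundary by auto
    have "A \<union> vboundary A \<subseteq> carrier G" if "A \<in> \<A>" for A
      using adm(2)[OF that] vb[of A] by blast
    then show "\<Lambda> \<subseteq> carrier G" unfolding \<Lambda>_def by blast
  qed
  obtain K where K: "2 * card \<Lambda> \<le> card (word_ball (16 ^ K))"
  proof -
    define r where "r = 2 * \<tau>\<^sup>2 * card \<Lambda>"
    have "card \<Lambda> \<noteq> 0" using \<Lambda> by (auto simp: \<Lambda>_def)
    then have "\<tau>\<^sup>2 * (2 * card \<Lambda>) \<le> r * r" using \<tau> by (simp add: r_def)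
    also have "\<dots> \<le> \<tau>\<^sup>2 * card (word_ball r)" using growth[of r] by (simp add: power2_eq_square)
    finally have "2 * card \<Lambda> \<le> card (word_ball r)" using \<tau> by simp
    moreover have "r \<le> 16 ^ r"
    proof -
      have "r < 2 ^ r" by (rule less_exp)
      moreover have "(2::nat) ^ r \<le> 16 ^ r" by (rule power_mono) auto
      ultimately show ?thesis by simp
    qed
    then have "card (word_ball r) \<le> card (word_ball (16 ^ r))"
      using finite_word_ball word_ball_mono by (intro card_mono)
    ultimately show ?thesis using that le_trans by blast
  qed
  let ?W = "\<lambda>g. \<Prod>x\<in>\<Lambda>. arrow_weight (kernel K) (killing \<Lambda> K) x (g x)"
  let ?Z = "forest_sum \<Lambda> (kernel K) (killing \<Lambda> K)"
  let ?past = "\<lambda>g a. {x. (x, a) \<in> (Map.graph g)\<^sup>*}"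
  have "\<exists>a b. a \<in> A \<and> b \<in> vboundary A \<and> inv a \<otimes> b \<in> S" if "A \<in> \<A>" for A
    using edge_out[of A] adm[OF that] by (auto simp: vboundary_def)
  then obtain \<rho> \<sigma> where \<rho>: "\<And>A. A \<in> \<A> \<Longrightarrow> \<rho> A \<in> A \<and> \<sigma> A \<in> vboundary A \<and> inv (\<rho> A) \<otimes> \<sigma> A \<in> S"
    by metis
  have Zpos: "0 < ?Z"
  proof (rule forest_sum_pos)
    fix Y assume Y: "Y \<subseteq> \<Lambda>" "Y \<noteq> {}"
    then have "vboundary Y \<noteq> {}" using \<Lambda> by (intro edge_out) (auto intro: finite_subset)
    then obtain y z where yz: "y \<in> Y" "z \<in> carrier G" "z \<notin> Y" "inv y \<otimes> z \<in> S"
      by (auto simp: vboundary_def)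
    have pos: "0 < 1 / real (card (word_ball 1))"
      using card_word_ball_pos[of 1] by (simp del: word_ball.simps One_nat_def)
    show "\<exists>y\<in>Y. 0 < killing \<Lambda> K y \<or> (\<exists>z\<in>\<Lambda> - Y. 0 < kernel K y z)"
    proof (cases "z \<in> \<Lambda>")
      case True
      then show ?thesis using yz kernel_step[OF yz(4), of K] pos by (meson DiffI less_le_trans)
    next
      case False
      then show ?thesis using yz Y \<Lambda> killing_step[OF \<Lambda>, of y z K] pos
        by (meson DiffI less_le_trans subset_iff)
    qed
  qed (use \<Lambda> kernel_nonneg killing_nonneg[OF \<Lambda>] subsetD[OF \<Lambda>(2)] in auto)
  have nn: "0 \<le> ?W g" if "g \<in> forests \<Lambda>" for g
    using that \<Lambda> killing_nonneg[OF \<Lambda>]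
    by (intro prod_nonneg ballI arrow_weight_nonneg[of g \<Lambda>]) (auto simp: kernel_nonneg)
  have "card \<A> * ?Z = (\<Sum>A\<in>\<A>. ?Z)" by simp
  also have "\<dots> \<le> (\<Sum>A\<in>\<A>. exp (cut_rate * n) * (\<Sum>g | g \<in> forests \<Lambda> \<and> ?past g (\<rho> A) = A. ?W g))"
  proof (rule sum_mono)
    fix A assume "A \<in> \<A>"
    then show "?Z \<le> exp (cut_rate * n) * (\<Sum>g | g \<in> forests \<Lambda> \<and> ?past g (\<rho> A) = A. ?W g)"
      using forest_sum_le_separated[of A \<Lambda> K "\<rho> A" "\<sigma> A"] fam(2)[of A] \<rho>[of A] \<Lambda> K
      by (auto simp: \<Lambda>_def)
  qed
  also have "\<dots> = exp (cut_rate * n) * (\<Sum>A\<in>\<A>. \<Sum>g\<in>forests \<Lambda>. ?W g * of_bool (?past g (\<rho> A) = A))"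
  proof -
    have "(\<Sum>g | g \<in> forests \<Lambda> \<and> ?past g (\<rho> A) = A. ?W g)
        = (\<Sum>g\<in>forests \<Lambda>. ?W g * of_bool (?past g (\<rho> A) = A))" for A
      using sum_filter_weight[OF finite_forests[OF \<Lambda>(1)],
          where P = "\<lambda>g. ?past g (\<rho> A) = A" and a = 1 and w = ?W]
      by (simp only: mult_1)
    then show ?thesis by (simp only: sum_distrib_left)
  qed
  \<comment> \<open>After the exchange of sums each forest is weighted by the number of sets of the
    family that it realizes, which \<open>card_pasts_le\<close> and \<open>isoperimetry\<close>
    bound by \<open>m\<close>.\<close>
  also have "(\<Sum>A\<in>\<A>. \<Sum>g\<in>forests \<Lambda>. ?W g * of_bool (?past g (\<rho> A) = A))
      = (\<Sum>g\<in>forests \<Lambda>. ?W g * card {A\<in>\<A>. ?past g (\<rho> A) = A})"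
  proof -
    have "(\<Sum>A\<in>\<A>. ?W g * of_bool (?past g (\<rho> A) = A)) = ?W g * card {A\<in>\<A>. ?past g (\<rho> A) = A}" for g
      using sum_filter_weight[OF fam(1), where P = "\<lambda>A. ?past g (\<rho> A) = A" and a = 1 and w = "\<lambda>_. 1"]
      by (simp add: sum_distrib_left[symmetric])
    then show ?thesis by (subst sum.swap) simp
  qed
  also have "\<dots> \<le> (\<Sum>g\<in>forests \<Lambda>. ?W g * m)"
  proof (rule sum_mono)
    fix g assume g: "g \<in> forests \<Lambda>"
    have "card {A\<in>\<A>. ?past g (\<rho> A) = A} \<le> m"
    proof (rule card_pasts_le[where z = \<one> and g = g and \<rho> = \<rho>])
      fix A assume A: "A \<in> {A\<in>\<A>. ?past g (\<rho> A) = A}"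
      then show "\<one> \<in> A \<and> A = ?past g (\<rho> A)" using adm[of A] by auto
      show "finite A \<and> card A \<le> m"
        using A adm[of A] isoperimetry[of A] fam(2)[of A] by (auto simp: m_def)
    qed
    then show "?W g * card {A\<in>\<A>. ?past g (\<rho> A) = A} \<le> ?W g * m"
      using nn[OF g] by (intro mult_left_mono) auto
  qed
  also have "\<dots> = ?Z * m" by (simp add: forest_sum_def sum_distrib_right)
  finally have "card \<A> * ?Z \<le> (m * exp (cut_rate * n)) * ?Z" by (simp add: mult_ac)
  then show ?thesis using Zpos by (simp add: m_def)
qed

end

section \<open>The Peierls argument\<close>

context cayley
begin

lemma vboundary_iff:
  "z \<in> vboundary Y \<longleftrightarrow> z \<in> carrier G \<and> z \<notin> Y \<and> (\<exists>y\<in>Y. inv y \<otimes> z \<in> S)"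
  by (auto simp: vboundary_def)

lemma step_sym:
  assumes "x \<in> carrier G" "y \<in> carrier G" "inv x \<otimes> y \<in> S" shows "inv y \<otimes> x \<in> S"
  using S_inv[OF assms(3)] assms(1,2) by (simp add: inv_mult_group)

lemma cluster_carrier:
  assumes "\<one> \<in> carrier G" shows "open_cluster (cayley_graph G S) \<omega> \<one> \<subseteq> carrier G"
proof
  fix y assume "y \<in> open_cluster (cayley_graph G S) \<omega> \<one>"
  then have "(\<one>, y) \<in> (cayley_graph G S \<inter> {(u, v). \<omega> u \<and> \<omega> v})\<^sup>*"
    by (simp add: open_cluster_def split: if_splits)
  then show "y \<in> carrier G"
    using assms by (induction rule: rtrancl_induct) (auto simp: cayley_graph_def)
qed

lemma cluster_linked:
  assumes "\<omega> \<one>"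
  defines "C \<equiv> open_cluster (cayley_graph G S) \<omega> \<one>"
  shows "linked C" "\<And>z. z \<in> C \<Longrightarrow> \<omega> z" "\<And>z. z \<in> vboundary C \<Longrightarrow> \<not> \<omega> z"
proof -
  let ?r = "cayley_graph G S \<inter> {(u, v). \<omega> u \<and> \<omega> v}"
  have C: "y \<in> C \<longleftrightarrow> (\<one>, y) \<in> ?r\<^sup>*" for y
    using assms(1) by (simp add: C_def open_cluster_def)
  have one: "\<one> \<in> C" by (simp add: C)
  have next_C: "z \<in> C" if "y \<in> C" "(y, z) \<in> ?r" for y z
    using that unfolding C by (rule rtrancl_into_rtrancl)
  show op: "\<omega> z" if "z \<in> C" for z
    using that[unfolded C] assms(1) by (induction rule: rtrancl_induct) auto
  have carr: "C \<subseteq> carrier G" unfolding C_def by (rule cluster_carrier) simp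
  have r: "(y, z) \<in> ?r \<longleftrightarrow> y \<in> carrier G \<and> z \<in> carrier G \<and> inv y \<otimes> z \<in> S \<and> \<omega> y \<and> \<omega> z" for y z
    by (auto simp: cayley_graph_def)
  show "\<not> \<omega> z" if z: "z \<in> vboundary C" for z
  proof
    assume "\<omega> z"
    from z obtain y where y: "y \<in> C" "inv y \<otimes> z \<in> S" "z \<in> carrier G" "z \<notin> C" by (auto simp: vboundary_iff)
    then have "(y, z) \<in> ?r" using carr op \<open>\<omega> z\<close> unfolding r by blast
    then show False using next_C y by blast
  qed
  have "vboundary Y \<inter> C \<noteq> {}" if Y: "Y \<subseteq> C" "Y \<noteq> {}" "Y \<noteq> C" for Y
  proof
    assume no: "vboundary Y \<inter> C = {}"
    have same: "z \<in> Y \<longleftrightarrow> y \<in> Y" if yz: "y \<in> C" "(y, z) \<in> ?r" for y z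
    proof -
      have s: "y \<in> carrier G" "z \<in> carrier G" "inv y \<otimes> z \<in> S" "z \<in> C"
        using yz(2)[unfolded r] next_C[OF yz] by blast+
      have "inv z \<otimes> y \<in> S" by (rule step_sym[OF s(1-3)])
      then have "y \<in> vboundary Y" if "z \<in> Y" "y \<notin> Y" using that s by (auto simp: vboundary_iff)
      moreover have "z \<in> vboundary Y" if "y \<in> Y" "z \<notin> Y" using that s by (auto simp: vboundary_iff)
      ultimately show ?thesis using no yz s by blast
    qed
    have "y \<in> Y \<longleftrightarrow> \<one> \<in> Y" if "y \<in> C" for y
      using that[unfolded C]
    proof (induction rule: rtrancl_induct)
      case (step y z)
      then show ?case using same[of y z] C by blast
    qed simp
    then show False using Y by blast
  qed
  then show "linked C" using carr one by (simp add: linked_def)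
qed

text \<open>Together with \<open>cluster_linked\<close> this turns the event that the cluster is a
  given finite linked set into a condition on finitely many sites, which makes the infinite cluster
  a measurable event.\<close>

lemma cluster_eqI:
  assumes A: "linked A" and op: "\<And>z. z \<in> A \<Longrightarrow> \<omega> z" and cl: "\<And>z. z \<in> vboundary A \<Longrightarrow> \<not> \<omega> z"
  shows "open_cluster (cayley_graph G S) \<omega> \<one> = A"
proof -
  define C where "C = open_cluster (cayley_graph G S) \<omega> \<one>"
  have one: "\<one> \<in> A" "A \<subseteq> carrier G" using A by (auto simp: linked_def)
  have C: "y \<in> C \<longleftrightarrow> (\<one>, y) \<in> (cayley_graph G S \<inter> {(u, v). \<omega> u \<and> \<omega> v})\<^sup>*" for y
    using op[OF one(1)] by (simp add: C_def open_cluster_def)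
  have "y \<in> A" if "y \<in> C" for y
    using that[unfolded C]
  proof (induction rule: rtrancl_induct)
    case (step y z)
    then have "z \<in> carrier G" "inv y \<otimes> z \<in> S" "\<omega> z" by (auto simp: cayley_graph_def)
    then show ?case using step.IH cl[of z] by (auto simp: vboundary_iff)
  qed (rule one)
  then have sub: "C \<subseteq> A" by blast
  have "C = A"
  proof (rule ccontr)
    assume "C \<noteq> A"
    moreover have "C \<noteq> {}" using C[of \<one>] by auto
    ultimately have "vboundary C \<inter> A \<noteq> {}" using linkedD[OF A sub] by blast
    then obtain z y where z: "z \<in> A" "z \<notin> C" "y \<in> C" "inv y \<otimes> z \<in> S" "z \<in> carrier G"
      by (auto simp: vboundary_iff)
    then have "y \<in> A" using sub by blast
    then have "(y, z) \<in> cayley_graph G S \<inter> {(u, v). \<omega> u \<and> \<omega> v}"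
      using z op one by (auto simp: cayley_graph_def)
    with z(3)[unfolded C] have "z \<in> C" unfolding C by (rule rtrancl_into_rtrancl)
    then show False using z by blast
  qed
  then show ?thesis by (simp add: C_def)
qed

lemma countable_carrier: "countable (carrier G)"
proof -
  have "carrier G = (\<Union>n. word_ball n)"
    using word_ball_exhausts word_ball_carrier by blast
  moreover have "countable (\<Union>n. word_ball n)"
    using finite_word_ball by (intro countable_UN) (auto intro: countable_finite)
  ultimately show ?thesis by simp
qed

end

section \<open>Cylinder events of site percolation\<close>

lemma prob_space_site_percolation: "prob_space (site_percolation V p)"
  unfolding site_percolation_def by (intro prob_space_PiM prob_space_measure_pmf)

lemma sets_site_open:
  assumes "x \<in> V" shows "{\<omega> \<in> space (site_percolation V p). \<omega> x} \<in> sets (site_percolation V p)"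
proof -
  have "(\<lambda>\<omega>. \<omega> x) -` {True} \<inter> space (site_percolation V p) \<in> sets (site_percolation V p)"
    unfolding site_percolation_def
    using assms by (intro measurable_sets[OF measurable_component_singleton]) auto
  then show ?thesis by (simp add: vimage_def Int_def conj_commute)
qed

lemma sets_sites_closed:
  assumes "finite B" "B \<subseteq> V"
  shows "{\<omega> \<in> space (site_percolation V p). \<forall>z\<in>B. \<not> \<omega> z} \<in> sets (site_percolation V p)"
  using assms sets_site_open[of _ V p]
  by (intro sets.sets_Collect_finite_All sets.sets_Collect_neg) auto

lemma sets_sites_open:
  assumes "finite B" "B \<subseteq> V"
  shows "{\<omega> \<in> space (site_percolation V p). \<forall>z\<in>B. \<omega> z} \<in> sets (site_percolation V p)"
  using assms sets_site_open[of _ V p]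
  by (intro sets.sets_Collect_finite_All) auto

lemma measure_sites_closed:
  assumes p: "0 \<le> p" "p \<le> 1" and B: "finite B" "B \<subseteq> V"
  shows "measure (site_percolation V p) {\<omega> \<in> space (site_percolation V p). \<forall>z\<in>B. \<not> \<omega> z}
    = (1 - p) ^ card B"
proof -
  interpret product_prob_space "\<lambda>_. measure_pmf (bernoulli_pmf p)" V
    by (rule product_prob_spaceI) (rule prob_space_measure_pmf)
  have eq: "{\<omega> \<in> space (site_percolation V p). \<forall>z\<in>B. \<not> \<omega> z}
     = prod_emb V (\<lambda>_. measure_pmf (bernoulli_pmf p)) B (PiE B (\<lambda>_. {False}))"
    using B by (auto simp: site_percolation_def prod_emb_def space_PiM PiE_iff restrict_def extensional_def fun_eq_iff)
  have "emeasure (site_percolation V p) {\<omega> \<in> space (site_percolation V p). \<forall>z\<in>B. \<not> \<omega> z}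
     = (\<Prod>i\<in>B. emeasure (measure_pmf (bernoulli_pmf p)) {False})"
    unfolding eq using B unfolding site_percolation_def by (intro emeasure_PiM_emb) auto
  also have "\<dots> = ennreal ((1 - p) ^ card B)"
    using p by (simp add: emeasure_pmf_single ennreal_power)
  finally show ?thesis using p by (simp add: measure_def)
qed

context quadratic_growth
begin

text \<open>Filling the holes of \<open>C\<close>: a largest linked set with boundary inside that of \<open>C\<close> exists by the
  isoperimetric inequality, and it has no finite holes.\<close>

lemma admissible_filling:
  assumes C: "finite C" "linked C"
  shows "\<exists>A. admissible A \<and> vboundary A \<subseteq> vboundary C"
proof -
  define P where "P A \<longleftrightarrow> finite A \<and> linked A \<and> vboundary A \<subseteq> vboundary C" for A
  have fin_vC: "finite (vboundary C)" using C by (intro finite_vboundary) (auto simp: linked_def)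
  have bound: "card A < Suc (32 * \<tau>\<^sup>2 * (card (vboundary C))\<^sup>2)" if "P A" for A
  proof -
    have "card A \<le> 32 * \<tau>\<^sup>2 * (card (vboundary A))\<^sup>2"
      using that by (intro isoperimetry) (auto simp: P_def linked_def)
    also have "\<dots> \<le> 32 * \<tau>\<^sup>2 * (card (vboundary C))\<^sup>2"
      using that fin_vC by (intro mult_le_mono power_mono card_mono) (auto simp: P_def)
    finally show ?thesis by simp
  qed
  have "\<exists>A. P A \<and> (\<forall>B. P B \<longrightarrow> card B \<le> card A)"
    using C bound by (intro ex_has_greatest_nat[of P C]) (auto simp: P_def)
  then obtain A where A: "P A" and max: "\<And>B. P B \<Longrightarrow> card B \<le> card A" by blast
  have lA: "linked A" "finite A" "A \<subseteq> carrier G" using A by (auto simp: P_def linked_def)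
  have "\<not> vboundary Y \<subseteq> A" if Y: "Y \<subseteq> carrier G - A" "finite Y" "Y \<noteq> {}" for Y
  proof
    assume sub: "vboundary Y \<subseteq> A"
    \<comment> \<open>Filling the hole \<open>Y\<close> gives a larger candidate: the neighbours of
      \<open>Y\<close> lie in \<open>A \<union> Y\<close>, so no new boundary arises.\<close>
    let ?A = "A \<union> Y"
    have Yout: "z \<in> A \<union> Y" if "y \<in> Y" "z \<in> carrier G" "inv y \<otimes> z \<in> S" for y z
      using that sub by (auto simp: vboundary_iff subset_iff)
    have "vboundary ?A \<subseteq> vboundary A"
    proof
      fix z assume "z \<in> vboundary ?A"
      then obtain y where y: "y \<in> ?A" "z \<in> carrier G" "z \<notin> ?A" "inv y \<otimes> z \<in> S"
        by (rule vboundaryE)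
      then have "y \<in> A" using Yout[of y z] by blast
      then show "z \<in> vboundary A" using y unfolding vboundary_iff by blast
    qed
    moreover have "linked ?A"
      unfolding linked_def
    proof (intro conjI allI impI)
      show "?A \<subseteq> carrier G" "\<one> \<in> ?A" using lA Y by (auto simp: linked_def)
      fix Q assume Q: "Q \<subseteq> ?A" "Q \<noteq> {} \<and> Q \<noteq> ?A"
      show "vboundary Q \<inter> ?A \<noteq> {}"
      proof (cases "Q \<inter> A = {}")
        case True
        then have QY: "Q \<subseteq> Y" using Q by blast
        then have "vboundary Q \<noteq> {}" using Q Y by (intro edge_out) (auto intro: finite_subset)
        then obtain z where "z \<in> vboundary Q" by blast
        moreover from this have "z \<in> ?A" using QY Yout by (auto simp: vboundary_iff)
        ultimately show ?thesis by blast
      next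
        case F: False
        show ?thesis
        proof (cases "A \<subseteq> Q")
          case False
          then have "vboundary (Q \<inter> A) \<inter> A \<noteq> {}"
            using F by (intro linkedD[OF lA(1)]) auto
          then obtain z where zA: "z \<in> A" "z \<in> vboundary (Q \<inter> A)" by blast
          from zA(2) obtain y where "y \<in> Q \<inter> A" "z \<in> carrier G" "z \<notin> Q \<inter> A" "inv y \<otimes> z \<in> S"
            by (rule vboundaryE)
          then have "z \<in> vboundary Q" using zA(1) unfolding vboundary_iff by blast
          then show ?thesis using zA(1) by blast
        next
          case True
          \<comment> \<open>\<open>Q\<close> contains \<open>A\<close>, so the rest
            \<open>?R\<close> lies in \<open>Y\<close>. An edge leaving \<open>?R\<close> stays in
            \<open>?A\<close> and hence ends in \<open>Q\<close>; read backwards it leads from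
            \<open>Q\<close> to a point of \<open>?A\<close> outside \<open>Q\<close>.\<close>
          let ?R = "?A - Q"
          have R: "?R \<subseteq> Y" "?R \<noteq> {}" using True Q by blast+
          then have "vboundary ?R \<noteq> {}" using Y by (intro edge_out) (auto intro: finite_subset)
          then obtain z where z: "z \<in> vboundary ?R" by blast
          then obtain y where y: "y \<in> ?R" "z \<in> carrier G" "z \<notin> ?R" "inv y \<otimes> z \<in> S"
            by (auto elim: vboundaryE)
          have yc: "y \<in> carrier G" using y(1) R(1) Y(1) by blast
          have "z \<in> ?A" using Yout[OF _ y(2,4)] y(1) R(1) by blast
          then have "z \<in> Q" using y(3) by blast
          moreover have "inv z \<otimes> y \<in> S" using step_sym[OF yc y(2,4)] .
          ultimately have "y \<in> vboundary Q" using y(1) yc unfolding vboundary_iff by blast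
          then show ?thesis using y(1) by blast
        qed
      qed
    qed
    ultimately have "P ?A" using A Y by (auto simp: P_def)
    then have "card ?A \<le> card A" by (rule max)
    moreover have "card ?A = card A + card Y"
      using lA Y by (intro card_Un_disjoint) auto
    moreover have "0 < card Y" using Y by (simp add: card_gt_0_iff)
    ultimately show False by simp
  qed
  then have "admissible A" using lA by (simp add: admissible_def)
  then show ?thesis using A by (auto simp: P_def)
qed

theorem percolation_prob_pos:
  "\<exists>p. 0 \<le> p \<and> p < 1 \<and> 0 < percolation_prob (carrier G) (cayley_graph G S) p \<one>"
proof -
  \<comment> \<open>By \<open>n\<^sup>2 \<le> 4 ^ n\<close> and \<open>n \<ge> 1\<close> the bound
    of \<open>card_admissible_le\<close> is at most \<open>L ^ n\<close>, with 128 as the product of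
    32 and 4. The choice of \<open>p\<close> makes \<open>L * (1 - p)\<close> equal to
    \<open>1 / 4\<close>.\<close>
  define L where "L = 128 * real \<tau> ^ 2 * exp cut_rate"
  define p where "p = 1 - 1 / (4 * L)"
  define \<A> where "\<A> n = {A. admissible A \<and> card (vboundary A) = n}" for n
  define M where "M = site_percolation (carrier G) p"
  let ?cl = "\<lambda>\<omega>. open_cluster (cayley_graph G S) \<omega> \<one>"
  let ?Z = "\<lambda>A. {\<omega> \<in> space M. \<forall>z\<in>vboundary A. \<not> \<omega> z}"
  have cr: "0 \<le> cut_rate"
    unfolding cut_rate_def energy_const_def by (simp add: le_max_iff_disj)
  have \<tau>2: "1 \<le> real \<tau> ^ 2" using \<tau> by (intro one_le_power) simp
  have L1: "1 \<le> L"
  proof -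
    have "1 * 1 \<le> (128 * real \<tau> ^ 2) * exp cut_rate"
      using \<tau>2 cr by (intro mult_mono) auto
    then show ?thesis by (simp add: L_def)
  qed
  have p: "0 \<le> p" "p \<le> 1" "p < 1" "1 - p = 1 / (4 * L)"
    using L1 by (auto simp: p_def field_simps)
  interpret prob_space M unfolding M_def by (rule prob_space_site_percolation)
  have card_A: "finite (\<A> n) \<and> card (\<A> n) \<le> L ^ n" if n: "1 \<le> n" for n
  proof -
    let ?b = "nat \<lfloor>L ^ n\<rfloor>"
    have "card F \<le> ?b" if F: "F \<subseteq> \<A> n" "finite F" for F
    proof -
      have "real (card F) \<le> real (32 * \<tau>\<^sup>2 * n\<^sup>2) * exp (cut_rate * n)"
        using F by (intro card_admissible_le) (auto simp: \<A>_def)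
      also have "\<dots> = (32 * real \<tau> ^ 2) * real n ^ 2 * exp (cut_rate * n)" by simp
      also have "\<dots> \<le> (32 * real \<tau> ^ 2) ^ n * 4 ^ n * exp cut_rate ^ n"
      proof (intro mult_mono)
        have "(32 * real \<tau> ^ 2) ^ 1 \<le> (32 * real \<tau> ^ 2) ^ n"
          using n \<tau>2 by (intro power_increasing) auto
        then show "32 * real \<tau> ^ 2 \<le> (32 * real \<tau> ^ 2) ^ n" by simp
        have "n < 2 ^ n" by (rule less_exp)
        then have "real n < real (2 ^ n)" by (simp only: of_nat_less_iff)
        then have "real n < 2 ^ n" by simp
        then have "real n ^ 2 \<le> (2 ^ n) ^ 2" by (intro power_mono) auto
        also have "(2 ^ n) ^ 2 = (4::real) ^ n"
          by (simp add: power2_eq_square power_mult_distrib[symmetric])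
        finally show "real n ^ 2 \<le> 4 ^ n" .
        show "exp (cut_rate * n) \<le> exp cut_rate ^ n"
          using exp_of_nat_mult[of n cut_rate] by (simp add: mult.commute)
      qed auto
      also have "\<dots> = (32 * real \<tau> ^ 2 * 4 * exp cut_rate) ^ n" by (simp only: power_mult_distrib)
      also have "32 * real \<tau> ^ 2 * 4 * exp cut_rate = L" by (simp add: L_def)
      finally show ?thesis using L1 by (simp add: le_nat_floor)
    qed
    \<comment> \<open>\<open>card_admissible_le\<close> speaks of finite families only; its bound is
      uniform over them, so the whole class is finite.\<close>
    from finite_if_finite_subsets_card_bdd[of "\<A> n" ?b, OF this]
    have "finite (\<A> n)" "card (\<A> n) \<le> ?b" by auto
    then show ?thesis using L1 by (simp add: le_nat_iff le_floor_iff)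
  qed
  have vb: "finite (vboundary A)" "vboundary A \<subseteq> carrier G" if "admissible A" for A
    using finite_vboundary[of A] admissibleD[OF that] by (auto simp: vboundary_def)
  have Z_sets: "?Z A \<in> sets M" if "admissible A" for A
    unfolding M_def using vb[OF that] by (rule sets_sites_closed)
  \<comment> \<open>The index is shifted because the boundary of a nonempty finite set is nonempty.
    The series then sums to \<open>1 / 3\<close>, which together with at most \<open>1 / 4\<close>
    for a closed unit stays below 1.\<close>
  define U where "U n = (\<Union>A\<in>\<A> (Suc n). ?Z A)" for n
  have U_sets: "U n \<in> sets M" for n
    unfolding U_def using card_A[of "Suc n"] Z_sets by (intro sets.finite_UN) (auto simp: \<A>_def)
  have U_le: "measure M (U n) \<le> (1 / 4) ^ Suc n" for n
  proof -
    have "measure M (U n) \<le> (\<Sum>A\<in>\<A> (Suc n). measure M (?Z A))"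
      unfolding U_def using card_A[of "Suc n"] Z_sets
      by (intro finite_measure_subadditive_finite) (auto simp: \<A>_def)
    also have "\<dots> = (\<Sum>A\<in>\<A> (Suc n). (1 - p) ^ Suc n)"
    proof (rule sum.cong[OF refl])
      fix A assume A: "A \<in> \<A> (Suc n)"
      then show "measure M (?Z A) = (1 - p) ^ Suc n"
        using measure_sites_closed[OF p(1,2) vb[of A]] by (simp add: M_def \<A>_def)
    qed
    also have "\<dots> = card (\<A> (Suc n)) * (1 - p) ^ Suc n" by simp
    also have "\<dots> \<le> L ^ Suc n * (1 - p) ^ Suc n"
      using card_A[of "Suc n"] p(2) by (intro mult_right_mono zero_le_power) auto
    also have "\<dots> = (L * (1 - p)) ^ Suc n" by (simp only: power_mult_distrib)
    also have "L * (1 - p) = 1 / 4" using L1 p(4) by simp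
    finally show ?thesis .
  qed
  have geo: "(\<lambda>n. (1 / 4 :: real) ^ Suc n) sums (1 / 3)"
    using sums_mult[OF geometric_sums[of "1 / 4 :: real"], of "1 / 4"] by simp
  have summ: "summable (\<lambda>n. measure M (U n))"
    using U_le by (intro summable_comparison_test'[OF sums_summable[OF geo], of 0]) auto
  have UN_le: "measure M (\<Union>n. U n) \<le> 1 / 3"
  proof -
    have "measure M (\<Union>n. U n) \<le> suminf (\<lambda>n. measure M (U n))"
      using U_sets summ by (intro finite_measure_subadditive_countably) auto
    also have "\<dots> \<le> suminf (\<lambda>n. (1 / 4) ^ Suc n)"
      using U_le summ sums_summable[OF geo] by (intro suminf_le) auto
    also have "\<dots> = 1 / 3" using geo by (simp add: sums_iff)
    finally show ?thesis .
  qed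
  let ?N = "{\<omega> \<in> space M. \<forall>z\<in>{\<one>}. \<not> \<omega> z}"
  have N: "?N \<in> sets M" unfolding M_def by (rule sets_sites_closed) auto
  have N_le: "measure M ?N \<le> 1 / 4"
  proof -
    have "measure M ?N = 1 - p"
      using measure_sites_closed[OF p(1,2), of "{\<one>}" "carrier G"] by (simp add: M_def)
    also have "\<dots> \<le> 1 / 4" unfolding p(4) using L1 by (intro frac_le) auto
    finally show ?thesis .
  qed
  let ?I = "{\<omega> \<in> space M. infinite (?cl \<omega>)}"
  have cover: "space M - (?N \<union> (\<Union>n. U n)) \<subseteq> ?I"
  proof
    fix \<omega> assume \<omega>: "\<omega> \<in> space M - (?N \<union> (\<Union>n. U n))"
    then have op: "\<omega> \<one>" by auto
    have "infinite (?cl \<omega>)"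
    proof
      assume "finite (?cl \<omega>)"
      then obtain A where A: "admissible A" "vboundary A \<subseteq> vboundary (?cl \<omega>)"
        using admissible_filling cluster_linked(1)[of \<omega>, OF op] by blast
      have "A \<noteq> {}" "A \<subseteq> carrier G" "finite A" using admissibleD[OF A(1)] by auto
      then have "card (vboundary A) \<noteq> 0" using edge_out[of A] vb[OF A(1)] by auto
      then obtain n where "card (vboundary A) = Suc n" by (cases "card (vboundary A)") auto
      then have "A \<in> \<A> (Suc n)" using A by (simp add: \<A>_def)
      moreover have "\<omega> \<in> ?Z A" using A(2) \<omega> cluster_linked(3)[of \<omega>, OF op] by auto
      ultimately have "\<omega> \<in> U n" unfolding U_def by blast
      then show False using \<omega> by auto
    qed
    then show "\<omega> \<in> ?I" using \<omega> by simp
  qed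
  \<comment> \<open>The group has countably many finite subsets, so the event of a finite cluster is
    a countable union of events on finitely many sites.\<close>
  have I_sets: "?I \<in> sets M"
  proof -
    let ?F = "{A. finite A \<and> A \<subseteq> carrier G}"
    have part: "{\<omega> \<in> space M. ?cl \<omega> = A} \<in> sets M" if A: "A \<in> ?F" for A
    proof (cases "A = {}")
      case True
      have "?cl \<omega> = {} \<longleftrightarrow> \<not> \<omega> \<one>" for \<omega> by (auto simp: open_cluster_def)
      then show ?thesis using N True by simp
    next
      case False
      show ?thesis
      proof (cases "linked A")
        case True
        have "{\<omega> \<in> space M. ?cl \<omega> = A}
            = {\<omega> \<in> space M. \<forall>z\<in>A. \<omega> z} \<inter> {\<omega> \<in> space M. \<forall>z\<in>vboundary A. \<not> \<omega> z}"
        proof (intro equalityI subsetI)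
          fix \<omega> assume \<omega>: "\<omega> \<in> {\<omega> \<in> space M. ?cl \<omega> = A}"
          then have op: "\<omega> \<one>" using False by (auto simp: open_cluster_def split: if_splits)
          have cl: "?cl \<omega> = A" using \<omega> by simp
          have "\<forall>z\<in>A. \<omega> z" "\<forall>z\<in>vboundary A. \<not> \<omega> z"
            using cluster_linked(2,3)[of \<omega>, OF op] unfolding cl by blast+
          then show "\<omega> \<in> {\<omega> \<in> space M. \<forall>z\<in>A. \<omega> z} \<inter> {\<omega> \<in> space M. \<forall>z\<in>vboundary A. \<not> \<omega> z}"
            using \<omega> by simp
        next
          fix \<omega> assume "\<omega> \<in> {\<omega> \<in> space M. \<forall>z\<in>A. \<omega> z} \<inter> {\<omega> \<in> space M. \<forall>z\<in>vboundary A. \<not> \<omega> z}"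
          then show "\<omega> \<in> {\<omega> \<in> space M. ?cl \<omega> = A}"
            using cluster_eqI[OF True, of \<omega>] by auto
        qed
        moreover have "finite (vboundary A)" "vboundary A \<subseteq> carrier G"
          using A finite_vboundary[of A] by (auto simp: vboundary_def)
        ultimately show ?thesis
          unfolding M_def using A sets_sites_open[of A "carrier G" p] sets_sites_closed[of "vboundary A" "carrier G" p]
          by auto
      next
        case F: False
        have "?cl \<omega> \<noteq> A" for \<omega>
          using F False cluster_linked(1)[of \<omega>] by (auto simp: open_cluster_def)
        then show ?thesis by simp
      qed
    qed
    have "(\<Union>A\<in>?F. {\<omega> \<in> space M. ?cl \<omega> = A}) \<in> sets M"
      using part countable_Collect_finite_subset[OF countable_carrier] by (intro sets.countable_UN') auto
    moreover have "?I = space M - (\<Union>A\<in>?F. {\<omega> \<in> space M. ?cl \<omega> = A})"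
      using cluster_carrier by auto
    ultimately show ?thesis by auto
  qed
  have "measure M (?N \<union> (\<Union>n. U n)) \<le> measure M ?N + measure M (\<Union>n. U n)"
    using N U_sets by (intro measure_Un_le) auto
  then have "measure M (?N \<union> (\<Union>n. U n)) \<le> 7 / 12" using N_le UN_le by simp
  moreover have "measure M (space M - (?N \<union> (\<Union>n. U n))) = 1 - measure M (?N \<union> (\<Union>n. U n))"
    using N U_sets by (intro prob_compl) auto
  moreover have "measure M (space M - (?N \<union> (\<Union>n. U n))) \<le> measure M ?I"
    using cover I_sets by (rule finite_measure_mono)
  ultimately have "0 < measure M ?I" by simp
  then show ?thesis
    using p by (intro exI[of _ p]) (simp add: percolation_prob_def M_def)
qed

end

section \<open>Quadratic growth\<close>

text \<open>If one more generator reached no new coset, the cosets met so far would be closed under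
  right multiplication by generators and hence be all of them, of which there are infinitely
  many.\<close>

lemma (in cayley) card_cosets_ge:
  assumes T: "subgroup T G" and inf: "infinite (rcosets T)"
  shows "r + 1 \<le> card ((\<lambda>x. T #> x) ` word_ball r)"
proof (induction r)
  case 0
  then show ?case by simp
next
  case (Suc r)
  let ?N = "\<lambda>r. (\<lambda>x. T #> x) ` word_ball r"
  have fin: "finite (?N n)" for n using finite_word_ball by simp
  have Tc: "T \<subseteq> carrier G" using T by (rule subgroup.subset)
  have sub: "?N r \<subseteq> ?N (Suc r)" using word_ball_mono[of r "Suc r"] by auto
  have "?N (Suc r) \<noteq> ?N r"
  proof
    assume eq: "?N (Suc r) = ?N r"
    have closed: "D #> s \<in> ?N r" if D: "D \<in> ?N r" "s \<in> insert \<one> S" for D s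
    proof -
      obtain x where x: "x \<in> word_ball r" "D = T #> x" using D by auto
      have "D #> s = T #> (x \<otimes> s)"
        using x D(2) word_ball_closed S_sub Tc by (auto simp: coset_mult_assoc)
      moreover have "x \<otimes> s \<in> word_ball (Suc r)" using x D(2) by auto
      ultimately show ?thesis using eq by blast
    qed
    have all: "T #> x \<in> ?N r" if "x \<in> word_ball n" for x n
      using that
    proof (induction n arbitrary: x)
      case 0
      then show ?case using one_in_word_ball by auto
    next
      case (Suc n)
      then obtain h s where h: "x = h \<otimes> s" "h \<in> word_ball n" "s \<in> insert \<one> S" by auto
      have "T #> x = (T #> h) #> s"
        using h word_ball_closed S_sub Tc by (auto simp: coset_mult_assoc)
      then show ?case using closed[OF Suc.IH[OF h(2)] h(3)] by simp
    qed
    have "rcosets T \<subseteq> ?N r"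
    proof
      fix D assume "D \<in> rcosets T"
      then obtain x where "x \<in> carrier G" "D = T #> x" by (auto simp: RCOSETS_def)
      then show "D \<in> ?N r" using word_ball_exhausts[of x] all by blast
    qed
    then show False using inf fin finite_subset by blast
  qed
  then have "?N r \<subset> ?N (Suc r)" using sub by (intro psubsetI) (simp_all only: not_sym)
  then have "card (?N r) < card (?N (Suc r))" by (rule psubset_card_mono[OF fin])
  then show ?case using Suc by simp
qed

lemma (in cayley) quadratic_growth_of_cyclic:
  assumes t: "t \<in> T" and T: "subgroup T G" and inf: "infinite (rcosets T)"
    and inj: "\<And>i j :: nat. t [^] i = t [^] j \<Longrightarrow> i = j"
  shows "\<exists>\<tau>. quadratic_growth G S \<tau>"
proof -
  have Tc: "T \<subseteq> carrier G" using T by (rule subgroup.subset)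
  then have tc: "t \<in> carrier G" using t by blast
  obtain l where l: "t \<in> word_ball l" using word_ball_exhausts[OF tc] by blast
  have pow: "t [^] j \<in> word_ball (l * j)" for j :: nat
  proof (induction j)
    case (Suc j)
    from word_ball_mult[OF Suc l] show ?case by (simp add: add.commute)
  qed (simp add: one_in_word_ball)
  have powT: "t [^] j \<in> T" for j :: nat
    using T t by (induction j) (auto simp: subgroup.one_closed subgroup.m_closed)
  have big: "(r + 1)\<^sup>2 \<le> card (word_ball ((l + 1) * r))" for r
  proof -
    \<comment> \<open>\<open>R\<close> picks one element of the ball from each coset that the ball
      meets; \<open>t [^] j \<otimes> x\<close> then determines the coset, hence \<open>x\<close>,
      and after that \<open>j\<close>.\<close>
    obtain R where R: "R \<subseteq> word_ball r" "inj_on (\<lambda>x. T #> x) R"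
      "(\<lambda>x. T #> x) ` word_ball r = (\<lambda>x. T #> x) ` R"
      using subset_image_inj[of "(\<lambda>x. T #> x) ` word_ball r" "\<lambda>x. T #> x" "word_ball r"] by auto
    have "r + 1 \<le> card R"
      using card_cosets_ge[OF T inf, of r] R by (simp add: card_image)
    then have "(r + 1) * (r + 1) \<le> card ({0..r} \<times> R)"
      by (simp add: card_cartesian_product del: mult_Suc mult_Suc_right)
    also have "\<dots> \<le> card (word_ball ((l + 1) * r))"
    proof (rule card_inj_on_le[where f = "\<lambda>(j :: nat, x). t [^] j \<otimes> x"])
      show "inj_on (\<lambda>(j :: nat, x). t [^] j \<otimes> x) ({0..r} \<times> R)"
      proof (rule inj_onI, clarify)
        fix i j :: nat and x y assume x: "x \<in> R" and y: "y \<in> R" and eq: "t [^] i \<otimes> x = t [^] j \<otimes> y"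
        have c: "x \<in> carrier G" "y \<in> carrier G" using x y R(1) word_ball_closed by auto
        have "t [^] i \<otimes> x \<in> T #> x" unfolding r_coset_def using powT[of i] by blast
        moreover have "t [^] i \<otimes> x \<in> T #> y" unfolding eq r_coset_def using powT[of j] by blast
        ultimately have "T #> x = T #> y"
          using repr_independence[OF _ _ T] c by blast
        then have "x = y" using R(2) x y by (auto simp: inj_on_def)
        moreover from this have "t [^] i = t [^] j" using eq c tc by simp
        ultimately show "i = j \<and> x = y" using inj by simp
      qed
      show "(\<lambda>(j :: nat, x). t [^] j \<otimes> x) ` ({0..r} \<times> R) \<subseteq> word_ball ((l + 1) * r)"
      proof clarify
        fix j x assume j: "j \<in> {0..r}" and x: "x \<in> R"
        have "t [^] j \<otimes> x \<in> word_ball (l * j + r)"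
          using pow[of j] x R(1) by (intro word_ball_mult) auto
        then show "t [^] j \<otimes> x \<in> word_ball ((l + 1) * r)"
          by (rule word_ball_le) (use j in simp)
      qed
    qed (rule finite_word_ball)
    finally show ?thesis by (simp add: power2_eq_square)
  qed
  have "quadratic_growth G S (l + 1)"
  proof unfold_locales
    fix R
    \<comment> \<open>The radius is rounded down to a multiple of \<open>l + 1\<close>; the
      additional 1 in \<open>(r + 1)\<^sup>2\<close> pays for the rounding, so \<tau> can be
      \<open>l + 1\<close> itself.\<close>
    define r where "r = R div (l + 1)"
    have "R < (l + 1) * (r + 1)"
      unfolding r_def using dividend_less_div_times[of "l + 1" R] by (simp add: mult.commute)
    then have "R\<^sup>2 \<le> ((l + 1) * (r + 1))\<^sup>2" by (intro power_mono) auto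
    also have "\<dots> = (l + 1)\<^sup>2 * (r + 1)\<^sup>2" by (rule power_mult_distrib)
    also have "\<dots> \<le> (l + 1)\<^sup>2 * card (word_ball ((l + 1) * r))" using big by (rule mult_le_mono2)
    also have "card (word_ball ((l + 1) * r)) \<le> card (word_ball R)"
      using finite_word_ball by (intro card_mono word_ball_mono) (simp_all add: r_def del: mult_Suc)
    finally show "R\<^sup>2 \<le> (l + 1)\<^sup>2 * card (word_ball R)" by simp
  qed simp
  then show ?thesis by blast
qed

theorem corollary3:
  fixes G :: "('a, 'b) monoid_scheme"
  assumes "group G"
    and "finitely_generated G"
    and "admits_virtual_character G"
    and "\<not> (\<exists>H. finite_index_subgroup H G \<and> infinite H \<and> cyclic_group (G\<lparr>carrier := H\<rparr>))"
  shows "\<forall>S. finite S \<and> symmetric_generating_set G S \<longrightarrow> p_c G S < 1"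
proof (intro allI impI)
  fix S assume S: "finite S \<and> symmetric_generating_set G S"
  interpret cayley G S
    using S \<open>group G\<close> by (auto simp: cayley_def cayley_axioms_def symmetric_generating_set_def)
  obtain H f where H: "subgroup H G" and f: "f \<in> hom (G\<lparr>carrier := H\<rparr>) real_group"
    and "\<exists>t\<in>H. f t \<noteq> 0"
    using assms(3) by (auto simp: admits_virtual_character_def finite_index_subgroup_def character_def)
  then obtain t where t: "t \<in> H" "f t \<noteq> 0" by blast
  have tc: "t \<in> carrier G" using t H subgroup.subset by blast
  have f_mult: "f (x \<otimes>\<^bsub>G\<^esub> y) = f x + f y" if "x \<in> H" "y \<in> H" for x y
    using hom_mult[OF f, of x y] that by (simp add: real_group_def)
  have f_pow: "t [^]\<^bsub>G\<^esub> i \<in> H \<and> f (t [^]\<^bsub>G\<^esub> i) = i * f t" for i :: nat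
  proof (induction i)
    case 0
    have "f \<one>\<^bsub>G\<^esub> = 0"
      using f_mult[of "\<one>\<^bsub>G\<^esub>" "\<one>\<^bsub>G\<^esub>"] H by (simp add: subgroup.one_closed)
    then show ?case using H by (simp add: subgroup.one_closed)
  next
    case (Suc i)
    then show ?case
      using t(1) f_mult[of "t [^]\<^bsub>G\<^esub> i" t] H by (simp add: subgroup.m_closed algebra_simps)
  qed
  have inj: "i = j" if "t [^]\<^bsub>G\<^esub> i = t [^]\<^bsub>G\<^esub> j" for i j :: nat
  proof -
    have "i * f t = f (t [^]\<^bsub>G\<^esub> i)" using f_pow by simp
    also have "\<dots> = j * f t" unfolding that using f_pow by simp
    finally have "i * f t = j * f t" .
    then show ?thesis using t(2) by auto
  qed
  \<comment> \<open>The character tells the powers of \<open>t\<close> apart, so this cyclic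
    subgroup is infinite and, by hypothesis, cannot have finite index.\<close>
  define T where "T = generate G {t}"
  have T: "subgroup T G" unfolding T_def using tc by (intro generate_is_subgroup) simp
  have tT: "t \<in> T" unfolding T_def by (rule generate.incl) simp
  have powT: "t [^]\<^bsub>G\<^esub> i \<in> T" for i :: nat
    using T tT by (induction i) (auto simp: subgroup.one_closed subgroup.m_closed)
  have "infinite T"
  proof
    assume "finite T"
    then have "finite (range (\<lambda>i::nat. t [^]\<^bsub>G\<^esub> i))"
      using powT by (elim finite_subset[rotated]) auto
    moreover have "inj (\<lambda>i::nat. t [^]\<^bsub>G\<^esub> i)" using inj by (rule injI)
    ultimately show False using finite_imageD by blast
  qed
  moreover have "cyclic_group (G\<lparr>carrier := T\<rparr>)"
  proof -
    have "subgroup_generated G {t} = G\<lparr>carrier := T\<rparr>"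
      using tc by (simp add: subgroup_generated_def T_def)
    then show ?thesis using cyclic_group_generated[of t] by simp
  qed
  ultimately have "infinite (rcosets\<^bsub>G\<^esub> T)"
    using assms(4) T by (auto simp: finite_index_subgroup_def)
  then obtain \<tau> where "quadratic_growth G S \<tau>"
    using quadratic_growth_of_cyclic[OF tT T _ inj] by blast
  then interpret quadratic_growth G S \<tau> .
  obtain p where p: "0 \<le> p" "p < 1" "0 < percolation_prob (carrier G) (cayley_graph G S) p \<one>\<^bsub>G\<^esub>"
    using percolation_prob_pos by blast
  then have "p_c G S \<le> ereal p"
    unfolding p_c_def by (intro Inf_lower imageI) auto
  also have "\<dots> < 1" using p(2) by simp
  finally show "p_c G S < 1" .
qed

end
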